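(* Let $f\in\mathcal{H}^1$. Then: (i) the functions $H_f,J^f_k:\mathcal{O}\times\mathcal{H}^{1,+}_0\to\mathbb{C}$ are analytic for any $k\ge1$; (ii) the Hamiltonian vector fields $X_{H_f},X_{J^f_k}:\mathcal{O}\times\mathcal{H}^{1,+}_0\to\mathcal{H}^{1,+}_0\times\mathcal{H}^{1,+}_0$, $k\ge1$, are well defined and analytic maps.
   Context: All spaces are complex, and "analytic" means complex-analytic between (open subsets of) complex Banach spaces. $\mathbb{T}=\mathbb{R}/\mathbb{Z}$, $f_k=(f)_k=\int_0^1 f(y)e^{-2\pi i k y}\,dy$, $\langle k\rangle:=|k|$ for $k\neq0$, $\langle0\rangle:=1$. $\mathcal{H}^1$ is the Hilbert space of functions $f:\mathbb{T}\to\mathbb{C}$ with $\|f\|_{\mathcal{H}^1}=(\sum_{k}|f_k|^2\langle k\rangle^2)^{1/2}<\infty$ (a Banach algebra). $\mathcal{H}^{1,+}=\{f\in\mathcal{H}^1:f_k=0\text{ for }k<0\}$, $\mathcal{H}^{1,+}_0=\{f\in\mathcal{H}^1:f_k=0\text{ for }k\le0\}$, with Fourier-truncation projections $\Pi^+,\Pi^+_0$; bilinear pairing $\langle f,g\rangle=\sum_kf_kg_k$; $\check f(y)=f(-y)$; $(Lf)(y)=f(y)e^{-2\pi iy}$. $\mathcal{O}:=\{w\in\mathcal{H}^{1,+}_0: w(y)\ne0\ \forall y\in\mathbb{T}\}$, open in $\mathcal{H}^{1,+}_0$. $H_f(w,p)=\langle w,p^2\rangle+\int_0^1 f(y)/w(y)\,dy$;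 $J^f_k(w,p)=\langle A_k(w)\Gamma(w)p,p\rangle-\big(w\,\Pi^+_0(f/w)\big)_{k+1}$, where $A_k(w)g=g\,\Pi^+(L^{k+1}w)-w\,\Pi^+(L^{k+1}g)$ and $\Gamma(w)p=\Pi^+_0(w\check p)$. For a $C^1$ function $F$ on $\mathcal{O}\times\mathcal{H}^{1,+}_0$, $X_F=(\nabla_pF,-\nabla_wF)$, where the gradients are a priori distributions on $\mathbb{T}$ with Fourier coefficients vanishing for $k\le0$, determined by $\langle\nabla_wF,\delta w\rangle=(D_1F)(\delta w)$, $\langle\nabla_pF,\delta p\rangle=(D_2F)(\delta p)$ for all $\delta w,\delta p\in\mathcal{H}^{1,+}_0$. "Well defined" means that the gradients lie in $\mathcal{H}^{1,+}_0$. *)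

theory Defs
  imports "HOL-Analysis.Analysis"
begin

section \<open>Complex normed spaces and analytic maps between them\<close>

class complex_normed_vector = real_normed_vector +
  fixes scaleC :: "complex \<Rightarrow> 'a \<Rightarrow> 'a" (infixr \<open>*\<^sub>C\<close> 75)
  assumes scaleC_add_right: "c *\<^sub>C (x + y) = c *\<^sub>C x + c *\<^sub>C y"
    and scaleC_add_left: "(c + d) *\<^sub>C x = c *\<^sub>C x + d *\<^sub>C x"
    and scaleC_scaleC: "c *\<^sub>C d *\<^sub>C x = (c * d) *\<^sub>C x"
    and scaleC_of_real: "of_real r *\<^sub>C x = r *\<^sub>R x"
    and norm_scaleC: "norm (c *\<^sub>C x) = cmod c * norm x"

class complex_banach = complex_normed_vector + complete_space

subclass (in complex_banach) banach ..

instantiation complex :: complex_banach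
begin

definition scaleC_complex :: "complex \<Rightarrow> complex \<Rightarrow> complex"
  where "scaleC_complex c x = c * x"

instance
  by standard (simp_all add: scaleC_complex_def algebra_simps norm_mult scaleR_conv_of_real)

end

instantiation prod :: (complex_normed_vector, complex_normed_vector) complex_normed_vector
begin

definition scaleC_prod :: "complex \<Rightarrow> 'a \<times> 'b \<Rightarrow> 'a \<times> 'b"
  where "scaleC_prod c x = (c *\<^sub>C fst x, c *\<^sub>C snd x)"

instance
proof
  fix c :: complex and x :: "'a \<times> 'b"
  have "norm (c *\<^sub>C x) = sqrt ((cmod c)\<^sup>2 * ((norm (fst x))\<^sup>2 + (norm (snd x))\<^sup>2))"
    by (simp add: scaleC_prod_def norm_prod_def norm_scaleC power_mult_distrib distrib_left)
  then show "norm (c *\<^sub>C x) = cmod c * norm x"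
    by (simp add: norm_prod_def real_sqrt_mult)
qed (simp_all add: scaleC_prod_def scaleC_add_right scaleC_add_left scaleC_scaleC
      scaleC_of_real scaleR_prod_def)

end

instance prod :: (complex_banach, complex_banach) complex_banach ..

text \<open>
  An \<open>n\<close>-linear map takes its arguments as a sequence of which only the first \<open>n\<close> entries
  are used; \<open>M\<close> bounds its norm. Symmetry is not required, since only the values on the
  diagonal matter in a power series.
\<close>

definition bounded_clinear_n ::
    "nat \<Rightarrow> real \<Rightarrow> ((nat \<Rightarrow> 'a::complex_normed_vector) \<Rightarrow> 'b::complex_normed_vector) \<Rightarrow> bool" where
  "bounded_clinear_n n M A \<longleftrightarrow>
     (\<forall>x y. (\<forall>i<n. x i = y i) \<longrightarrow> A x = A y) \<and>
     (\<forall>i<n. \<forall>x u v. A (x(i := u + v)) = A (x(i := u)) + A (x(i := v))) \<and>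
     (\<forall>i<n. \<forall>x u c. A (x(i := c *\<^sub>C u)) = c *\<^sub>C A (x(i := u))) \<and>
     (\<forall>x. norm (A x) \<le> M * (\<Prod>i<n. norm (x i)))"

definition complex_analytic_on ::
    "'a::complex_banach set \<Rightarrow> ('a \<Rightarrow> 'b::complex_banach) \<Rightarrow> bool" where
  "complex_analytic_on U F \<longleftrightarrow> open U \<and>
     (\<forall>x\<in>U. \<exists>r>0. \<exists>A M.
        (\<forall>n. bounded_clinear_n n (M n) (A n)) \<and>
        summable (\<lambda>n. M n * r ^ n) \<and>
        (\<forall>h. norm h < r \<longrightarrow> (\<lambda>n. A n (\<lambda>_. h)) sums F (x + h)))"

section \<open>Fourier coefficients and the Sobolev space\<close>

definition fexp :: "int \<Rightarrow> real \<Rightarrow> complex"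
  where "fexp k y = cis (2 * pi * of_int k * y)"

definition fourier :: "(real \<Rightarrow> complex) \<Rightarrow> int \<Rightarrow> complex"
  where "fourier f k = integral {0..1} (\<lambda>y. f y * fexp (- k) y)"

definition jap :: "int \<Rightarrow> real"
  where "jap k = (if k = 0 then 1 else \<bar>of_int k\<bar>)"

text \<open>
  Functions on the circle are 1-periodic functions on the line. Finiteness of the Sobolev norm
  makes the Fourier series absolutely convergent, so every class of functions modulo null sets
  has a unique continuous representative, and this representative is taken as the element.
\<close>

definition H1 :: "(real \<Rightarrow> complex) set" where
  "H1 = {f. continuous_on UNIV f \<and> (\<forall>y. f (y + 1) = f y) \<and>
            (\<lambda>k. (cmod (fourier f k))\<^sup>2 * (jap k)\<^sup>2) summable_on UNIV}"

definition H1_norm :: "(real \<Rightarrow> complex) \<Rightarrow> real"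
  where "H1_norm f = sqrt (\<Sum>\<^sub>\<infinity>k. (cmod (fourier f k))\<^sup>2 * (jap k)\<^sup>2)"

subsection \<open>Elementary properties\<close>

lemma jap_ge_1: "jap k \<ge> 1"
  unfolding jap_def by auto

lemma fexp_mult: "fexp j y * fexp k y = fexp (j + k) y"
  by (simp add: fexp_def cis_mult distrib_left distrib_right)

lemma fexp_0 [simp]: "fexp 0 y = 1"
  by (simp add: fexp_def)

lemma norm_fexp [simp]: "norm (fexp k y) = 1"
  by (simp add: fexp_def)

lemma fexp_periodic: "fexp k (y + 1) = fexp k y"
proof -
  have "fexp k (y + 1) = cis (2 * pi * of_int k * y) * cis (2 * pi * of_int k)"
    by (simp only: fexp_def cis_mult distrib_left mult_1_right)
  then show ?thesis
    using cis_multiple_2pi[of "of_int k"] by (simp add: fexp_def)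
qed

lemma continuous_on_fexp [continuous_intros]: "continuous_on S (fexp k)"
  unfolding fexp_def cis_conv_exp by (intro continuous_intros)

lemma integral_fexp: "integral {0..1} (fexp k) = (if k = 0 then 1 else 0)"
proof (cases "k = 0")
  case True
  then have "fexp k = (\<lambda>y. 1)" by auto
  then show ?thesis using True by simp
next
  case False
  define a where "a = 2 * pi * of_int k"
  have a: "a \<noteq> 0" using False by (simp add: a_def)
  have "(fexp k has_integral (exp (\<i> * of_real (a * 1)) / (\<i> * of_real a)
            - exp (\<i> * of_real (a * 0)) / (\<i> * of_real a))) {0..1}"
  proof (rule fundamental_theorem_of_calculus)
    fix y :: real assume "y \<in> {0..1}"
    have "((\<lambda>z. exp (\<i> * of_real a * z) / (\<i> * of_real a)) has_field_derivative
             exp (\<i> * of_real a * of_real y)) (at (of_real y))"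
      by (rule derivative_eq_intros refl | use a in simp)+
    from has_vector_derivative_real_field[OF this, where s = "{0..1}"]
    show "((\<lambda>y. exp (\<i> * of_real (a * y)) / (\<i> * of_real a)) has_vector_derivative fexp k y)
            (at y within {0..1})"
      by (simp add: fexp_def cis_conv_exp a_def mult_ac)
  qed simp
  moreover have "exp (\<i> * of_real (a * 1)) = 1"
    using cis_multiple_2pi[of "of_int k"] by (simp add: cis_conv_exp a_def mult_ac)
  ultimately have "(fexp k has_integral 0) {0..1}" by simp
  then show ?thesis using False by (simp add: integral_unique)
qed

lemma integrable_fexp:
  "continuous_on UNIV f \<Longrightarrow> (\<lambda>y. f y * fexp k y) integrable_on {0..1}"
  by (intro integrable_continuous_real continuous_intros) (auto intro: continuous_on_subset)

lemma fourier_add: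
  assumes "continuous_on UNIV f" "continuous_on UNIV g"
  shows "fourier (\<lambda>y. f y + g y) k = fourier f k + fourier g k"
  unfolding fourier_def distrib_right
  by (rule integral_add) (rule integrable_fexp[OF assms(1)] integrable_fexp[OF assms(2)])+

lemma fourier_cmult: "fourier (\<lambda>y. c * f y) k = c * fourier f k"
  unfolding fourier_def by (simp add: mult.assoc)

lemma fourier_diff:
  assumes "continuous_on UNIV f" "continuous_on UNIV g"
  shows "fourier (\<lambda>y. f y - g y) k = fourier f k - fourier g k"
  unfolding fourier_def left_diff_distrib
  by (rule integral_diff) (rule integrable_fexp[OF assms(1)] integrable_fexp[OF assms(2)])+

lemma fourier_zero [simp]: "fourier (\<lambda>y. 0) k = 0"
  unfolding fourier_def by simp

lemma cis_comb:
  "of_real (cos t * a + sin t * b) =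
     (of_real a - \<i> * of_real b) / 2 * cis t + (of_real a + \<i> * of_real b) / 2 * cis (- t)"
  by (rule complex_eqI)
    (simp_all add: add_divide_distrib diff_divide_distrib left_diff_distrib distrib_right)

text \<open>Uniqueness of Fourier coefficients, by the Weierstrass theorem on the unit circle.\<close>

lemma fourier_eq_0_imp:
  assumes cont: "continuous_on UNIV f" and per: "\<And>y. f (y + 1) = f y"
    and zero: "\<And>k. fourier f k = 0"
  shows "f = (\<lambda>y. 0)"
proof -
  define E where "E y = cis (2 * pi * y)" for y :: real
  define V where "V = {h. continuous_on {0..1} h \<and>
      (\<forall>k. integral {0..1} (\<lambda>y. h y * fexp k y) = 0)}"
  have contE: "continuous_on S E" for S
    unfolding E_def cis_conv_exp by (intro continuous_intros)
  have V_add: "(\<lambda>y. g y + h y) \<in> V" if "g \<in> V" "h \<in> V" for g h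
  proof -
    have "integral {0..1} (\<lambda>y. g y * fexp k y + h y * fexp k y) = 0" for k
      using that unfolding V_def
      by (subst integral_add) (auto intro!: integrable_continuous_real continuous_intros)
    then show ?thesis
      using that unfolding V_def by (auto intro!: continuous_intros simp: distrib_right)
  qed
  have V_cmult: "(\<lambda>y. c * h y) \<in> V" if "h \<in> V" for c h
    using that unfolding V_def by (auto intro!: continuous_intros simp: mult.assoc)
  have V_fexp: "(\<lambda>y. fexp j y * h y) \<in> V" if "h \<in> V" for j h
  proof -
    have *: "fexp j y * h y * fexp k y = h y * fexp (j + k) y" for k y
      by (simp add: fexp_mult[symmetric] mult_ac)
    show ?thesis
      using that unfolding V_def * by (auto intro!: continuous_intros simp: *)
  qed
  have fV: "f \<in> V"
  proof -
    have "integral {0..1} (\<lambda>y. f y * fexp k y) = 0" for k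
      using zero[of "- k"] by (simp add: fourier_def)
    then show ?thesis
      unfolding V_def using cont by (auto intro: continuous_on_subset)
  qed
  have poly: "(\<lambda>y. of_real (q (E y)) * h y) \<in> V"
    if "real_polynomial_function q" "h \<in> V" for q :: "complex \<Rightarrow> real" and h
    using that
  proof (induction arbitrary: h)
    case (linear q)
    then interpret bounded_linear q by simp
    have q: "q z = Re z * q 1 + Im z * q \<i>" for z
    proof -
      have "q z = q (Re z *\<^sub>R 1 + Im z *\<^sub>R \<i>)"
        by (rule arg_cong[of _ _ q]) (simp add: complex_eq_iff)
      then show ?thesis by (simp add: add scaleR)
    qed
    define c where "c = (of_real (q 1) - \<i> * of_real (q \<i>)) / 2"
    define d where "d = (of_real (q 1) + \<i> * of_real (q \<i>)) / 2"
    have "of_real (q (E y)) * h y = c * (fexp 1 y * h y) + d * (fexp (-1) y * h y)" for y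
    proof -
      have "of_real (q (E y)) = c * fexp 1 y + d * fexp (-1) y"
      proof -
        have "q (E y) = cos (2 * pi * y) * q 1 + sin (2 * pi * y) * q \<i>"
          using q[of "E y"] by (simp add: E_def)
        then show ?thesis
          using cis_comb[of "2 * pi * y" "q 1" "q \<i>"]
          by (simp add: fexp_def c_def d_def del: of_real_add of_real_mult)
      qed
      then show ?thesis by (simp add: algebra_simps)
    qed
    then show ?case
      using V_add[OF V_cmult[OF V_fexp[OF linear.prems, of 1], of c]
          V_cmult[OF V_fexp[OF linear.prems, of "-1"], of d]] by simp
  next
    case (const c)
    then show ?case by (rule V_cmult)
  next
    case (add q r)
    then show ?case using V_add[OF add.IH] by (simp add: distrib_right)
  next
    case (mult q r)
    then show ?case using mult.IH(1)[OF mult.IH(2)] by (simp add: mult.assoc)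
  qed
  define S where "S = sphere (0::complex) 1"
  have S_im: "S = E ` {0..1}"
  proof
    show "E ` {0..1} \<subseteq> S" by (auto simp: S_def E_def)
    show "S \<subseteq> E ` {0..1}"
    proof
      fix z assume "z \<in> S"
      then have z: "z = cis (Arg2pi z)"
        using complex_norm_eq_1_exp[of z] by (simp add: S_def cis_conv_exp)
      have "0 \<le> Arg2pi z" "Arg2pi z < 2 * pi" by (simp_all add: Arg2pi_ge_0 Arg2pi_lt_2pi)
      then have "Arg2pi z / (2 * pi) \<in> {0..1}" by simp
      moreover have "E (Arg2pi z / (2 * pi)) = z" using z by (simp add: E_def)
      ultimately show "z \<in> E ` {0..1}" by (metis imageI)
    qed
  qed
  have f01: "f 1 = f 0" using per[of 0] by simp
  have f_E: "f x = f y" if E: "E x = E y" and x: "x \<in> {0..1}" and y: "y \<in> {0..1}" for x y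
  proof -
    obtain n :: int where n0: "2 * pi * x = 2 * pi * y + 2 * pi * of_int n"
      using E sin_cos_eq_iff[of "2 * pi * x" "2 * pi * y"]
      by (auto simp: E_def complex_eq_iff)
    have "2 * pi * x = 2 * pi * (y + of_int n)"
      unfolding n0 by (simp add: distrib_left)
    then have n: "x = y + of_int n" by simp
    then have "-1 \<le> real_of_int n" "real_of_int n \<le> 1" using x y by auto
    then consider "n = -1" | "n = 0" | "n = 1" by linarith
    then show ?thesis
    proof cases
      case 1
      then have "x = 0" "y = 1" using n x y by auto
      then show ?thesis using f01 by simp
    next
      case 2
      then show ?thesis using n by simp
    next
      case 3
      then have "x = 1" "y = 0" using n x y by auto
      then show ?thesis using f01 by simp
    qed
  qed
  define g where "g z = f (SOME y. y \<in> {0..1} \<and> E y = z)" for z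
  have gE: "g (E y) = f y" if "y \<in> {0..1}" for y
  proof -
    have "(SOME x. x \<in> {0..1} \<and> E x = E y) \<in> {0..1} \<and> E (SOME x. x \<in> {0..1} \<and> E x = E y) = E y"
      by (rule someI[of _ y]) (use that in simp)
    then show ?thesis unfolding g_def using that by (intro f_E) auto
  qed
  have contg: "continuous_on S g"
  proof -
    have "closed (g -` B \<inter> S)" if "closed B" for B
    proof -
      have "g -` B \<inter> S = E ` (f -` B \<inter> {0..1})"
        unfolding S_im using gE by auto
      moreover have "closed (f -` B \<inter> {0..1})"
        using that continuous_on_subset[OF cont subset_UNIV, of "{0..1}"]
        by (simp add: continuous_on_closed_vimage)
      then have "compact (f -` B \<inter> {0..1})"
        by (metis compact_Icc closed_Int_compact inf.right_idem)
      ultimately show ?thesis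
        using compact_continuous_image[OF contE] compact_imp_closed by metis
    qed
    then show ?thesis by (subst continuous_on_closed_vimage) (auto simp: S_def)
  qed
  have compS: "compact S" by (simp add: S_def)
  define I where "I = integral {0..1} (\<lambda>y. (cmod (f y))\<^sup>2)"
  have contf: "continuous_on {0..1} f" using cont by (auto intro: continuous_on_subset)
  then have "compact (f ` {0..1})" by (intro compact_continuous_image) auto
  then obtain M where M: "\<And>y. y \<in> {0..1} \<Longrightarrow> cmod (f y) \<le> M"
    using compact_imp_bounded bounded_iff by (metis imageI)
  have M0: "M \<ge> 0" using M[of 0] norm_ge_zero[of "f 0"] by (simp del: norm_ge_zero)
  have I0: "I \<le> e * (2 * M)" if e: "e > 0" for e
  proof -
    have "continuous_on S (\<lambda>z. Re (g z))" "continuous_on S (\<lambda>z. Im (g z))"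
      using contg by (auto intro: continuous_intros)
    note cont_parts = this
    obtain p where p: "real_polynomial_function p" "\<And>z. z \<in> S \<Longrightarrow> \<bar>Re (g z) - p z\<bar> < e"
      using Stone_Weierstrass_real_polynomial_function[OF compS cont_parts(1) e] by blast
    obtain q where q: "real_polynomial_function q" "\<And>z. z \<in> S \<Longrightarrow> \<bar>Im (g z) - q z\<bar> < e"
      using Stone_Weierstrass_real_polynomial_function[OF compS cont_parts(2) e] by blast
    define P where "P y = of_real (p (E y)) - \<i> * of_real (q (E y))" for y
    have "(\<lambda>y. of_real (p (E y)) * f y + (- \<i>) * (of_real (q (E y)) * f y)) \<in> V"
      by (intro V_add V_cmult poly p q fV)
    also have "(\<lambda>y. of_real (p (E y)) * f y + (- \<i>) * (of_real (q (E y)) * f y)) = (\<lambda>y. P y * f y)"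
      by (auto simp: P_def algebra_simps)
    finally have PV: "(\<lambda>y. P y * f y) \<in> V" .
    then have "integral {0..1} (\<lambda>y. P y * f y * fexp 0 y) = 0" and
      contP: "continuous_on {0..1} (\<lambda>y. P y * f y)" unfolding V_def by blast+
    then have P0: "integral {0..1} (\<lambda>y. P y * f y) = 0" by simp
    have close: "cmod ((cnj (f y) - P y) * f y) \<le> e * (2 * M)" if y: "y \<in> {0..1}" for y
    proof -
      have "E y \<in> S" using y S_im by auto
      then have "\<bar>Re (f y) - p (E y)\<bar> < e" "\<bar>Im (f y) - q (E y)\<bar> < e"
        using p(2)[of "E y"] q(2)[of "E y"] gE[OF y] by auto
      moreover have "cmod (cnj (f y) - P y) \<le> \<bar>Re (cnj (f y) - P y)\<bar> + \<bar>Im (cnj (f y) - P y)\<bar>"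
        by (rule cmod_le)
      ultimately have "cmod (cnj (f y) - P y) \<le> 2 * e"
        by (simp add: P_def abs_if split: if_splits)
      then have "cmod (cnj (f y) - P y) * cmod (f y) \<le> (2 * e) * M"
        using M[OF y] e by (intro mult_mono) auto
      then show ?thesis by (simp add: norm_mult mult_ac)
    qed
    have "of_real I = integral {0..1} (\<lambda>y. complex_of_real ((cmod (f y))\<^sup>2))"
      unfolding I_def
      by (subst integral_linear[OF _ bounded_linear_of_real, symmetric])
        (auto simp: o_def intro!: integrable_continuous_real continuous_intros contf)
    also have "\<dots> = integral {0..1} (\<lambda>y. cnj (f y) * f y)"
      by (intro integral_cong) (simp only: complex_norm_square mult.commute)
    also have "\<dots> = integral {0..1} (\<lambda>y. cnj (f y) * f y) - integral {0..1} (\<lambda>y. P y * f y)"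
      using P0 by simp
    also have "\<dots> = integral {0..1} (\<lambda>y. cnj (f y) * f y - P y * f y)"
      by (subst integral_diff)
        (auto intro!: integrable_continuous_real continuous_intros contf contP)
    also have "\<dots> = integral {0..1} (\<lambda>y. (cnj (f y) - P y) * f y)"
      by (simp add: left_diff_distrib)
    finally have "cmod (of_real I) = cmod (integral {0..1} (\<lambda>y. (cnj (f y) - P y) * f y))"
      by simp
    also have "\<dots> \<le> e * (2 * M) * (1 - 0)"
    proof (rule integral_bound)
      show "continuous_on {0..1} (\<lambda>y. (cnj (f y) - P y) * f y)"
        unfolding left_diff_distrib by (intro continuous_intros contf contP)
    qed (use close in auto)
    finally show ?thesis by simp
  qed
  have "I \<le> 0"
  proof (rule field_le_epsilon)
    fix e :: real assume e: "e > 0"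
    have "I \<le> e / (2 * M + 1) * (2 * M)" by (rule I0) (use e M0 in auto)
    also have "\<dots> \<le> e" using e M0 by (simp add: field_simps)
    finally show "I \<le> 0 + e" by simp
  qed
  moreover have "I \<ge> 0" unfolding I_def by (rule integral_nonneg)
      (auto intro!: integrable_continuous_real continuous_intros contf)
  ultimately have "integral {0..1} (\<lambda>y. (cmod (f y))\<^sup>2) = 0" by (simp add: I_def)
  then have "\<And>y. y \<in> {0..1} \<Longrightarrow> (cmod (f y))\<^sup>2 = 0"
    by (subst (asm) integral_eq_0_iff) (auto intro!: continuous_intros contf)
  then have f0: "f y = 0" if "y \<in> {0..1}" for y using that by simp
  show ?thesis
  proof
    fix y
    have "f (frac y) = f y"
    proof -
      have nat: "f (x + real n) = f x" for x n
      proof (induction n)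
        case (Suc n)
        then show ?case using per[of "x + real n"] by (simp add: add_ac)
      qed simp
      show ?thesis
      proof (cases "\<lfloor>y\<rfloor> \<ge> 0")
        case True
        then show ?thesis using nat[of "frac y" "nat \<lfloor>y\<rfloor>"] by (simp add: frac_def)
      next
        case False
        then show ?thesis using nat[of y "nat (- \<lfloor>y\<rfloor>)"] by (simp add: frac_def)
      qed
    qed
    moreover have "frac y \<in> {0..1}" using frac_ge_0[of y] frac_lt_1[of y] by simp
    ultimately show "f y = 0" using f0 by metis
  qed
qed

definition wl2 :: "(int \<Rightarrow> complex) \<Rightarrow> bool"
  where "wl2 c \<longleftrightarrow> (\<lambda>k. (cmod (c k))\<^sup>2 * (jap k)\<^sup>2) summable_on UNIV"

definition wl2_norm :: "(int \<Rightarrow> complex) \<Rightarrow> real"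
  where "wl2_norm c = sqrt (\<Sum>\<^sub>\<infinity>k. (cmod (c k))\<^sup>2 * (jap k)\<^sup>2)"

lemma wl2_fin:
  assumes "wl2 c" "finite A"
  shows "L2_set (\<lambda>k. cmod (c k) * jap k) A \<le> wl2_norm c"
  using finite_sum_le_infsum[of "\<lambda>k. (cmod (c k))\<^sup>2 * (jap k)\<^sup>2" UNIV A] assms
  unfolding wl2_def wl2_norm_def L2_set_def by (simp add: power_mult_distrib)

lemma wl2_bound:
  assumes "\<And>A. finite A \<Longrightarrow> L2_set (\<lambda>k. cmod (c k) * jap k) A \<le> B"
  shows "wl2 c" "wl2_norm c \<le> B"
proof -
  have B: "B \<ge> 0" using assms[of "{}"] by simp
  have *: "(\<Sum>k\<in>A. (cmod (c k))\<^sup>2 * (jap k)\<^sup>2) \<le> B\<^sup>2" if "finite A" for A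
    using sqrt_le_D[OF assms[OF that, unfolded L2_set_def]] by (simp add: power_mult_distrib)
  show "wl2 c"
    unfolding wl2_def
    by (rule nonneg_bdd_above_summable_on) (auto intro!: bdd_aboveI[of _ "B\<^sup>2"] *)
  then have "(\<Sum>\<^sub>\<infinity>k. (cmod (c k))\<^sup>2 * (jap k)\<^sup>2) \<le> B\<^sup>2"
    unfolding wl2_def by (rule infsum_le_finite_sums) (rule *)
  then show "wl2_norm c \<le> B"
    unfolding wl2_norm_def using B by (rule real_le_lsqrt[rotated 1])
qed

lemma wl2_norm_nonneg: "wl2_norm c \<ge> 0"
  unfolding wl2_norm_def by (simp add: infsum_nonneg)

lemma wl2_component: "wl2 c \<Longrightarrow> cmod (c k) * jap k \<le> wl2_norm c"
  using wl2_fin[of c "{k}"] jap_ge_1[of k] by simp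

lemma wl2_component': "wl2 c \<Longrightarrow> cmod (c k) \<le> wl2_norm c"
  using wl2_component[of c k] mult_left_mono[OF jap_ge_1[of k], of "cmod (c k)"] by simp

lemma wl2_add:
  assumes "wl2 c" "wl2 d"
  shows "wl2 (\<lambda>k. c k + d k)" "wl2_norm (\<lambda>k. c k + d k) \<le> wl2_norm c + wl2_norm d"
proof -
  have "L2_set (\<lambda>k. cmod (c k + d k) * jap k) A \<le> wl2_norm c + wl2_norm d" if "finite A" for A
  proof -
    have "L2_set (\<lambda>k. cmod (c k + d k) * jap k) A \<le>
        L2_set (\<lambda>k. cmod (c k) * jap k + cmod (d k) * jap k) A"
    proof (rule L2_set_mono)
      fix k
      show "cmod (c k + d k) * jap k \<le> cmod (c k) * jap k + cmod (d k) * jap k"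
        unfolding distrib_right[symmetric]
        by (rule mult_right_mono[OF norm_triangle_ineq]) (use jap_ge_1[of k] in simp)
      show "0 \<le> cmod (c k + d k) * jap k" using jap_ge_1[of k] by simp
    qed
    also have "\<dots> \<le> L2_set (\<lambda>k. cmod (c k) * jap k) A + L2_set (\<lambda>k. cmod (d k) * jap k) A"
      by (rule L2_set_triangle_ineq)
    also have "\<dots> \<le> wl2_norm c + wl2_norm d"
      by (intro add_mono wl2_fin assms that)
    finally show ?thesis .
  qed
  from wl2_bound[OF this]
  show "wl2 (\<lambda>k. c k + d k)" "wl2_norm (\<lambda>k. c k + d k) \<le> wl2_norm c + wl2_norm d" by blast+
qed

lemma wl2_cmult:
  assumes "wl2 c"
  shows "wl2 (\<lambda>k. a * c k)" "wl2_norm (\<lambda>k. a * c k) = cmod a * wl2_norm c"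
proof -
  have *: "(\<lambda>k. (cmod (a * c k))\<^sup>2 * (jap k)\<^sup>2) =
      (\<lambda>k. (cmod a)\<^sup>2 * ((cmod (c k))\<^sup>2 * (jap k)\<^sup>2))"
    by (simp add: norm_mult power_mult_distrib mult.assoc)
  show "wl2 (\<lambda>k. a * c k)"
    using assms unfolding wl2_def * by (rule summable_on_cmult_right)
  show "wl2_norm (\<lambda>k. a * c k) = cmod a * wl2_norm c"
    unfolding wl2_norm_def * by (simp add: infsum_cmult_right' real_sqrt_mult)
qed

lemma wl2_zero [simp]: "wl2 (\<lambda>k. 0)" "wl2_norm (\<lambda>k. 0) = 0"
  by (simp_all add: wl2_def wl2_norm_def)

lemma wl2_norm_eq_0: "wl2 c \<Longrightarrow> wl2_norm c = 0 \<Longrightarrow> c k = 0"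
  using wl2_component'[of c k] by simp

lemma wl2_abs_summable:
  assumes "wl2 c"
  shows "(\<lambda>k. cmod (c k)) summable_on UNIV"
proof -
  have "(\<lambda>n. 1 / (real n)\<^sup>2) summable_on {1..}"
    using inverse_power_summable[of 2, where ?'a = real]
    by (intro summable_on_subset_banach[where A = UNIV and B = "{1..}"] norm_summable_imp_summable_on)
      (auto simp: inverse_eq_divide power_divide)
  then have s: "(\<lambda>n. 1 / (real n)\<^sup>2) summable_on {1..}" .
  have pos: "(\<lambda>k. 1 / (jap k)\<^sup>2) summable_on {1..}"
  proof -
    have "bij_betw int {1..} {1..}"
      by (rule bij_betwI[where g = nat]) auto
    from summable_on_reindex_bij_betw[OF this, of "\<lambda>k. 1 / (jap k)\<^sup>2"]
    have "(\<lambda>k. 1 / (jap k)\<^sup>2) summable_on {1..} \<longleftrightarrow>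
        (\<lambda>n. 1 / (jap (int n))\<^sup>2) summable_on {1..}" by simp
    also have "\<dots> \<longleftrightarrow> (\<lambda>n. 1 / (real n)\<^sup>2) summable_on {1..}"
      by (rule summable_on_cong) (simp add: jap_def)
    finally show ?thesis using s by simp
  qed
  have neg: "(\<lambda>k. 1 / (jap k)\<^sup>2) summable_on {..-1}"
  proof -
    have "bij_betw uminus {1..} {..-1::int}"
      by (rule bij_betwI[where g = uminus]) auto
    from summable_on_reindex_bij_betw[OF this, of "\<lambda>k. 1 / (jap k)\<^sup>2"]
    have "(\<lambda>k. 1 / (jap k)\<^sup>2) summable_on {..-1} \<longleftrightarrow>
        (\<lambda>k. 1 / (jap (- k))\<^sup>2) summable_on {1..}" by simp
    also have "\<dots> \<longleftrightarrow> (\<lambda>k. 1 / (jap k)\<^sup>2) summable_on {1..}"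
      by (rule summable_on_cong) (simp add: jap_def)
    finally show ?thesis using pos by simp
  qed
  have "(\<lambda>k. 1 / (jap k)\<^sup>2) summable_on ({..-1} \<union> {0} \<union> {1..})"
    by (intro summable_on_Un_disjoint pos neg) auto
  also have "{..-1} \<union> {0} \<union> {1::int..} = UNIV" by auto
  finally have "(\<lambda>k. 1 / (jap k)\<^sup>2) summable_on UNIV" .
  then have "(\<lambda>k. (cmod (c k))\<^sup>2 * (jap k)\<^sup>2 + 1 / (jap k)\<^sup>2) summable_on UNIV"
    using assms unfolding wl2_def by (intro summable_on_add)
  then show ?thesis
  proof (rule summable_on_comparison_test)
    fix k :: int
    define a b where "a = cmod (c k) * jap k" and "b = 1 / jap k"
    have "a * b = cmod (c k)" using jap_ge_1[of k] by (simp add: a_def b_def)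
    moreover have "2 * a * b \<le> a\<^sup>2 + b\<^sup>2" by (rule sum_squares_bound)
    moreover have "0 \<le> a * b" using jap_ge_1[of k] by (simp add: a_def b_def)
    ultimately have "cmod (c k) \<le> a\<^sup>2 + b\<^sup>2" by linarith
    then show "cmod (c k) \<le> (cmod (c k))\<^sup>2 * (jap k)\<^sup>2 + 1 / (jap k)\<^sup>2"
      by (simp add: a_def b_def power_mult_distrib power_divide)
  qed simp
qed

lemma wl2_synthesis:
  assumes "wl2 c"
  shows "(\<lambda>y. \<Sum>\<^sub>\<infinity>k. c k * fexp k y) \<in> H1" (is "?f \<in> H1")
    and "fourier (\<lambda>y. \<Sum>\<^sub>\<infinity>k. c k * fexp k y) = c"
proof -
  have ul: "uniform_limit UNIV (\<lambda>X y. \<Sum>k\<in>X. c k * fexp k y) ?f (finite_subsets_at_top UNIV)"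
    by (rule Weierstrass_m_test_general[OF _ wl2_abs_summable[OF assms]]) (simp add: norm_mult)
  have cont: "continuous_on UNIV ?f"
    by (rule uniform_limit_theorem[OF _ ul]) (auto intro!: always_eventually continuous_intros)
  have fin: "fourier (\<lambda>y. \<Sum>k\<in>X. c k * fexp k y) j = (\<Sum>k\<in>X. c k * (if k = j then 1 else 0))"
    if "finite X" for X j
  proof -
    have "fourier (\<lambda>y. \<Sum>k\<in>X. c k * fexp k y) j =
        integral {0..1} (\<lambda>y. \<Sum>k\<in>X. c k * fexp (k - j) y)"
      by (simp add: fourier_def sum_distrib_right mult.assoc fexp_mult)
    also have "\<dots> = (\<Sum>k\<in>X. integral {0..1} (\<lambda>y. c k * fexp (k - j) y))"
      by (rule integral_sum)
        (auto intro!: that integrable_continuous_real continuous_intros)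
    also have "\<dots> = (\<Sum>k\<in>X. c k * (if k = j then 1 else 0))"
      by (rule sum.cong) (simp_all add: integral_fexp)
    finally show ?thesis .
  qed
  show four: "fourier ?f = c"
  proof
    fix j
    have ul': "uniform_limit {0..1} (\<lambda>X y. (\<Sum>k\<in>X. c k * fexp k y) * fexp (- j) y)
        (\<lambda>y. ?f y * fexp (- j) y) (finite_subsets_at_top UNIV)"
    proof (rule uniform_limitI)
      fix e :: real assume "e > 0"
      from uniform_limitD[OF ul this]
      show "\<forall>\<^sub>F X in finite_subsets_at_top UNIV. \<forall>y\<in>{0..1}.
          dist ((\<Sum>k\<in>X. c k * fexp k y) * fexp (- j) y) (?f y * fexp (- j) y) < e"
        by eventually_elim (simp add: dist_norm left_diff_distrib[symmetric] norm_mult)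
    qed
    obtain I J where I: "\<And>X. ((\<lambda>y. (\<Sum>k\<in>X. c k * fexp k y) * fexp (- j) y) has_integral I X) {0..1}"
      and J: "((\<lambda>y. ?f y * fexp (- j) y) has_integral J) {0..1}"
      and lim: "(I \<longlongrightarrow> J) (finite_subsets_at_top UNIV)"
      by (rule uniform_limit_integral[OF ul']) (auto intro!: continuous_intros)
    have "I X = fourier (\<lambda>y. \<Sum>k\<in>X. c k * fexp k y) j" for X
      unfolding fourier_def using I[of X] by (simp add: integral_unique)
    moreover have "\<forall>\<^sub>F X in finite_subsets_at_top UNIV. finite X \<and> {j} \<subseteq> X"
      by (auto simp: eventually_finite_subsets_at_top intro!: exI[of _ "{j}"])
    ultimately have "\<forall>\<^sub>F X in finite_subsets_at_top UNIV. I X = c j"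
      by (elim eventually_mono) (auto simp: fin if_distrib[of "(*) _"] cong: if_cong)
    then have "(I \<longlongrightarrow> c j) (finite_subsets_at_top UNIV)" by (rule tendsto_eventually)
    then have "J = c j" using lim tendsto_unique finite_subsets_at_top_neq_bot by blast
    then show "fourier ?f j = c j" using J by (simp add: fourier_def integral_unique)
  qed
  show "?f \<in> H1"
    using cont assms four unfolding H1_def wl2_def by (auto simp: fexp_periodic)
qed

lemma H1_norm_wl2: "H1_norm f = wl2_norm (fourier f)"
  by (simp add: H1_norm_def wl2_norm_def)

lemma H1_iff: "f \<in> H1 \<longleftrightarrow> continuous_on UNIV f \<and> (\<forall>y. f (y + 1) = f y) \<and> wl2 (fourier f)"
  by (simp add: H1_def wl2_def)

lemma H1_add: "f \<in> H1 \<Longrightarrow> g \<in> H1 \<Longrightarrow> (\<lambda>y. f y + g y) \<in> H1"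
proof -
  assume fg: "f \<in> H1" "g \<in> H1"
  have "fourier (\<lambda>y. f y + g y) = (\<lambda>k. fourier f k + fourier g k)"
    using fg by (auto simp: H1_iff fourier_add)
  then show ?thesis using fg unfolding H1_iff by (auto intro!: continuous_intros wl2_add)
qed

lemma H1_cmult: "f \<in> H1 \<Longrightarrow> (\<lambda>y. c * f y) \<in> H1"
proof -
  assume f: "f \<in> H1"
  have "fourier (\<lambda>y. c * f y) = (\<lambda>k. c * fourier f k)"
    by (auto simp: fourier_cmult)
  then show ?thesis using f unfolding H1_iff by (auto intro!: continuous_intros wl2_cmult)
qed

lemma H1_zero: "(\<lambda>y. 0) \<in> H1"
proof -
  have "fourier (\<lambda>y. 0) = (\<lambda>k. 0)" by (rule ext) simp
  then show ?thesis unfolding H1_iff by simp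
qed

lemma H1_eqI:
  assumes "f \<in> H1" "g \<in> H1" "\<And>k. fourier f k = fourier g k"
  shows "f = g"
proof -
  have "(\<lambda>y. f y - g y) = (\<lambda>y. 0)"
    by (rule fourier_eq_0_imp) (use assms in \<open>auto simp: H1_iff fourier_diff intro!: continuous_intros\<close>)
  then show ?thesis by (simp add: fun_eq_iff)
qed


section \<open>The phase space\<close>

typedef H10 = "{f \<in> H1. \<forall>k\<le>0. fourier f k = 0}"
  morphisms fun_of Abs_H10
  using H1_zero by (intro exI[of _ "\<lambda>y. 0"]) simp

lemma fun_of_H1 [simp]: "fun_of u \<in> H1"
  using fun_of[of u] by simp

lemma fun_of_cont: "continuous_on UNIV (fun_of u)"
  using fun_of_H1[of u] unfolding H1_iff by simp

lemma fourier_fun_of_nonpos [simp]: "k \<le> 0 \<Longrightarrow> fourier (fun_of u) k = 0"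
  using fun_of[of u] by simp

lemma wl2_fun_of [simp]: "wl2 (fourier (fun_of u))"
  using fun_of_H1[of u] unfolding H1_iff by simp

instantiation H10 :: complex_normed_vector
begin

definition zero_H10 :: H10
  where "zero_H10 = Abs_H10 (\<lambda>y. 0)"

definition plus_H10 :: "H10 \<Rightarrow> H10 \<Rightarrow> H10"
  where "plus_H10 u v = Abs_H10 (\<lambda>y. fun_of u y + fun_of v y)"

definition scaleC_H10 :: "complex \<Rightarrow> H10 \<Rightarrow> H10"
  where "scaleC_H10 c u = Abs_H10 (\<lambda>y. c * fun_of u y)"

definition uminus_H10 :: "H10 \<Rightarrow> H10"
  where "uminus_H10 u = (- 1) *\<^sub>C u"

definition minus_H10 :: "H10 \<Rightarrow> H10 \<Rightarrow> H10"
  where "minus_H10 u v = u + (- v)"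

definition scaleR_H10 :: "real \<Rightarrow> H10 \<Rightarrow> H10"
  where "scaleR_H10 r u = of_real r *\<^sub>C u"

definition norm_H10 :: "H10 \<Rightarrow> real"
  where "norm_H10 u = H1_norm (fun_of u)"

definition dist_H10 :: "H10 \<Rightarrow> H10 \<Rightarrow> real"
  where "dist_H10 u v = norm (u - v)"

definition sgn_H10 :: "H10 \<Rightarrow> H10"
  where "sgn_H10 u = inverse (norm u) *\<^sub>R u"

definition uniformity_H10 :: "(H10 \<times> H10) filter"
  where "uniformity_H10 = (INF e\<in>{0<..}. principal {(u, v). dist u v < e})"

definition open_H10 :: "H10 set \<Rightarrow> bool"
  where "open_H10 U \<longleftrightarrow> (\<forall>u\<in>U. \<forall>\<^sub>F (u', v) in uniformity. u' = u \<longrightarrow> v \<in> U)"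

lemma fun_of_zero: "fun_of 0 = (\<lambda>y. 0)"
  unfolding zero_H10_def by (rule Abs_H10_inverse) (simp add: H1_zero)

lemma fun_of_add: "fun_of (u + v) = (\<lambda>y. fun_of u y + fun_of v y)"
  unfolding plus_H10_def
  by (rule Abs_H10_inverse) (simp add: H1_add fourier_add[OF fun_of_cont fun_of_cont])

lemma fun_of_scaleC: "fun_of (c *\<^sub>C u) = (\<lambda>y. c * fun_of u y)"
  unfolding scaleC_H10_def
  by (rule Abs_H10_inverse) (simp add: H1_cmult fourier_cmult)

lemma norm_H10_wl2: "norm u = wl2_norm (fourier (fun_of u))"
  by (simp add: norm_H10_def H1_norm_wl2)

lemma norm_H10_scaleC: "norm (c *\<^sub>C u) = cmod c * norm (u :: H10)"
proof -
  have "fourier (fun_of (c *\<^sub>C u)) = (\<lambda>k. c * fourier (fun_of u) k)"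
    by (auto simp: fun_of_scaleC fourier_cmult)
  then show ?thesis by (simp add: norm_H10_wl2 wl2_cmult)
qed

instance
proof
  note defs = fun_of_inject[symmetric] fun_of_zero fun_of_add fun_of_scaleC uminus_H10_def
    minus_H10_def scaleR_H10_def
  fix u v w :: H10 and c d :: complex and a b :: real
  show "u + v + w = u + (v + w)" "u + v = v + u" "0 + u = u" "- u + u = 0" "u - v = u + - v"
    "a *\<^sub>R (u + v) = a *\<^sub>R u + a *\<^sub>R v" "(a + b) *\<^sub>R u = a *\<^sub>R u + b *\<^sub>R u"
    "a *\<^sub>R b *\<^sub>R u = (a * b) *\<^sub>R u" "1 *\<^sub>R u = u"
    "c *\<^sub>C (u + v) = c *\<^sub>C u + c *\<^sub>C v" "(c + d) *\<^sub>C u = c *\<^sub>C u + d *\<^sub>C u"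
    "c *\<^sub>C d *\<^sub>C u = (c * d) *\<^sub>C u" "of_real a *\<^sub>C u = a *\<^sub>R u"
    by (simp_all add: defs fun_eq_iff algebra_simps)
  show "dist u v = norm (u - v)" by (rule dist_H10_def)
  show "sgn u = inverse (norm u) *\<^sub>R u" by (rule sgn_H10_def)
  show "uniformity = (INF e\<in>{0<..}. principal {(u :: H10, v). dist u v < e})"
    by (rule uniformity_H10_def)
  show "open U \<longleftrightarrow> (\<forall>u\<in>U. \<forall>\<^sub>F (u', v) in uniformity. u' = u \<longrightarrow> v \<in> U)" for U :: "H10 set"
    by (rule open_H10_def)
  show "norm (c *\<^sub>C u) = cmod c * norm u" by (rule norm_H10_scaleC)
  show "norm (a *\<^sub>R u) = \<bar>a\<bar> * norm u" by (simp add: scaleR_H10_def norm_H10_scaleC)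
  show "norm u = 0 \<longleftrightarrow> u = 0"
  proof
    assume "norm u = 0"
    then have "fourier (fun_of u) k = 0" for k
      by (intro wl2_norm_eq_0) (simp_all add: norm_H10_wl2)
    then have "fun_of u = (\<lambda>y. 0)"
      by (intro H1_eqI) (simp_all add: H1_zero)
    then show "u = 0" by (simp add: fun_of_inject[symmetric] fun_of_zero)
  next
    assume "u = 0"
    then have "fourier (fun_of u) = (\<lambda>k. 0)" by (auto simp: fun_of_zero)
    then show "norm u = 0" by (simp add: norm_H10_wl2)
  qed
  show "norm (u + v) \<le> norm u + norm v"
  proof -
    have "fourier (fun_of (u + v)) = (\<lambda>k. fourier (fun_of u) k + fourier (fun_of v) k)"
      by (auto simp: fun_of_add fourier_add fun_of_cont)
    then show ?thesis by (simp add: norm_H10_wl2 wl2_add)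
  qed
qed

end

lemma fourier_fun_of_diff:
  "fourier (fun_of (u - v)) k = fourier (fun_of u) k - fourier (fun_of v) k"
  by (simp add: minus_H10_def uminus_H10_def fun_of_add fun_of_scaleC fourier_cmult
      fourier_add[OF fun_of_cont continuous_on_mult_left[OF fun_of_cont], simplified]
      fourier_diff[OF fun_of_cont fun_of_cont])

instance H10 :: complex_banach
proof
  fix X :: "nat \<Rightarrow> H10"
  assume X: "Cauchy X"
  define a where "a n = fourier (fun_of (X n))" for n
  have a_diff: "(\<lambda>k. a m k - a n k) = fourier (fun_of (X m - X n))" for m n
    by (auto simp: a_def fourier_fun_of_diff)
  have comp: "cmod (a m k - a n k) \<le> norm (X m - X n)" for m n k
    using wl2_component'[of "fourier (fun_of (X m - X n))" k]
    by (simp add: fourier_fun_of_diff a_def norm_H10_wl2)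
  have "Cauchy (\<lambda>n. a n k)" for k
  proof (rule metric_CauchyI)
    fix e :: real assume "e > 0"
    with X obtain N where "\<forall>m\<ge>N. \<forall>n\<ge>N. dist (X m) (X n) < e"
      by (auto simp: Cauchy_def)
    then show "\<exists>N. \<forall>m\<ge>N. \<forall>n\<ge>N. dist (a m k) (a n k) < e"
      using comp unfolding dist_norm by (meson le_less_trans)
  qed
  then have "convergent (\<lambda>n. a n k)" for k by (rule Cauchy_convergent)
  then obtain c where c: "\<And>k. (\<lambda>n. a n k) \<longlonglongrightarrow> c k" unfolding convergent_def by metis
  have close: "wl2 (\<lambda>k. c k - a n k) \<and> wl2_norm (\<lambda>k. c k - a n k) \<le> e"
    if N: "\<And>m. m \<ge> N \<Longrightarrow> dist (X m) (X n) \<le> e" for N n e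
  proof -
    have "L2_set (\<lambda>k. cmod (c k - a n k) * jap k) A \<le> e" if A: "finite A" for A
    proof (rule LIMSEQ_le_const2)
      show "(\<lambda>m. L2_set (\<lambda>k. cmod (a m k - a n k) * jap k) A)
              \<longlonglongrightarrow> L2_set (\<lambda>k. cmod (c k - a n k) * jap k) A"
        unfolding L2_set_def by (intro tendsto_intros c)
      have "L2_set (\<lambda>k. cmod (a m k - a n k) * jap k) A \<le> dist (X m) (X n)" for m
        using wl2_fin[OF wl2_fun_of A, of "X m - X n"] unfolding a_diff[symmetric]
        by (simp add: dist_norm norm_H10_wl2 a_diff)
      then show "\<exists>N. \<forall>m\<ge>N. L2_set (\<lambda>k. cmod (a m k - a n k) * jap k) A \<le> e"
        using N order_trans by blast
    qed
    from wl2_bound[OF this] show ?thesis by blast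
  qed
  have "wl2 c"
  proof -
    obtain N where "\<forall>m\<ge>N. \<forall>n\<ge>N. dist (X m) (X n) < 1"
      using X unfolding Cauchy_def by (meson zero_less_one)
    then have "wl2 (\<lambda>k. c k - a N k)" using close[of N N 1] by force
    then have "wl2 (\<lambda>k. (c k - a N k) + a N k)"
      by (rule wl2_add) (simp add: a_def)
    then show ?thesis by simp
  qed
  define f where "f = (\<lambda>y. \<Sum>\<^sub>\<infinity>k. c k * fexp k y)"
  have f: "f \<in> H1" "fourier f = c"
    unfolding f_def by (rule wl2_synthesis[OF \<open>wl2 c\<close>])+
  have "c k = 0" if "k \<le> 0" for k
    using c[of k] that by (simp add: a_def LIMSEQ_const_iff)
  with f have *: "fun_of (Abs_H10 f) = f" by (intro Abs_H10_inverse) simp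
  have "X \<longlonglongrightarrow> Abs_H10 f"
  proof (rule metric_LIMSEQ_I)
    fix e :: real assume "e > 0"
    then obtain N where N: "\<And>m n. m \<ge> N \<Longrightarrow> n \<ge> N \<Longrightarrow> dist (X m) (X n) < e / 2"
      using X unfolding Cauchy_def by (meson half_gt_zero)
    have "dist (X n) (Abs_H10 f) < e" if "n \<ge> N" for n
    proof -
      have "fourier (fun_of (Abs_H10 f - X n)) = (\<lambda>k. c k - a n k)"
        by (auto simp: fourier_fun_of_diff * f a_def)
      then have "dist (Abs_H10 f) (X n) \<le> e / 2"
        using close[of N n "e / 2"] N that by (simp add: dist_norm norm_H10_wl2 less_imp_le)
      then show ?thesis using \<open>e > 0\<close> by (simp add: dist_commute)
    qed
    then show "\<exists>N. \<forall>n\<ge>N. dist (X n) (Abs_H10 f) < e" by blast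
  qed
  then show "convergent X" unfolding convergent_def by blast
qed

definition nonvanishing :: "H10 set"
  where "nonvanishing = {w. \<forall>y. fun_of w y \<noteq> 0}"

section \<open>The Hamiltonians\<close>

definition Pi_plus :: "(real \<Rightarrow> complex) \<Rightarrow> real \<Rightarrow> complex"
  where "Pi_plus f y = (\<Sum>\<^sub>\<infinity>k\<in>{0..}. fourier f k * fexp k y)"

definition Pi_plus0 :: "(real \<Rightarrow> complex) \<Rightarrow> real \<Rightarrow> complex"
  where "Pi_plus0 f y = (\<Sum>\<^sub>\<infinity>k\<in>{1..}. fourier f k * fexp k y)"

text \<open>The pairing is bilinear: no complex conjugation, and equal indices are multiplied.\<close>

definition pairing :: "(real \<Rightarrow> complex) \<Rightarrow> (real \<Rightarrow> complex) \<Rightarrow> complex"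
  where "pairing f g = (\<Sum>\<^sub>\<infinity>k. fourier f k * fourier g k)"

definition shift :: "(real \<Rightarrow> complex) \<Rightarrow> real \<Rightarrow> complex"
  where "shift f y = f y * fexp (- 1) y"

definition A_op :: "nat \<Rightarrow> (real \<Rightarrow> complex) \<Rightarrow> (real \<Rightarrow> complex) \<Rightarrow> real \<Rightarrow> complex" where
  "A_op k w g y =
     g y * Pi_plus ((shift ^^ (k + 1)) w) y - w y * Pi_plus ((shift ^^ (k + 1)) g) y"

definition Gamma_op :: "(real \<Rightarrow> complex) \<Rightarrow> (real \<Rightarrow> complex) \<Rightarrow> real \<Rightarrow> complex"
  where "Gamma_op w p = Pi_plus0 (\<lambda>y. w y * p (- y))"

definition H_fun :: "(real \<Rightarrow> complex) \<Rightarrow> H10 \<times> H10 \<Rightarrow> complex" where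
  "H_fun f = (\<lambda>(w, p).
     pairing (fun_of w) (\<lambda>y. (fun_of p y)\<^sup>2) + integral {0..1} (\<lambda>y. f y / fun_of w y))"

definition J_fun :: "(real \<Rightarrow> complex) \<Rightarrow> nat \<Rightarrow> H10 \<times> H10 \<Rightarrow> complex" where
  "J_fun f k = (\<lambda>(w, p).
     pairing (A_op k (fun_of w) (Gamma_op (fun_of w) (fun_of p))) (fun_of p)
     - fourier (\<lambda>y. fun_of w y * Pi_plus0 (\<lambda>y. f y / fun_of w y) y) (int k + 1))"

section \<open>Hamiltonian vector fields\<close>

text \<open>
  The derivatives are real Frechet derivatives; for a complex analytic function they are
  automatically complex linear.
  A distribution whose Fourier coefficients vanish for \<open>k \<le> 0\<close> is determined by its pairing with
  \<^typ>\<open>H10\<close>; that it lies in \<^typ>\<open>H10\<close> means that the partial derivative is the pairing with an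
  element of \<^typ>\<open>H10\<close>.
\<close>

definition is_grad_w :: "(H10 \<times> H10 \<Rightarrow> complex) \<Rightarrow> H10 \<times> H10 \<Rightarrow> H10 \<Rightarrow> bool" where
  "is_grad_w F z g \<longleftrightarrow>
     ((\<lambda>w. F (w, snd z)) has_derivative (\<lambda>dw. pairing (fun_of g) (fun_of dw))) (at (fst z))"

definition is_grad_p :: "(H10 \<times> H10 \<Rightarrow> complex) \<Rightarrow> H10 \<times> H10 \<Rightarrow> H10 \<Rightarrow> bool" where
  "is_grad_p F z g \<longleftrightarrow>
     ((\<lambda>p. F (fst z, p)) has_derivative (\<lambda>dp. pairing (fun_of g) (fun_of dp))) (at (snd z))"

definition grad_w :: "(H10 \<times> H10 \<Rightarrow> complex) \<Rightarrow> H10 \<times> H10 \<Rightarrow> H10"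
  where "grad_w F z = (THE g. is_grad_w F z g)"

definition grad_p :: "(H10 \<times> H10 \<Rightarrow> complex) \<Rightarrow> H10 \<times> H10 \<Rightarrow> H10"
  where "grad_p F z = (THE g. is_grad_p F z g)"

definition ham_vf :: "(H10 \<times> H10 \<Rightarrow> complex) \<Rightarrow> H10 \<times> H10 \<Rightarrow> H10 \<times> H10"
  where "ham_vf F z = (grad_p F z, - grad_w F z)"

definition ham_vf_well_defined_on :: "(H10 \<times> H10) set \<Rightarrow> (H10 \<times> H10 \<Rightarrow> complex) \<Rightarrow> bool" where
  "ham_vf_well_defined_on U F \<longleftrightarrow>
     (\<forall>z\<in>U. (\<exists>!g. is_grad_w F z g) \<and> (\<exists>!g. is_grad_p F z g))"

end

(*
  Every map involved is built from continuous bilinear and linear operations on the Banach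
  algebra of Sobolev functions (multiplication, truncation of the Fourier series, reflection)
  and from w |-> 1/w, which is analytic by the Neumann series; maps with local power series
  expansions are closed under such operations (Cauchy product). The pairing is
  <g, h> = (h(y) g(-y))_0, so multiplication operators have multiplication operators as
  adjoints and truncations are self-adjoint. Transposing the derivatives of H_f and J_k with
  these rules exhibits the gradients as truncations of Sobolev functions, again built from the
  same operations. That the space is an algebra closed under reciprocals of nowhere vanishing
  functions follows from Parseval and Bessel, which characterise it by
  sup_h |f(. + h) - f|_2 / h < infinity.
*)
theory Submission
  imports Defs
begin

text \<open>Gradients are Frechet derivatives and analyticity is a matter of power series; no bridge
  is built from one to the other. Over nowhere vanishing \<open>w\<close> each Hamiltonian is an
  expression in an algebra. Its derivative is computed by the product rule, transposing the
  derivative gives a closed formula for the gradient, and that formula is expanded on its own.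
  Reciprocals are therefore treated twice, in \<open>power_series_at_recip\<close> and in
  \<open>has_derivative_recip\<close>. The algebra is set up as a normed space without a
  completeness instance, so absolute convergence does not by itself provide a sum: the Cauchy
  product and the Neumann series identify their limits explicitly. The norm lives on Fourier
  coefficients, whereas a reciprocal is a pointwise operation. Mean squares of differences f(y + h)
  - f(y) can be estimated on both sides, which is why they carry the proof that the space is closed
  under products and reciprocals.\<close>

section \<open>Power series between complex normed spaces\<close>

text \<open>The local condition of \<open>complex_analytic_on\<close>, stated for normed spaces so
  that it also covers maps into the algebra \<open>sobolev\<close>. On the zero space a bound
  \<open>M n\<close> with n > 0 could be negative, so \<open>0 \<le> M n\<close> is imposed; the
  estimates for Cauchy products and smaller radii rely on it.\<close>

definition power_series_at ::
    "('a::complex_normed_vector \<Rightarrow> 'b::complex_normed_vector) \<Rightarrow> 'a \<Rightarrow> bool" where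
  "power_series_at F x \<longleftrightarrow>
     (\<exists>r>0. \<exists>A M. (\<forall>n. 0 \<le> M n \<and> bounded_clinear_n n (M n) (A n)) \<and>
        summable (\<lambda>n. M n * r ^ n) \<and>
        (\<forall>h. norm h < r \<longrightarrow> (\<lambda>n. A n (\<lambda>_. h)) sums F (x + h)))"

definition bounded_clinear ::
    "('a::complex_normed_vector \<Rightarrow> 'b::complex_normed_vector) \<Rightarrow> bool" where
  "bounded_clinear T \<longleftrightarrow> (\<forall>x y. T (x + y) = T x + T y) \<and> (\<forall>c x. T (c *\<^sub>C x) = c *\<^sub>C T x) \<and>
     (\<exists>K. \<forall>x. norm (T x) \<le> norm x * K)"

definition bounded_cbilinear ::
    "('a::complex_normed_vector \<Rightarrow> 'b::complex_normed_vector \<Rightarrow> 'c::complex_normed_vector) \<Rightarrow> bool"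
  where
  "bounded_cbilinear B \<longleftrightarrow>
     (\<forall>x y z. B (x + y) z = B x z + B y z) \<and> (\<forall>x y z. B x (y + z) = B x y + B x z) \<and>
     (\<forall>c x y. B (c *\<^sub>C x) y = c *\<^sub>C B x y) \<and> (\<forall>c x y. B x (c *\<^sub>C y) = c *\<^sub>C B x y) \<and>
     (\<exists>K. \<forall>x y. norm (B x y) \<le> norm x * norm y * K)"

lemma scaleC_zero_right [simp]: "c *\<^sub>C (0 :: 'a::complex_normed_vector) = 0"
  using scaleC_add_right[of c "0 :: 'a" 0] by simp

lemma scaleC_minus_right: "c *\<^sub>C (- x) = - (c *\<^sub>C (x :: 'a::complex_normed_vector))"
  using scaleC_add_right[of c x "- x"] by (simp add: eq_neg_iff_add_eq_0 add.commute)

lemma scaleR_scaleC: "r *\<^sub>R (x :: 'a::complex_normed_vector) = of_real r *\<^sub>C x"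
  by (simp add: scaleC_of_real)

text \<open>Restricting the scalars to the reals makes the rules for sums, limits and derivatives
  available; the bound \<open>norm x * K\<close> has the shape used by
  \<open>bounded_linear\<close>.\<close>

lemma bounded_clinear_imp_bounded_linear: "bounded_clinear T \<Longrightarrow> bounded_linear T"
  unfolding bounded_clinear_def
  by (auto intro!: bounded_linear_intro simp: scaleR_scaleC)

lemma bounded_cbilinear_imp_bounded_bilinear: "bounded_cbilinear B \<Longrightarrow> bounded_bilinear B"
  unfolding bounded_cbilinear_def bounded_bilinear_def by (auto simp: scaleR_scaleC)

lemma bounded_clinear_compose:
  assumes "bounded_clinear S" "bounded_clinear T"
  shows "bounded_clinear (\<lambda>x. S (T x))"
proof -
  interpret S: bounded_linear S by (rule bounded_clinear_imp_bounded_linear[OF assms(1)])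
  interpret T: bounded_linear T by (rule bounded_clinear_imp_bounded_linear[OF assms(2)])
  have "\<exists>K. \<forall>x. norm (S (T x)) \<le> norm x * K"
    by (rule bounded_linear.bounded[OF bounded_linear_compose[OF S.bounded_linear_axioms
          T.bounded_linear_axioms]])
  then show ?thesis
    using assms unfolding bounded_clinear_def by auto
qed

section \<open>Bounded n-linear maps\<close>

lemma bounded_clinear_n_zero: "bounded_clinear_n n 0 (\<lambda>_. 0)"
  unfolding bounded_clinear_n_def by simp

lemma bounded_clinear_n_compose:
  assumes "bounded_clinear_n n M A" "bounded_clinear T" "\<And>y. norm (T y) \<le> norm y * K" "0 \<le> K"
  shows "bounded_clinear_n n (M * K) (\<lambda>x. T (A x))"
proof -
  have "norm (T (A x)) \<le> M * K * (\<Prod>i<n. norm (x i))" for x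
  proof -
    have "norm (A x) \<le> M * (\<Prod>i<n. norm (x i))"
      using assms(1) unfolding bounded_clinear_n_def by blast
    then have "norm (A x) * K \<le> M * (\<Prod>i<n. norm (x i)) * K"
      by (rule mult_right_mono[OF _ assms(4)])
    with assms(3)[of "A x"] show ?thesis by (simp add: mult_ac)
  qed
  moreover have "\<forall>x y. (\<forall>i<n. x i = y i) \<longrightarrow> T (A x) = T (A y)"
    using assms(1) unfolding bounded_clinear_n_def by metis
  ultimately show ?thesis
    using assms(1,2) unfolding bounded_clinear_n_def bounded_clinear_def by auto
qed

lemma bounded_clinear_n_add:
  assumes "bounded_clinear_n n M A" "bounded_clinear_n n M' A'"
  shows "bounded_clinear_n n (M + M') (\<lambda>x. A x + A' x)"
proof -
  have "norm (A x + A' x) \<le> (M + M') * (\<Prod>i<n. norm (x i))" for x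
  proof -
    have "norm (A x) \<le> M * (\<Prod>i<n. norm (x i))" "norm (A' x) \<le> M' * (\<Prod>i<n. norm (x i))"
      using assms unfolding bounded_clinear_n_def by blast+
    with norm_triangle_ineq[of "A x" "A' x"] show ?thesis by (simp add: distrib_right)
  qed
  moreover have "\<forall>x y. (\<forall>i<n. x i = y i) \<longrightarrow> A x + A' x = A y + A' y"
    using assms unfolding bounded_clinear_n_def by metis
  ultimately show ?thesis
    using assms unfolding bounded_clinear_n_def by (simp add: scaleC_add_right add_ac)
qed

lemma bounded_clinear_n_sum:
  assumes "\<And>i. i \<in> I \<Longrightarrow> bounded_clinear_n n (M i) (A i)"
  shows "bounded_clinear_n n (\<Sum>i\<in>I. M i) (\<lambda>x. \<Sum>i\<in>I. A i x)"
  using assms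
  by (induction I rule: infinite_finite_induct)
    (simp_all add: bounded_clinear_n_zero bounded_clinear_n_add)

lemma prod_lessThan_split:
  fixes f :: "nat \<Rightarrow> 'a::comm_monoid_mult"
  shows "(\<Prod>j<i + m. f j) = (\<Prod>j<i. f j) * (\<Prod>j<m. f (j + i))"
  by (induction m) (simp_all add: mult_ac add.commute[of i])

text \<open>A tensor product: \<open>A\<close> reads the first \<open>i\<close> arguments and
  \<open>A'\<close> the next \<open>m\<close>, through the index shift by \<open>i\<close>. Changing
  argument \<open>j\<close> affects only one factor: \<open>A\<close> if \<open>j < i\<close>, and
  otherwise \<open>A'\<close> in position \<open>j - i\<close>. These maps are the terms of the
  Cauchy product.\<close>

lemma bounded_clinear_n_bilinear:
  assumes A: "bounded_clinear_n i M A" and A': "bounded_clinear_n m M' A'" and B: "bounded_cbilinear B"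
    and K: "\<And>x y. norm (B x y) \<le> norm x * norm y * K" and pos: "0 \<le> M" "0 \<le> M'" "0 \<le> K"
  shows "bounded_clinear_n (i + m) (M * M' * K) (\<lambda>x. B (A x) (A' (\<lambda>j. x (j + i))))"
    (is "bounded_clinear_n _ _ ?C")
proof -
  have cong: "A x = A y" if "\<And>j. j < i \<Longrightarrow> x j = y j" for x y
    using A that unfolding bounded_clinear_n_def by blast
  have cong': "A' x = A' y" if "\<And>j. j < m \<Longrightarrow> x j = y j" for x y
    using A' that unfolding bounded_clinear_n_def by blast
  have left: "?C (x(j := u)) = B (A (x(j := u))) (A' (\<lambda>j. x (j + i)))" if "j < i" for x j u
    by (rule arg_cong[of _ _ "B _"], rule cong') (use that in auto)
  have right: "?C (x(j := u)) = B (A x) (A' ((\<lambda>j. x (j + i))(j - i := u)))" if "\<not> j < i" for x j u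
    by (rule arg_cong2[of _ _ _ _ B], rule cong, use that in auto, rule cong') auto
  have "?C x = ?C y" if "\<forall>j<i + m. x j = y j" for x y
    by (rule arg_cong2[of _ _ _ _ B], rule cong, use that in auto, rule cong') (use that in auto)
  moreover have "?C (x(j := u + v)) = ?C (x(j := u)) + ?C (x(j := v))"
    and "?C (x(j := c *\<^sub>C u)) = c *\<^sub>C ?C (x(j := u))" if "j < i + m" for x j u v c
  proof -
    note linear = A[unfolded bounded_clinear_n_def] A'[unfolded bounded_clinear_n_def]
      B[unfolded bounded_cbilinear_def]
    have "?C (x(j := u + v)) = ?C (x(j := u)) + ?C (x(j := v)) \<and>
        ?C (x(j := c *\<^sub>C u)) = c *\<^sub>C ?C (x(j := u))"
    proof (cases "j < i")
      case True
      then show ?thesis unfolding left[OF True] using linear by simp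
    next
      case False
      then have "j - i < m" using that by linarith
      then show ?thesis unfolding right[OF False] using linear by simp
    qed
    then show "?C (x(j := u + v)) = ?C (x(j := u)) + ?C (x(j := v))"
      "?C (x(j := c *\<^sub>C u)) = c *\<^sub>C ?C (x(j := u))" by blast+
  qed
  moreover have "norm (?C x) \<le> M * M' * K * (\<Prod>j<i + m. norm (x j))" for x
  proof -
    have "norm (A x) * norm (A' (\<lambda>j. x (j + i))) * K
        \<le> (M * (\<Prod>j<i. norm (x j))) * (M' * (\<Prod>j<m. norm (x (j + i)))) * K"
      using A A' pos unfolding bounded_clinear_n_def
      by (intro mult_right_mono mult_mono mult_nonneg_nonneg prod_nonneg) auto
    with K[of "A x" "A' (\<lambda>j. x (j + i))"] show ?thesis
      by (simp add: prod_lessThan_split mult_ac)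
  qed
  ultimately show ?thesis unfolding bounded_clinear_n_def by blast
qed

section \<open>Closure rules for local power series\<close>

lemma power_series_atE:
  assumes "power_series_at F x"
  obtains r M A where "r > 0" "\<forall>n. 0 \<le> M n" "\<forall>n. bounded_clinear_n n (M n) (A n)"
    "summable (\<lambda>n. M n * r ^ n)" "\<forall>h. norm h < r \<longrightarrow> (\<lambda>n. A n (\<lambda>_. h)) sums F (x + h)"
proof -
  obtain r M A where *: "r > 0" "\<forall>n. 0 \<le> M n \<and> bounded_clinear_n n (M n) (A n)"
    "summable (\<lambda>n. M n * r ^ n)" "\<forall>h. norm h < r \<longrightarrow> (\<lambda>n. A n (\<lambda>_. h)) sums F (x + h)"
    using assms unfolding power_series_at_def by (elim exE conjE)
  show ?thesis by (rule that[of r M A]) (use * in blast)+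
qed

lemma summable_power_mono:
  fixes M :: "nat \<Rightarrow> real"
  assumes "summable (\<lambda>n. M n * r ^ n)" "\<And>n. 0 \<le> M n" "0 \<le> s" "s \<le> r"
  shows "summable (\<lambda>n. M n * s ^ n)"
  by (rule summable_comparison_test[OF _ assms(1)])
    (use assms in \<open>auto intro!: mult_left_mono power_mono simp: abs_mult\<close>)

text \<open>\<open>G\<close> is a Hamiltonian or a vector field and \<open>F\<close> its algebraic
  expression; they agree on \<open>U\<close>, so the radius is shrunk until the ball stays inside
  \<open>U\<close>.\<close>

lemma power_series_at_imp_analytic_on:
  assumes "open U" "\<And>x. x \<in> U \<Longrightarrow> power_series_at F x" "\<And>x. x \<in> U \<Longrightarrow> G x = F x"
  shows "complex_analytic_on U (G :: 'a::complex_banach \<Rightarrow> 'b::complex_banach)"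
  unfolding complex_analytic_on_def
proof (intro conjI ballI assms(1))
  fix x assume x: "x \<in> U"
  obtain r M A where r: "r > 0" and M [rule_format]: "\<forall>n. 0 \<le> M n" "\<forall>n. bounded_clinear_n n (M n) (A n)"
    and s: "summable (\<lambda>n. M n * r ^ n)"
    and F [rule_format]: "\<forall>h. norm h < r \<longrightarrow> (\<lambda>n. A n (\<lambda>_. h)) sums F (x + h)"
    by (rule power_series_atE[OF assms(2)[OF x]])
  obtain e where e: "e > 0" "\<And>y. dist y x < e \<Longrightarrow> y \<in> U"
    using assms(1) x unfolding open_dist by blast
  show "\<exists>r>0. \<exists>A M. (\<forall>n. bounded_clinear_n n (M n) (A n)) \<and> summable (\<lambda>n. M n * r ^ n) \<and>
      (\<forall>h. norm h < r \<longrightarrow> (\<lambda>n. A n (\<lambda>_. h)) sums G (x + h))"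
  proof (intro exI[of _ "min r e"] exI[of _ A] exI[of _ M] conjI allI impI)
    show "summable (\<lambda>n. M n * min r e ^ n)"
      by (rule summable_power_mono[OF s M(1)]) (use r e in auto)
    show "(\<lambda>n. A n (\<lambda>_. h)) sums G (x + h)" if "norm h < min r e" for h
      using F[of h] assms(3) e(2)[of "x + h"] that by (simp add: dist_norm)
  qed (use r e M in auto)
qed

lemma power_series_atI:
  assumes "r > 0" "\<And>n. 0 \<le> M n" "\<And>n. bounded_clinear_n n (M n) (A n)"
    "summable (\<lambda>n. M n * r ^ n)" "\<And>h. norm h < r \<Longrightarrow> (\<lambda>n. A n (\<lambda>_. h)) sums F (x + h)"
  shows "power_series_at F x"
  unfolding power_series_at_def
  by (rule exI[of _ r], rule conjI[OF assms(1)], rule exI[of _ A], rule exI[of _ M])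
    (use assms in blast)

lemma power_series_at_const: "power_series_at (\<lambda>_. c) x"
proof (rule power_series_atI[where r = 1 and A = "\<lambda>n _. if n = 0 then c else 0"
      and M = "\<lambda>n. if n = 0 then norm c else 0"])
  fix n :: nat and h :: 'a
  show "bounded_clinear_n n (if n = 0 then norm c else 0) (\<lambda>_. if n = 0 then c else 0)"
    unfolding bounded_clinear_n_def by auto
  show "(\<lambda>n. if n = 0 then c else 0) sums c" by (rule sums_single)
  show "summable (\<lambda>n. (if n = 0 then norm c else 0) * 1 ^ n)"
    by (rule summable_finite[of "{0}"]) auto
qed auto

lemma power_series_at_clinear:
  assumes "bounded_clinear T"
  shows "power_series_at T x"
proof -
  interpret bounded_linear T by (rule bounded_clinear_imp_bounded_linear[OF assms])
  obtain K where K: "K > 0" "\<And>x. norm (T x) \<le> norm x * K" using pos_bounded by blast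
  define A where "A n y = (if n = 0 then T x else if n = 1 then T (y 0) else 0)"
    for n :: nat and y :: "nat \<Rightarrow> 'a"
  define M where "M n = (if n = 0 then norm (T x) else if n = 1 then K else 0)" for n :: nat
  have "bounded_clinear_n n (M n) (A n)" for n
  proof -
    consider "n = 0" | "n = 1" | "n > 1" by linarith
    then show ?thesis
      by cases (use K assms in
          \<open>auto simp: A_def M_def bounded_clinear_n_def bounded_clinear_def mult.commute\<close>)
  qed
  moreover have "(\<lambda>n. A n (\<lambda>_. h)) sums T (x + h)" for h
  proof -
    have "(\<lambda>n. A n (\<lambda>_. h)) sums (\<Sum>n\<in>{0, 1}. A n (\<lambda>_. h))"
      by (rule sums_finite) (auto simp: A_def)
    then show ?thesis by (simp add: A_def add)
  qed
  moreover have "summable (\<lambda>n. M n * 1 ^ n)"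
    by (rule summable_finite[of "{0, 1}"]) (auto simp: M_def)
  moreover have "0 \<le> M n" for n using K by (simp add: M_def)
  ultimately show ?thesis
    by (intro power_series_atI[of 1 M A]) auto
qed

lemma power_series_at_compose_clinear:
  assumes "bounded_clinear T" "power_series_at F x"
  shows "power_series_at (\<lambda>z. T (F z)) x"
proof -
  interpret bounded_linear T by (rule bounded_clinear_imp_bounded_linear[OF assms(1)])
  obtain K where K: "K > 0" "\<And>x. norm (T x) \<le> norm x * K" using pos_bounded by blast
  obtain r M A where r: "r > 0" and M [rule_format]: "\<forall>n. 0 \<le> M n" "\<forall>n. bounded_clinear_n n (M n) (A n)"
    and s: "summable (\<lambda>n. M n * r ^ n)"
    and F [rule_format]: "\<forall>h. norm h < r \<longrightarrow> (\<lambda>n. A n (\<lambda>_. h)) sums F (x + h)"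
    by (rule power_series_atE[OF assms(2)])
  have "bounded_clinear_n n (M n * K) (\<lambda>x. T (A n x))" for n
    using K by (intro bounded_clinear_n_compose M assms) auto
  moreover have "summable (\<lambda>n. M n * K * r ^ n)"
    using summable_mult[OF s, of K] by (simp add: mult_ac)
  moreover have "(\<lambda>n. T (A n (\<lambda>_. h))) sums T (F (x + h))" if "norm h < r" for h
    by (rule sums[OF F[OF that]])
  ultimately show ?thesis
    by (intro power_series_atI[of r "\<lambda>n. M n * K" "\<lambda>n x. T (A n x)"]) (use r M K in auto)
qed

lemma power_series_at_common_radius:
  assumes "power_series_at F x" "power_series_at G x"
  obtains r M A M' A' where "r > 0"
    "\<forall>n. 0 \<le> M n" "\<forall>n. bounded_clinear_n n (M n) (A n)" "summable (\<lambda>n. M n * r ^ n)"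
    "\<forall>h. norm h < r \<longrightarrow> (\<lambda>n. A n (\<lambda>_. h)) sums F (x + h)"
    "\<forall>n. 0 \<le> M' n" "\<forall>n. bounded_clinear_n n (M' n) (A' n)" "summable (\<lambda>n. M' n * r ^ n)"
    "\<forall>h. norm h < r \<longrightarrow> (\<lambda>n. A' n (\<lambda>_. h)) sums G (x + h)"
proof -
  obtain r M A where F [rule_format]: "r > 0" "\<forall>n. 0 \<le> M n" "\<forall>n. bounded_clinear_n n (M n) (A n)"
    "summable (\<lambda>n. M n * r ^ n)" "\<forall>h. norm h < r \<longrightarrow> (\<lambda>n. A n (\<lambda>_. h)) sums F (x + h)"
    by (rule power_series_atE[OF assms(1)])
  obtain r' M' A' where G [rule_format]: "r' > 0" "\<forall>n. 0 \<le> M' n" "\<forall>n. bounded_clinear_n n (M' n) (A' n)"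
    "summable (\<lambda>n. M' n * r' ^ n)" "\<forall>h. norm h < r' \<longrightarrow> (\<lambda>n. A' n (\<lambda>_. h)) sums G (x + h)"
    by (rule power_series_atE[OF assms(2)])
  have "summable (\<lambda>n. M n * min r r' ^ n)" "summable (\<lambda>n. M' n * min r r' ^ n)"
    using summable_power_mono[OF F(4,2), of "min r r'"] summable_power_mono[OF G(4,2), of "min r r'"]
      F(1) G(1) by auto
  then show ?thesis by (intro that[of "min r r'" M A M' A']) (use F G in auto)
qed

lemma power_series_at_add:
  assumes "power_series_at F x" "power_series_at G x"
  shows "power_series_at (\<lambda>z. F z + G z) x"
proof -
  obtain r M A M' A' where H [rule_format]: "r > 0"
    "\<forall>n. 0 \<le> M n" "\<forall>n. bounded_clinear_n n (M n) (A n)" "summable (\<lambda>n. M n * r ^ n)"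
    "\<forall>h. norm h < r \<longrightarrow> (\<lambda>n. A n (\<lambda>_. h)) sums F (x + h)"
    "\<forall>n. 0 \<le> M' n" "\<forall>n. bounded_clinear_n n (M' n) (A' n)" "summable (\<lambda>n. M' n * r ^ n)"
    "\<forall>h. norm h < r \<longrightarrow> (\<lambda>n. A' n (\<lambda>_. h)) sums G (x + h)"
    by (rule power_series_at_common_radius[OF assms])
  have "summable (\<lambda>n. (M n + M' n) * r ^ n)"
    using summable_add[OF H(4,8)] by (simp add: distrib_right)
  then show ?thesis
    by (intro power_series_atI[of r "\<lambda>n. M n + M' n" "\<lambda>n x. A n x + A' n x"])
      (use H in \<open>simp_all add: bounded_clinear_n_add sums_add\<close>)
qed

lemma sum_lessThan_triangle:
  fixes f :: "nat \<Rightarrow> nat \<Rightarrow> 'a::comm_monoid_add"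
  shows "(\<Sum>n<N. \<Sum>i\<le>n. f i (n - i)) = (\<Sum>(i, j)\<in>{(i, j). i + j < N}. f i j)"
  unfolding sum.Sigma[OF finite_lessThan ballI[OF finite_atMost]]
  by (rule sum.reindex_bij_witness[where i = "\<lambda>(i, j). (i + j, i)" and j = "\<lambda>(n, i). (i, n - i)"])
    auto

text \<open>Partial sums of the Cauchy product run over triangles. Sums over squares factor and
  converge to \<open>B x y\<close> by continuity; square minus triangle is dominated by the same
  difference for the series of norms, where the real Cauchy product applies. This needs no Cauchy
  criterion in the target space.\<close>

lemma Cauchy_product_bilinear:
  assumes "bounded_bilinear B" "summable (\<lambda>n. norm (a n))" "summable (\<lambda>n. norm (b n))"
    and sums: "a sums x" "b sums y"
  shows "(\<lambda>n. \<Sum>i\<le>n. B (a i) (b (n - i))) sums B x y"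
proof -
  interpret bounded_bilinear B by fact
  obtain K where K: "K > 0" "\<And>x y. norm (B x y) \<le> norm x * norm y * K" using pos_bounded by blast
  define \<alpha> \<beta> where "\<alpha> n = norm (a n)" and "\<beta> n = norm (b n)" for n
  have summable: "summable \<alpha>" "summable \<beta>"
    using assms(2,3) by (simp_all add: \<alpha>_def[abs_def] \<beta>_def[abs_def])
  define T Q where "T N = {(i, j). i + j < (N::nat)}" and "Q N = {..<N} \<times> {..<N}" for N
  have TQ: "T N \<subseteq> Q N" "finite (Q N)" for N by (auto simp: T_def Q_def)
  have finT: "finite (T N)" for N using finite_subset[OF TQ] .
  have square: "(\<lambda>N. \<Sum>(i, j)\<in>Q N. B (a i) (b j)) \<longlonglongrightarrow> B x y"
  proof -
    have "(\<Sum>(i, j)\<in>Q N. B (a i) (b j)) = B (\<Sum>i<N. a i) (\<Sum>j<N. b j)" for N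
      unfolding Q_def sum.cartesian_product[symmetric]
      by (simp only: sum_left sum_right) (rule sum.swap)
    then show ?thesis using tendsto[OF sums[unfolded sums_def]] by simp
  qed
  \<comment> \<open>Square and triangle sums of the norms have the same limit, so \<open>d\<close>
    tends to 0.\<close>
  define d where "d N = (\<Sum>(i, j)\<in>Q N. \<alpha> i * \<beta> j) - (\<Sum>(i, j)\<in>T N. \<alpha> i * \<beta> j)" for N
  have "d \<longlonglongrightarrow> suminf \<alpha> * suminf \<beta> - suminf \<alpha> * suminf \<beta>"
    unfolding d_def
  proof (rule tendsto_diff)
    have "(\<Sum>(i, j)\<in>Q N. \<alpha> i * \<beta> j) = (\<Sum>i<N. \<alpha> i) * (\<Sum>j<N. \<beta> j)" for N
      unfolding Q_def by (simp add: sum_product sum.cartesian_product)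
    then show "(\<lambda>N. \<Sum>(i, j)\<in>Q N. \<alpha> i * \<beta> j) \<longlonglongrightarrow> suminf \<alpha> * suminf \<beta>"
      using summable by (simp add: tendsto_mult summable_LIMSEQ)
    have "(\<lambda>n. \<Sum>i\<le>n. \<alpha> i * \<beta> (n - i)) sums (suminf \<alpha> * suminf \<beta>)"
      by (rule Cauchy_product_sums) (use assms(2,3) in \<open>simp_all add: \<alpha>_def \<beta>_def\<close>)
    then show "(\<lambda>N. \<Sum>(i, j)\<in>T N. \<alpha> i * \<beta> j) \<longlonglongrightarrow> suminf \<alpha> * suminf \<beta>"
      by (simp only: sums_def sum_lessThan_triangle[of "\<lambda>i j. \<alpha> i * \<beta> j"] T_def)
  qed
  then have d: "(\<lambda>N. d N * K) \<longlonglongrightarrow> 0" by (auto intro: tendsto_mult_left_zero)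
  have "(\<lambda>N. (\<Sum>(i, j)\<in>Q N. B (a i) (b j)) - (\<Sum>(i, j)\<in>T N. B (a i) (b j))) \<longlonglongrightarrow> 0"
  proof (rule Lim_null_comparison[OF always_eventually d], rule allI)
    fix N
    have "norm ((\<Sum>(i, j)\<in>Q N. B (a i) (b j)) - (\<Sum>(i, j)\<in>T N. B (a i) (b j)))
        = norm (\<Sum>(i, j)\<in>Q N - T N. B (a i) (b j))"
      by (subst sum_diff[OF TQ(2,1)]) simp
    also have "\<dots> \<le> (\<Sum>(i, j)\<in>Q N - T N. \<alpha> i * \<beta> j * K)"
      by (rule sum_norm_le) (use K in \<open>auto simp: \<alpha>_def \<beta>_def\<close>)
    also have "\<dots> = d N * K"
      unfolding d_def using sum_diff[OF TQ(2,1), of "\<lambda>(i, j). \<alpha> i * \<beta> j" N]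
      by (simp add: sum_distrib_right[symmetric] case_prod_unfold)
    finally show "norm ((\<Sum>(i, j)\<in>Q N. B (a i) (b j)) - (\<Sum>(i, j)\<in>T N. B (a i) (b j))) \<le> d N * K" .
  qed
  from tendsto_diff[OF square this]
  show ?thesis
    by (simp add: sums_def sum_lessThan_triangle[of "\<lambda>i j. B (a i) (b j)"] T_def)
qed

lemma power_series_at_bilinear:
  fixes F :: "'a::complex_normed_vector \<Rightarrow> 'b::complex_normed_vector"
    and G :: "'a \<Rightarrow> 'c::complex_normed_vector"
  assumes B: "bounded_cbilinear B" and FG: "power_series_at F x" "power_series_at G x"
  shows "power_series_at (\<lambda>z. B (F z) (G z)) x"
proof -
  interpret bounded_bilinear B by (rule bounded_cbilinear_imp_bounded_bilinear[OF B])
  obtain K where K: "K > 0" "\<And>x y. norm (B x y) \<le> norm x * norm y * K" using pos_bounded by blast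
  obtain r M A M' A' where H [rule_format]: "r > 0"
    "\<forall>n. 0 \<le> M n" "\<forall>n. bounded_clinear_n n (M n) (A n)" "summable (\<lambda>n. M n * r ^ n)"
    "\<forall>h. norm h < r \<longrightarrow> (\<lambda>n. A n (\<lambda>_. h)) sums F (x + h)"
    "\<forall>n. 0 \<le> M' n" "\<forall>n. bounded_clinear_n n (M' n) (A' n)" "summable (\<lambda>n. M' n * r ^ n)"
    "\<forall>h. norm h < r \<longrightarrow> (\<lambda>n. A' n (\<lambda>_. h)) sums G (x + h)"
    by (rule power_series_at_common_radius[OF FG])
  \<comment> \<open>The second factor receives the arguments from position \<open>i\<close> on; on
    the diagonal this shift changes nothing, so \<open>C n\<close> yields the term of degree
    \<open>n\<close> of the Cauchy product.\<close>
  define C where "C n y = (\<Sum>i\<le>n. B (A i y) (A' (n - i) (\<lambda>j. y (j + i))))"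
    for n and y :: "nat \<Rightarrow> 'a"
  define L where "L n = (\<Sum>i\<le>n. M i * M' (n - i) * K)" for n
  have "bounded_clinear_n n (L n) (C n)" for n
    unfolding L_def C_def
  proof (rule bounded_clinear_n_sum)
    fix i assume "i \<in> {..n}"
    then show "bounded_clinear_n n (M i * M' (n - i) * K)
        (\<lambda>y. B (A i y) (A' (n - i) (\<lambda>j. y (j + i))))"
      using bounded_clinear_n_bilinear[OF H(3)[of i] H(7)[of "n - i"] B K(2) H(2) H(6)] K(1) by simp
  qed
  moreover have "0 \<le> L n" for n
    unfolding L_def using H K by (intro sum_nonneg) auto
  moreover have "summable (\<lambda>n. L n * r ^ n)"
  proof -
    have "(\<lambda>n. \<Sum>i\<le>n. (M i * r ^ i) * (M' (n - i) * r ^ (n - i))) sums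
        ((\<Sum>n. M n * r ^ n) * (\<Sum>n. M' n * r ^ n))"
      by (rule Cauchy_product_sums) (use H in \<open>simp_all add: abs_mult\<close>)
    then have "summable (\<lambda>n. (\<Sum>i\<le>n. (M i * r ^ i) * (M' (n - i) * r ^ (n - i))) * K)"
      by (intro summable_mult2) (rule sums_summable)
    also have "(\<lambda>n. (\<Sum>i\<le>n. (M i * r ^ i) * (M' (n - i) * r ^ (n - i))) * K) = (\<lambda>n. L n * r ^ n)"
    proof
      fix n
      have "M i * r ^ i * (M' (n - i) * r ^ (n - i)) * K = M i * M' (n - i) * K * r ^ n"
        if "i \<le> n" for i
        using power_add[of r i "n - i"] that by simp
      then show "(\<Sum>i\<le>n. (M i * r ^ i) * (M' (n - i) * r ^ (n - i))) * K = L n * r ^ n"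
        unfolding L_def sum_distrib_right by (intro sum.cong) auto
    qed
    finally show ?thesis .
  qed
  moreover have "(\<lambda>n. C n (\<lambda>_. h)) sums B (F (x + h)) (G (x + h))" if h: "norm h < r" for h
    unfolding C_def
  proof (rule Cauchy_product_bilinear[OF bounded_bilinear_axioms])
    have "norm (A n (\<lambda>_. h)) \<le> M n * r ^ n" "norm (A' n (\<lambda>_. h)) \<le> M' n * r ^ n" for n
    proof -
      have "norm (A n (\<lambda>_. h)) \<le> M n * norm h ^ n" "norm (A' n (\<lambda>_. h)) \<le> M' n * norm h ^ n"
        using H(3)[of n, unfolded bounded_clinear_n_def, THEN conjunct2, THEN conjunct2,
            THEN conjunct2, rule_format, of "\<lambda>_. h"]
          H(7)[of n, unfolded bounded_clinear_n_def, THEN conjunct2, THEN conjunct2,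
            THEN conjunct2, rule_format, of "\<lambda>_. h"] by simp_all
      moreover have "norm h ^ n \<le> r ^ n" using h by (intro power_mono) auto
      ultimately show "norm (A n (\<lambda>_. h)) \<le> M n * r ^ n" "norm (A' n (\<lambda>_. h)) \<le> M' n * r ^ n"
        using H(2,6) by (meson mult_left_mono order_trans)+
    qed
    then show "summable (\<lambda>n. norm (A n (\<lambda>_. h)))" "summable (\<lambda>n. norm (A' n (\<lambda>_. h)))"
      by (auto intro: summable_comparison_test[OF _ H(4)] summable_comparison_test[OF _ H(8)])
  qed (use H h in auto)
  ultimately show ?thesis
    by (intro power_series_atI[of r L C]) (use H(1) in auto)
qed

section \<open>Fourier coefficients of products\<close>

lemma wl2_mono:
  assumes "wl2 d" "\<And>k. cmod (c k) \<le> cmod (d k)"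
  shows "wl2 c" "wl2_norm c \<le> wl2_norm d"
proof -
  have "L2_set (\<lambda>k. cmod (c k) * jap k) A \<le> wl2_norm d" if A: "finite A" for A
  proof -
    have "0 \<le> jap k" for k using jap_ge_1[of k] by simp
    then have "L2_set (\<lambda>k. cmod (c k) * jap k) A \<le> L2_set (\<lambda>k. cmod (d k) * jap k) A"
      by (intro L2_set_mono mult_right_mono assms) auto
    with wl2_fin[OF assms(1) A] show ?thesis by simp
  qed
  from wl2_bound[OF this] show "wl2 c" "wl2_norm c \<le> wl2_norm d" by blast+
qed

lemma wl2_finite_support:
  assumes "finite {k. c k \<noteq> 0}"
  shows "wl2 c"
  unfolding wl2_def summable_on_def
  by (rule exI, rule has_sum_finite_neutralI[OF assms]) auto

text \<open>Index 0 contributes 1, the indices 1 and -1 contribute 2, and the others at most 2 by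
  telescoping 1/(N+1)^2 \<le> 1/N - 1/(N+1). The total 5 is rounded up to the square 9; its root 3
  is the constant of the sup bound.\<close>

lemma sum_inverse_jap_squared:
  assumes "finite A"
  shows "(\<Sum>k\<in>A. (1 / jap k)\<^sup>2) \<le> 3\<^sup>2"
proof -
  \<comment> \<open>At N = 0 the bound reads 5, since division by zero gives 0. It is too weak to
    start the telescoping, so N = 1 is computed directly.\<close>
  have interval: "(\<Sum>k\<in>{- int N..int N}. (1 / jap k)\<^sup>2) \<le> 5 - 2 / real N" for N
  proof (induction N)
    case 0
    then show ?case by (simp add: jap_def)
  next
    case (Suc N)
    have "{- int (Suc N)..int (Suc N)} = {- int N..int N} \<union> {- int (Suc N), int (Suc N)}" by auto
    then have "(\<Sum>k\<in>{- int (Suc N)..int (Suc N)}. (1 / jap k)\<^sup>2) =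
        (\<Sum>k\<in>{- int N..int N}. (1 / jap k)\<^sup>2) +
        (\<Sum>k\<in>{- int (Suc N), int (Suc N)}. (1 / jap k)\<^sup>2)"
      by (simp only:) (rule sum.union_disjoint, auto)
    also have "(\<Sum>k\<in>{- int (Suc N), int (Suc N)}. (1 / jap k)\<^sup>2) = 2 / (real (Suc N))\<^sup>2"
      by (simp add: jap_def power_divide add.commute[of 1])
    finally have *: "(\<Sum>k\<in>{- int (Suc N)..int (Suc N)}. (1 / jap k)\<^sup>2) =
        (\<Sum>k\<in>{- int N..int N}. (1 / jap k)\<^sup>2) + 2 / (real (Suc N))\<^sup>2" .
    show ?case
    proof (cases "N = 0")
      case True
      then show ?thesis using * by (simp add: jap_def)
    next
      case False
      then have "2 / (real (Suc N))\<^sup>2 \<le> 2 / real N - 2 / real (Suc N)"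
        by (simp add: diff_frac_eq power2_eq_square mult_ac frac_le)
      then show ?thesis using * Suc by linarith
    qed
  qed
  define N where "N = Max (insert 0 ((\<lambda>k. nat \<bar>k\<bar>) ` A))"
  have "nat \<bar>k\<bar> \<le> N" if "k \<in> A" for k
    unfolding N_def using assms that by (intro Max_ge) auto
  then have "A \<subseteq> {- int N..int N}" by fastforce
  then have "(\<Sum>k\<in>A. (1 / jap k)\<^sup>2) \<le> (\<Sum>k\<in>{- int N..int N}. (1 / jap k)\<^sup>2)"
    by (intro sum_mono2) auto
  also have "\<dots> \<le> 5 - 2 / real N" by (rule interval)
  also have "\<dots> \<le> 5" by simp
  also have "(5 :: real) \<le> 3\<^sup>2" by simp
  finally show ?thesis .
qed

text \<open>Cauchy-Schwarz after splitting each coefficient as (|c_k| <k>) times 1/<k>.\<close>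

lemma wl2_infsum_norm_le:
  assumes "wl2 c"
  shows "(\<Sum>\<^sub>\<infinity>k. cmod (c k)) \<le> 3 * wl2_norm c"
proof (rule infsum_le_finite_sums[OF wl2_abs_summable[OF assms]])
  fix A :: "int set" assume A: "finite A"
  have pos: "jap k > 0" for k using jap_ge_1[of k] by simp
  have "(\<Sum>k\<in>A. cmod (c k)) = (\<Sum>k\<in>A. \<bar>cmod (c k) * jap k\<bar> * \<bar>1 / jap k\<bar>)"
    using pos by (intro sum.cong) (simp_all add: abs_mult less_imp_neq[symmetric])
  also have "\<dots> \<le> L2_set (\<lambda>k. cmod (c k) * jap k) A * L2_set (\<lambda>k. 1 / jap k) A"
    by (rule L2_set_mult_ineq)
  also have "\<dots> \<le> wl2_norm c * 3"
    using sum_inverse_jap_squared[OF A]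
    by (intro mult_mono wl2_fin assms A) (auto simp: L2_set_def wl2_norm_nonneg real_le_lsqrt sum_nonneg)
  finally show "(\<Sum>k\<in>A. cmod (c k)) \<le> 3 * wl2_norm c" by (simp add: mult.commute)
qed

section \<open>Fourier series of Sobolev functions and the convolution formula\<close>

lemma H1_continuous: "f \<in> H1 \<Longrightarrow> continuous_on S f"
  unfolding H1_iff by (auto intro: continuous_on_subset)

lemma H1_periodic: "f \<in> H1 \<Longrightarrow> f (y + 1) = f y"
  unfolding H1_iff by blast

lemma H1_wl2: "f \<in> H1 \<Longrightarrow> wl2 (fourier f)"
  unfolding H1_iff by blast

lemma H1_norm_nonneg: "0 \<le> H1_norm f"
  by (simp add: H1_norm_wl2 wl2_norm_nonneg)

lemma H1_fourier_series:
  assumes "f \<in> H1"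
  shows "f y = (\<Sum>\<^sub>\<infinity>k. fourier f k * fexp k y)"
proof -
  have "f = (\<lambda>y. \<Sum>\<^sub>\<infinity>k. fourier f k * fexp k y)"
    by (rule H1_eqI) (simp_all add: assms wl2_synthesis H1_wl2)
  then show ?thesis by (rule fun_cong)
qed

lemma H1_sup_bound:
  assumes "f \<in> H1"
  shows "cmod (f y) \<le> 3 * H1_norm f"
proof -
  have "(\<lambda>k. norm (fourier f k * fexp k y)) summable_on UNIV"
    using wl2_abs_summable[OF H1_wl2[OF assms]] by (simp add: norm_mult)
  from norm_infsum_bound[OF this] wl2_infsum_norm_le[OF H1_wl2[OF assms]]
  show ?thesis by (simp add: H1_fourier_series[OF assms, of y] norm_mult H1_norm_wl2)
qed

lemma integrable_unit_interval:
  "continuous_on UNIV g \<Longrightarrow> (g :: real \<Rightarrow> 'a::banach) integrable_on {0..1}"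
  by (rule integrable_continuous_real) (rule continuous_on_subset, auto)

lemma bounded_on_unit_interval:
  assumes "continuous_on UNIV (g :: real \<Rightarrow> complex)"
  obtains M where "M > 0" "\<And>y. y \<in> {0..1} \<Longrightarrow> cmod (g y) \<le> M"
proof -
  have "compact (g ` {0..1})"
    using assms by (intro compact_continuous_image) (auto intro: continuous_on_subset)
  then have "bounded (g ` {0..1})" by (rule compact_imp_bounded)
  then obtain M where "M > 0" "\<forall>z\<in>g ` {0..1}. norm z \<le> M"
    unfolding bounded_pos by blast
  with that show ?thesis by auto
qed

text \<open>The series of \<open>f\<close> converges uniformly, and remains so after multiplication
  by the bounded \<open>g\<close>, so it can be integrated term by term. Taking \<open>g\<close>
  merely continuous lets \<open>bessel\<close> use the formula for functions whose membership in
  \<open>H1\<close> is still open.\<close>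

lemma fourier_mult_has_sum:
  assumes f: "f \<in> H1" and g: "continuous_on UNIV g"
  shows "((\<lambda>k. fourier f k * fourier g (n - k)) has_sum fourier (\<lambda>y. f y * g y) n) UNIV"
proof -
  have ul: "uniform_limit UNIV (\<lambda>X y. \<Sum>k\<in>X. fourier f k * fexp k y) f (finite_subsets_at_top UNIV)"
  proof -
    have "uniform_limit UNIV (\<lambda>X y. \<Sum>k\<in>X. fourier f k * fexp k y)
        (\<lambda>y. \<Sum>\<^sub>\<infinity>k. fourier f k * fexp k y) (finite_subsets_at_top UNIV)"
      by (rule Weierstrass_m_test_general[OF _ wl2_abs_summable[OF H1_wl2[OF f]]])
        (simp add: norm_mult)
    also have "(\<lambda>y. \<Sum>\<^sub>\<infinity>k. fourier f k * fexp k y) = f"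
      by (rule ext) (rule H1_fourier_series[OF f, symmetric])
    finally show ?thesis .
  qed
  obtain G where G: "G > 0" "\<And>y. y \<in> {0..1} \<Longrightarrow> cmod (g y) \<le> G"
    using bounded_on_unit_interval[OF g] by blast
  have ul': "uniform_limit {0..1}
      (\<lambda>X y. (\<Sum>k\<in>X. fourier f k * fexp k y) * (g y * fexp (- n) y))
      (\<lambda>y. f y * (g y * fexp (- n) y)) (finite_subsets_at_top UNIV)"
  proof (rule uniform_limitI)
    fix e :: real assume "e > 0"
    then have "e / G > 0" using G by simp
    from uniform_limitD[OF ul this]
    show "\<forall>\<^sub>F X in finite_subsets_at_top UNIV. \<forall>y\<in>{0..1}.
        dist ((\<Sum>k\<in>X. fourier f k * fexp k y) * (g y * fexp (- n) y))
          (f y * (g y * fexp (- n) y)) < e"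
    proof eventually_elim
      case (elim X)
      show ?case
      proof
        fix y :: real assume y: "y \<in> {0..1}"
        have "cmod (((\<Sum>k\<in>X. fourier f k * fexp k y) - f y) * (g y * fexp (- n) y))
            \<le> cmod ((\<Sum>k\<in>X. fourier f k * fexp k y) - f y) * G"
          using G(2)[OF y] by (simp add: norm_mult mult_left_mono)
        also have "\<dots> < e / G * G"
          using elim G(1) by (intro mult_strict_right_mono) (auto simp: dist_norm)
        also have "e / G * G = e" using G(1) by simp
        finally show "dist ((\<Sum>k\<in>X. fourier f k * fexp k y) * (g y * fexp (- n) y))
          (f y * (g y * fexp (- n) y)) < e" by (simp add: dist_norm left_diff_distrib)
      qed
    qed
  qed
  obtain I J where
    I: "\<And>X. ((\<lambda>y. (\<Sum>k\<in>X. fourier f k * fexp k y) * (g y * fexp (- n) y)) has_integral I X) {0..1}"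
    and J: "((\<lambda>y. f y * (g y * fexp (- n) y)) has_integral J) {0..1}"
    and lim: "(I \<longlongrightarrow> J) (finite_subsets_at_top UNIV)"
    by (rule uniform_limit_integral[OF ul'])
      (auto intro!: continuous_intros intro: continuous_on_subset[OF g])
  have "I X = (\<Sum>k\<in>X. fourier f k * fourier g (n - k))" if X: "finite X" for X
  proof -
    have shift: "fexp (- (n - k)) y = fexp k y * fexp (- n) y" for k y
      by (simp add: fexp_mult)
    have "I X = integral {0..1} (\<lambda>y. \<Sum>k\<in>X. fourier f k * (g y * fexp (- (n - k)) y))"
      by (subst integral_unique[OF I, symmetric], rule integral_cong)
        (simp only: shift sum_distrib_right mult.assoc mult.left_commute[of "fexp _ _" "g _"])
    also have "\<dots> = (\<Sum>k\<in>X. integral {0..1} (\<lambda>y. fourier f k * (g y * fexp (- (n - k)) y)))"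
      by (rule integral_sum[OF X])
        (auto intro!: integrable_unit_interval continuous_intros g)
    finally show ?thesis by (simp add: fourier_def)
  qed
  then have "\<forall>\<^sub>F X in finite_subsets_at_top UNIV.
      I X = (\<Sum>k\<in>X. fourier f k * fourier g (n - k))"
    by (intro eventually_finite_subsets_at_top_weakI) auto
  moreover have "J = fourier (\<lambda>y. f y * g y) n"
    using J by (simp add: fourier_def integral_unique mult.assoc)
  ultimately show ?thesis
    unfolding has_sum_def using lim by (simp add: tendsto_cong)
qed

section \<open>Mean squares, Parseval and Bessel\<close>

lemma fourier_cnj: "fourier (\<lambda>y. cnj (g y)) k = cnj (fourier g (- k))"
  unfolding fourier_def by (simp add: integral_cnj fexp_def cis_cnj)

definition meansq :: "(real \<Rightarrow> complex) \<Rightarrow> real"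
  where "meansq g = integral {0..1} (\<lambda>y. (cmod (g y))\<^sup>2)"

lemma meansq_mono:
  assumes "continuous_on UNIV f" "continuous_on UNIV g" "\<And>y. cmod (f y) \<le> cmod (g y)"
  shows "meansq f \<le> meansq g"
  unfolding meansq_def
  by (intro integral_le integrable_unit_interval continuous_intros assms power_mono) auto

lemma meansq_cmult: "meansq (\<lambda>y. c * g y) = (cmod c)\<^sup>2 * meansq g"
  by (simp add: meansq_def norm_mult power_mult_distrib)

lemma meansq_nonneg: "continuous_on UNIV g \<Longrightarrow> 0 \<le> meansq g"
  unfolding meansq_def
  by (intro integral_nonneg integrable_unit_interval continuous_intros) auto

lemma meansq_conv_fourier:
  assumes "continuous_on UNIV g"
  shows "of_real (meansq g) = fourier (\<lambda>y. g y * cnj (g y)) 0"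
proof -
  have "(\<lambda>y. (cmod (g y))\<^sup>2) integrable_on {0..1}"
    by (intro integrable_unit_interval continuous_intros assms)
  from integral_linear[OF this bounded_linear_of_real[where ?'a = complex]]
  show ?thesis
    by (simp add: meansq_def fourier_def o_def complex_norm_square[symmetric] del: of_real_power)
qed

lemma meansq_diff:
  assumes "continuous_on UNIV f" "continuous_on UNIV g"
  shows "meansq (\<lambda>y. f y - g y) = meansq f - 2 * Re (fourier (\<lambda>y. g y * cnj (f y)) 0) + meansq g"
proof -
  have "(cmod (f y - g y))\<^sup>2 = (cmod (f y))\<^sup>2 - 2 * Re (g y * cnj (f y)) + (cmod (g y))\<^sup>2" for y
    by (simp add: cmod_power2 power2_diff algebra_simps)
  then have "meansq (\<lambda>y. f y - g y) =
      meansq f - integral {0..1} (\<lambda>y. 2 * Re (g y * cnj (f y))) + meansq g"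
    unfolding meansq_def
    by (simp only:) (subst integral_add integral_diff;
        (intro integrable_unit_interval continuous_intros assms | rule refl)?)+
  moreover have "integral {0..1} (\<lambda>y. Re (g y * cnj (f y))) = Re (fourier (\<lambda>y. g y * cnj (f y)) 0)"
    using integral_linear[OF integrable_unit_interval bounded_linear_Re, of "\<lambda>y. g y * cnj (f y)"]
    by (simp add: fourier_def o_def continuous_intros assms)
  ultimately show ?thesis by (simp only: integral_mult_right)
qed

text \<open>The convolution formula at index 0 for \<open>f\<close> and its conjugate, whose
  coefficients are the conjugates at the opposite indices.\<close>

lemma parseval:
  assumes "f \<in> H1"
  shows "((\<lambda>k. (cmod (fourier f k))\<^sup>2) has_sum meansq f) UNIV"
proof -
  have "((\<lambda>k. fourier f k * fourier (\<lambda>y. cnj (f y)) (0 - k)) has_sum of_real (meansq f)) UNIV"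
    using fourier_mult_has_sum[OF assms, of "\<lambda>y. cnj (f y)" 0] H1_continuous[OF assms]
    by (simp add: meansq_conv_fourier continuous_intros)
  then show ?thesis
    by (simp add: fourier_cnj has_sum_of_real_iff[where ?'a = complex, symmetric]
        complex_norm_square del: of_real_power)
qed

text \<open>The partial sum \<open>s\<close> of the Fourier series over \<open>A\<close> lies in
  \<open>H1\<close>, so Parseval applies to it; expanding the mean square of \<open>g - s\<close>
  gives \<open>meansq g - S\<close>, which is nonnegative.\<close>

lemma bessel:
  assumes g: "continuous_on UNIV g" and A: "finite A"
  shows "(\<Sum>k\<in>A. (cmod (fourier g k))\<^sup>2) \<le> meansq g"
proof -
  define c where "c k = (if k \<in> A then fourier g k else 0)" for k
  have "wl2 c" by (rule wl2_finite_support) (rule finite_subset[OF _ A], auto simp: c_def)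
  define s where "s y = (\<Sum>\<^sub>\<infinity>k. c k * fexp k y)" for y
  have s: "s \<in> H1" "fourier s = c"
    unfolding s_def[abs_def] by (rule wl2_synthesis[OF \<open>wl2 c\<close>])+
  define S where "S = (\<Sum>k\<in>A. (cmod (fourier g k))\<^sup>2)"
  have "((\<lambda>k. (cmod (fourier s k))\<^sup>2) has_sum S) UNIV"
    unfolding S_def by (rule has_sum_finite_neutralI[OF A]) (auto simp: s c_def)
  with parseval[OF s(1)] have "meansq s = S" using has_sum_unique by blast
  moreover have "fourier (\<lambda>y. s y * cnj (g y)) 0 = of_real S"
  proof (rule has_sum_unique[OF fourier_mult_has_sum[OF s(1)]])
    show "((\<lambda>k. fourier s k * fourier (\<lambda>y. cnj (g y)) (0 - k)) has_sum of_real S) UNIV"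
      unfolding S_def
      by (rule has_sum_finite_neutralI[OF A])
        (auto simp: s c_def fourier_cnj complex_norm_square simp del: of_real_power)
  qed (intro continuous_intros g)
  ultimately have "meansq (\<lambda>y. g y - s y) = meansq g - S"
    by (simp add: meansq_diff g H1_continuous[OF s(1)])
  with meansq_nonneg[of "\<lambda>y. g y - s y"] show ?thesis
    by (simp add: S_def continuous_intros g H1_continuous[OF s(1)])
qed

section \<open>Finite differences\<close>

lemma norm_fexp_diff: "cmod (fexp k h - 1) = 2 * \<bar>sin (pi * of_int k * h)\<bar>"
  using dist_exp_i_1[of "2 * pi * of_int k * h"] by (simp add: fexp_def cis_conv_exp mult_ac)

text \<open>Serves functions not yet known to equal their Fourier series, so it rests on
  substitution: the window from h to 1 + h is cut at 1 and its overhang moved back by one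
  period.\<close>

lemma fourier_translate:
  assumes g: "continuous_on UNIV g" and per: "\<And>y. g (y + 1) = g y" and h: "0 \<le> h" "h \<le> 1"
  shows "fourier (\<lambda>y. g (y + h)) k = fexp k h * fourier g k"
proof -
  define \<phi> where "\<phi> y = g y * fexp (- k) y" for y
  have cont: "continuous_on S \<phi>" for S
    unfolding \<phi>_def[abs_def] by (intro continuous_intros continuous_on_subset[OF g]) auto
  have int: "\<phi> integrable_on {a..b}" for a b by (rule integrable_continuous_real[OF cont])
  have per\<phi>: "\<phi> (y + 1) = \<phi> y" for y by (simp add: \<phi>_def per fexp_periodic)
  have "fexp k h * fexp (- k) (y + h) = fexp (- k) y" for y
    by (simp add: fexp_def cis_mult algebra_simps)
  then have "g (y + h) * fexp (- k) y = fexp k h * \<phi> (y + h)" for y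
    by (metis \<phi>_def mult.left_commute)
  then have "fourier (\<lambda>y. g (y + h)) k = fexp k h * integral {0..1} (\<phi> \<circ> (+) h)"
    by (simp add: fourier_def o_def add.commute)
  also have "integral {0..1} (\<phi> \<circ> (+) h) = integral {h..1 + h} \<phi>"
    by (simp add: integral_shift_Icc_real)
  also have "\<dots> = integral {h..1} \<phi> + integral {1..1 + h} \<phi>"
    by (rule Henstock_Kurzweil_Integration.integral_combine[symmetric]) (use h int in auto)
  also have "integral {1..1 + h} \<phi> = integral {0..h} (\<phi> \<circ> (+) 1)"
    by (simp add: integral_shift_Icc_real add.commute)
  also have "\<phi> \<circ> (+) 1 = \<phi>" using per\<phi> by (simp add: fun_eq_iff add.commute)
  also have "integral {h..1} \<phi> + integral {0..h} \<phi> = integral {0..1} \<phi>"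
    using Henstock_Kurzweil_Integration.integral_combine[of 0 h 1 \<phi>] h int by (simp add: add.commute)
  finally show ?thesis by (simp add: fourier_def \<phi>_def[abs_def])
qed

lemma H1_meansq_le:
  assumes "f \<in> H1"
  shows "meansq f \<le> (H1_norm f)\<^sup>2"
proof (rule has_sum_le_finite_sums[OF parseval[OF assms]])
  fix A :: "int set" assume A: "finite A"
  have "(\<Sum>k\<in>A. (cmod (fourier f k))\<^sup>2) \<le> (\<Sum>k\<in>A. (cmod (fourier f k) * jap k)\<^sup>2)"
  proof (intro sum_mono power_mono)
    show "cmod (fourier f k) \<le> cmod (fourier f k) * jap k" for k
      using mult_left_mono[OF jap_ge_1[of k], of "cmod (fourier f k)"] by simp
  qed simp
  also have "\<dots> = (L2_set (\<lambda>k. cmod (fourier f k) * jap k) A)\<^sup>2"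
    by (simp add: L2_set_def sum_nonneg)
  also have "\<dots> \<le> (H1_norm f)\<^sup>2"
    unfolding H1_norm_wl2 by (intro power_mono wl2_fin H1_wl2[OF assms] A) simp
  finally show "(\<Sum>k\<in>A. (cmod (fourier f k))\<^sup>2) \<le> (H1_norm f)\<^sup>2" .
qed

text \<open>Translating the Fourier series multiplies the k-th coefficient by
  \<open>fexp k h\<close>; the factor \<open>fexp k h - 1\<close> has modulus at most 2 pi |h| <k>,
  and Parseval turns this into a mean square.\<close>

lemma H1_meansq_difference_le:
  assumes "f \<in> H1"
  shows "meansq (\<lambda>y. f (y + h) - f y) \<le> (2 * pi * h * H1_norm f)\<^sup>2"
proof -
  define c where "c k = fourier f k * (fexp k h - 1)" for k
  have "cmod (c k) \<le> cmod (2 * fourier f k)" for k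
    using norm_triangle_ineq4[of "fexp k h" 1]
    by (simp add: c_def norm_mult mult.commute[of 2] mult_left_mono)
  then have "wl2 c" by (rule wl2_mono(1)[OF wl2_cmult(1)[OF H1_wl2[OF assms]]])
  have summable: "(\<lambda>k. d k * fexp k y) summable_on UNIV" if "wl2 d" for d y
    by (rule Infinite_Sum.abs_summable_summable) (simp add: norm_mult wl2_abs_summable that)
  have "f (y + h) - f y = (\<Sum>\<^sub>\<infinity>k. c k * fexp k y)" for y
  proof -
    have "f (y + h) = (\<Sum>\<^sub>\<infinity>k. c k * fexp k y + fourier f k * fexp k y)"
      unfolding H1_fourier_series[OF assms, of "y + h"]
      by (rule infsum_cong) (simp add: c_def fexp_def cis_mult algebra_simps)
    also have "\<dots> = (\<Sum>\<^sub>\<infinity>k. c k * fexp k y) + f y"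
      unfolding H1_fourier_series[OF assms, of y]
      by (rule infsum_add) (intro summable \<open>wl2 c\<close> H1_wl2[OF assms])+
    finally show ?thesis by simp
  qed
  then have d: "(\<lambda>y. f (y + h) - f y) \<in> H1" "fourier (\<lambda>y. f (y + h) - f y) = c"
    using wl2_synthesis[OF \<open>wl2 c\<close>] by simp_all
  show ?thesis
  proof (rule has_sum_le_finite_sums[OF parseval[OF d(1)]])
    fix A :: "int set" assume A: "finite A"
    have "(\<Sum>k\<in>A. (cmod (fourier (\<lambda>y. f (y + h) - f y) k))\<^sup>2)
        \<le> (\<Sum>k\<in>A. (2 * pi * h)\<^sup>2 * (cmod (fourier f k) * jap k)\<^sup>2)"
    proof (rule sum_mono)
      fix k
      have "cmod (fexp k h - 1) \<le> 2 * \<bar>pi * of_int k * h\<bar>"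
        unfolding norm_fexp_diff using abs_sin_x_le_abs_x[of "pi * of_int k * h"] by simp
      also have "\<dots> \<le> \<bar>2 * pi * h\<bar> * jap k"
        by (auto simp: jap_def abs_mult)
      finally have "(cmod (fourier f k) * cmod (fexp k h - 1))\<^sup>2
          \<le> (cmod (fourier f k) * (\<bar>2 * pi * h\<bar> * jap k))\<^sup>2"
        by (intro power_mono mult_left_mono) auto
      then show "(cmod (fourier (\<lambda>y. f (y + h) - f y) k))\<^sup>2
          \<le> (2 * pi * h)\<^sup>2 * (cmod (fourier f k) * jap k)\<^sup>2"
        unfolding d(2) by (simp add: c_def norm_mult power_mult_distrib mult_ac)
    qed
    also have "\<dots> = (2 * pi * h)\<^sup>2 * (L2_set (\<lambda>k. cmod (fourier f k) * jap k) A)\<^sup>2"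
      by (simp add: L2_set_def sum_nonneg sum_distrib_left)
    also have "\<dots> \<le> (2 * pi * h)\<^sup>2 * (H1_norm f)\<^sup>2"
      unfolding H1_norm_wl2
      by (intro mult_left_mono power_mono wl2_fin H1_wl2[OF assms] A) simp_all
    finally show "(\<Sum>k\<in>A. (cmod (fourier (\<lambda>y. f (y + h) - f y) k))\<^sup>2)
        \<le> (2 * pi * h * H1_norm f)\<^sup>2" by (simp add: power_mult_distrib)
  qed
qed

text \<open>
  The converse of the two preceding estimates. It avoids weak derivatives: products and
  reciprocals have difference quotients that are controlled pointwise.
\<close>

lemma H1_difference_criterion:
  assumes g: "continuous_on UNIV g" and per: "\<And>y. g (y + 1) = g y"
    and B: "meansq g \<le> B\<^sup>2" "0 \<le> B" and D: "0 \<le> D"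
    and diff: "\<And>h. 0 < h \<Longrightarrow> h < 1 \<Longrightarrow> meansq (\<lambda>y. g (y + h) - g y) \<le> (D * h)\<^sup>2"
  shows "g \<in> H1" "H1_norm g \<le> B + D"
proof -
  have "L2_set (\<lambda>k. cmod (fourier g k) * jap k) A \<le> B + D" if A: "finite A" for A
  proof -
    \<comment> \<open>Bessel for the difference quotient. The sum is over the finite set
      \<open>A\<close>, so h can tend to 0 term by term, turning sin(pi k h)/h into pi k and leaving
      the coefficients of a derivative.\<close>
    have fin: "(\<Sum>k\<in>A. (cmod (fourier g k) * (2 * \<bar>sin (pi * of_int k * h) / h\<bar>))\<^sup>2) \<le> D\<^sup>2"
      if h: "0 < h" "h < 1" for h
    proof -
      have cont: "continuous_on UNIV (\<lambda>y. g (y + h))"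
        by (rule continuous_on_compose2[OF g]) (auto intro!: continuous_intros)
      have "fourier (\<lambda>y. g (y + h) - g y) k = fourier g k * (fexp k h - 1)" for k
        using h by (simp add: fourier_diff[OF cont g] fourier_translate[OF g per] algebra_simps)
      then have coeff: "cmod (fourier (\<lambda>y. g (y + h) - g y) k) =
          h * (cmod (fourier g k) * (2 * \<bar>sin (pi * of_int k * h) / h\<bar>))" for k
        using h by (simp add: norm_mult norm_fexp_diff)
      have "h\<^sup>2 * (\<Sum>k\<in>A. (cmod (fourier g k) * (2 * \<bar>sin (pi * of_int k * h) / h\<bar>))\<^sup>2) =
          (\<Sum>k\<in>A. (cmod (fourier (\<lambda>y. g (y + h) - g y) k))\<^sup>2)"
        by (simp only: coeff power_mult_distrib[of h] sum_distrib_left)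
      also have "\<dots> \<le> meansq (\<lambda>y. g (y + h) - g y)"
        by (intro bessel A continuous_intros cont g)
      also have "\<dots> \<le> h\<^sup>2 * D\<^sup>2" using diff[OF h] by (simp add: power_mult_distrib mult.commute)
      finally show ?thesis using h by simp
    qed
    have "((\<lambda>h. sin (c * h) / h) \<longlongrightarrow> c) (at_right 0)" for c :: real
    proof -
      have "((\<lambda>h. sin (c * h)) has_real_derivative c) (at 0)"
        by (auto intro!: derivative_eq_intros)
      then have "((\<lambda>h. sin (c * h) / h) \<longlongrightarrow> c) (at 0)" by (simp add: DERIV_def)
      then show ?thesis by (rule tendsto_within_subset) simp
    qed
    then have "((\<lambda>h. \<Sum>k\<in>A. (cmod (fourier g k) * (2 * \<bar>sin (pi * of_int k * h) / h\<bar>))\<^sup>2) \<longlongrightarrow>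
        (\<Sum>k\<in>A. (cmod (fourier g k) * (2 * \<bar>pi * of_int k\<bar>))\<^sup>2)) (at_right 0)"
      by (intro tendsto_intros)
    moreover have "\<forall>\<^sub>F h in at_right 0.
        (\<Sum>k\<in>A. (cmod (fourier g k) * (2 * \<bar>sin (pi * of_int k * h) / h\<bar>))\<^sup>2) \<le> D\<^sup>2"
      using eventually_at_right_real[of 0 1] by (rule eventually_mono) (use fin in auto)
    ultimately have lim: "(\<Sum>k\<in>A. (cmod (fourier g k) * (2 * \<bar>pi * of_int k\<bar>))\<^sup>2) \<le> D\<^sup>2"
      by (intro tendsto_upperbound) auto
    \<comment> \<open>The summand 1 covers k = 0, where \<open>jap\<close> is 1; elsewhere 2 pi > 1
      suffices. Hence \<open>B\<close> pays for the function and \<open>D\<close> for its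
      derivative.\<close>
    have jap: "(jap k)\<^sup>2 \<le> 1 + (2 * \<bar>pi * of_int k\<bar>)\<^sup>2" for k
    proof -
      have "\<bar>of_int k\<bar> * 1 \<le> \<bar>of_int k\<bar> * (2 * pi)"
        using pi_gt3 by (intro mult_left_mono) auto
      then have "\<bar>of_int k\<bar> \<le> 2 * \<bar>pi * of_int k\<bar>" by (simp add: abs_mult mult_ac)
      then have "\<bar>of_int k\<bar>\<^sup>2 \<le> (2 * \<bar>pi * of_int k\<bar>)\<^sup>2" by (intro power_mono) auto
      then show ?thesis by (auto simp: jap_def)
    qed
    have "(\<Sum>k\<in>A. (cmod (fourier g k) * jap k)\<^sup>2)
        \<le> (\<Sum>k\<in>A. (cmod (fourier g k))\<^sup>2 + (cmod (fourier g k) * (2 * \<bar>pi * of_int k\<bar>))\<^sup>2)"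
    proof (rule sum_mono)
      fix k
      show "(cmod (fourier g k) * jap k)\<^sup>2
          \<le> (cmod (fourier g k))\<^sup>2 + (cmod (fourier g k) * (2 * \<bar>pi * of_int k\<bar>))\<^sup>2"
        using mult_left_mono[OF jap[of k], of "(cmod (fourier g k))\<^sup>2"]
        by (simp add: power_mult_distrib distrib_left)
    qed
    also have "\<dots> \<le> B\<^sup>2 + D\<^sup>2"
      unfolding sum.distrib using lim bessel[OF g A] B(1) by linarith
    also have "\<dots> \<le> (B + D)\<^sup>2" using B(2) D by (simp add: power2_sum)
    finally show ?thesis
      unfolding L2_set_def using B(2) D by (intro real_le_lsqrt) auto
  qed
  from wl2_bound[OF this] show "g \<in> H1" "H1_norm g \<le> B + D"
    using g per by (auto simp: H1_iff H1_norm_wl2)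
qed

section \<open>Products and reciprocals of Sobolev functions\<close>

lemma meansq_add_le:
  assumes "continuous_on UNIV f" "continuous_on UNIV g"
  shows "meansq (\<lambda>y. f y + g y) \<le> 2 * meansq f + 2 * meansq g"
proof -
  have "(cmod (f y + g y))\<^sup>2 \<le> 2 * (cmod (f y))\<^sup>2 + 2 * (cmod (g y))\<^sup>2" for y
  proof -
    have "(cmod (f y + g y))\<^sup>2 \<le> (cmod (f y) + cmod (g y))\<^sup>2"
      by (intro power_mono norm_triangle_ineq) simp
    also have "\<dots> \<le> 2 * (cmod (f y))\<^sup>2 + 2 * (cmod (g y))\<^sup>2"
      using sum_squares_bound[of "cmod (f y)" "cmod (g y)"] by (simp add: power2_sum)
    finally show ?thesis .
  qed
  then have "meansq (\<lambda>y. f y + g y)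
      \<le> integral {0..1} (\<lambda>y. 2 * (cmod (f y))\<^sup>2 + 2 * (cmod (g y))\<^sup>2)"
    unfolding meansq_def
    by (intro integral_le integrable_unit_interval continuous_intros assms)
  also have "\<dots> = 2 * meansq f + 2 * meansq g"
    unfolding meansq_def
    by (subst integral_add) (auto intro!: integrable_unit_interval continuous_intros assms)
  finally show ?thesis .
qed

lemma meansq_mult_le:
  assumes "continuous_on UNIV f" "continuous_on UNIV g" "\<And>y. cmod (f y) \<le> C"
  shows "meansq (\<lambda>y. f y * g y) \<le> C\<^sup>2 * meansq g"
proof -
  have "0 \<le> C" using assms(3)[of 0] norm_ge_zero order_trans by blast
  then have "meansq (\<lambda>y. f y * g y) \<le> meansq (\<lambda>y. of_real C * g y)"
    using assms(3) by (intro meansq_mono continuous_intros assms) (simp add: norm_mult mult_right_mono)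
  also have "\<dots> = C\<^sup>2 * meansq g" by (simp add: meansq_cmult)
  finally show ?thesis .
qed

text \<open>A Leibniz rule for differences: f(y+h) (g(y+h) - g(y)) + g(y) (f(y+h) - f(y)), with one
  factor bounded in sup norm and the other in mean square. The 3 is the sup bound of one factor.
  Each of the two difference terms contributes 2 (3 * 2 pi)^2 = 72 pi^2, and their sum is (12
  pi)^2.\<close>

lemma H1_mult:
  assumes f: "f \<in> H1" and g: "g \<in> H1"
  shows "(\<lambda>y. f y * g y) \<in> H1"
    and "H1_norm (\<lambda>y. f y * g y) \<le> H1_norm f * H1_norm g * (3 + 12 * pi)"
proof -
  define a b where "a = H1_norm f" and "b = H1_norm g"
  have ab: "0 \<le> a" "0 \<le> b" by (simp_all add: a_def b_def H1_norm_nonneg)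
  note cont = H1_continuous[OF f] H1_continuous[OF g]
  have shift: "continuous_on UNIV (\<lambda>y. u (y + h))" if "u \<in> H1" for u h
    by (rule continuous_on_compose2[OF H1_continuous[OF that]]) (auto intro!: continuous_intros)
  have "meansq (\<lambda>y. f y * g y) \<le> (3 * a)\<^sup>2 * meansq g"
    using H1_sup_bound[OF f] by (intro meansq_mult_le cont) (simp add: a_def)
  also have "\<dots> \<le> (3 * a)\<^sup>2 * b\<^sup>2"
    using H1_meansq_le[OF g] by (intro mult_left_mono) (simp_all add: b_def)
  finally have 1: "meansq (\<lambda>y. f y * g y) \<le> (3 * a * b)\<^sup>2" by (simp add: power_mult_distrib)
  have 2: "meansq (\<lambda>y. f (y + h) * g (y + h) - f y * g y) \<le> (12 * pi * a * b * h)\<^sup>2" for h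
  proof -
    have "meansq (\<lambda>y. f (y + h) * g (y + h) - f y * g y) =
        meansq (\<lambda>y. f (y + h) * (g (y + h) - g y) + g y * (f (y + h) - f y))"
      by (simp add: algebra_simps)
    also have "\<dots> \<le> 2 * meansq (\<lambda>y. f (y + h) * (g (y + h) - g y))
        + 2 * meansq (\<lambda>y. g y * (f (y + h) - f y))"
      by (intro meansq_add_le continuous_intros cont shift f g)
    also have "\<dots> \<le> 2 * ((3 * a)\<^sup>2 * meansq (\<lambda>y. g (y + h) - g y))
        + 2 * ((3 * b)\<^sup>2 * meansq (\<lambda>y. f (y + h) - f y))"
      using H1_sup_bound[OF f] H1_sup_bound[OF g]
      by (intro add_mono mult_left_mono meansq_mult_le continuous_intros cont shift f g)
        (simp_all add: a_def b_def)
    also have "\<dots> \<le> 2 * ((3 * a)\<^sup>2 * (2 * pi * h * b)\<^sup>2) + 2 * ((3 * b)\<^sup>2 * (2 * pi * h * a)\<^sup>2)"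
      unfolding a_def b_def by (intro add_mono mult_left_mono H1_meansq_difference_le f g) auto
    also have "\<dots> = (12 * pi * a * b * h)\<^sup>2" by (simp add: power_mult_distrib)
    finally show ?thesis .
  qed
  have "(\<lambda>y. f y * g y) \<in> H1 \<and> H1_norm (\<lambda>y. f y * g y) \<le> 3 * a * b + 12 * pi * a * b"
    using H1_difference_criterion[OF _ _ 1, of "12 * pi * a * b"] 2 ab
      H1_periodic[OF f] H1_periodic[OF g] by (simp add: continuous_intros cont)
  then show "(\<lambda>y. f y * g y) \<in> H1"
    "H1_norm (\<lambda>y. f y * g y) \<le> H1_norm f * H1_norm g * (3 + 12 * pi)"
    by (simp_all add: a_def b_def algebra_simps)
qed

lemma periodic_of_nat:
  assumes "\<And>y :: real. f (y + 1) = f y"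
  shows "f (y + real n) = f y"
proof (induction n)
  case (Suc n)
  then show ?case using assms[of "y + real n"] by (simp add: add_ac)
qed simp

lemma periodic_frac:
  assumes "\<And>y :: real. f (y + 1) = f y"
  shows "f (frac y) = f y"
proof (cases "\<lfloor>y\<rfloor> \<ge> 0")
  case True
  then show ?thesis using periodic_of_nat[of f "frac y" "nat \<lfloor>y\<rfloor>"] assms by (simp add: frac_def)
next
  case False
  then show ?thesis using periodic_of_nat[of f y "nat (- \<lfloor>y\<rfloor>)"] assms by (simp add: frac_def)
qed

text \<open>1/w(y+h) - 1/w(y) is -(w(y+h) - w(y)) divided by w(y+h) w(y). Compactness of one period
  bounds 1/w by \<open>M\<close>, periodicity extends this to the line, and the difference quotients
  of 1/w are those of w up to the factor \<open>M\<^sup>2\<close>.\<close>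

lemma H1_inverse:
  assumes w: "w \<in> H1" and nz: "\<And>y. w y \<noteq> 0"
  shows "(\<lambda>y. inverse (w y)) \<in> H1"
proof -
  note cont = H1_continuous[OF w]
  have cont': "continuous_on UNIV (\<lambda>y. inverse (w y))"
    using nz by (intro continuous_intros cont) auto
  obtain M where M: "M > 0" "\<And>y. y \<in> {0..1} \<Longrightarrow> cmod (inverse (w y)) \<le> M"
    using bounded_on_unit_interval[OF cont'] by blast
  have bound: "cmod (inverse (w y)) \<le> M" for y
  proof -
    have "frac y \<in> {0..1}" using frac_ge_0[of y] frac_lt_1[of y] by simp
    from M(2)[OF this] show ?thesis using periodic_frac[of w, OF H1_periodic[OF w]] by simp
  qed
  have shift: "continuous_on UNIV (\<lambda>y. w (y + h))" "continuous_on UNIV (\<lambda>y. inverse (w (y + h)))" for h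
    by (rule continuous_on_compose2[OF cont] continuous_on_compose2[OF cont'];
        auto intro!: continuous_intros)+
  have 1: "meansq (\<lambda>y. inverse (w y)) \<le> M\<^sup>2"
    using meansq_mult_le[OF cont', of "\<lambda>_. 1" M] bound by (simp add: meansq_def)
  have 2: "meansq (\<lambda>y. inverse (w (y + h)) - inverse (w y)) \<le> (M\<^sup>2 * (2 * pi * H1_norm w) * h)\<^sup>2" for h
  proof -
    have "inverse (w (y + h)) - inverse (w y) =
        - (inverse (w (y + h)) * inverse (w y)) * (w (y + h) - w y)" for y
      using nz by (simp add: field_simps)
    then have "meansq (\<lambda>y. inverse (w (y + h)) - inverse (w y)) =
        meansq (\<lambda>y. - (inverse (w (y + h)) * inverse (w y)) * (w (y + h) - w y))" by presburger
    also have "\<dots> \<le> (M * M)\<^sup>2 * meansq (\<lambda>y. w (y + h) - w y)"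
    proof (rule meansq_mult_le)
      show "cmod (- (inverse (w (y + h)) * inverse (w y))) \<le> M * M" for y
        unfolding norm_minus_cancel norm_mult using M(1) by (intro mult_mono bound) auto
    qed (intro continuous_intros cont cont' shift)+
    also have "\<dots> \<le> (M * M)\<^sup>2 * (2 * pi * h * H1_norm w)\<^sup>2"
      by (intro mult_left_mono H1_meansq_difference_le w) simp
    also have "\<dots> = (M\<^sup>2 * (2 * pi * H1_norm w) * h)\<^sup>2"
      by (simp add: power_mult_distrib power2_eq_square mult_ac)
    finally show ?thesis .
  qed
  show ?thesis
    by (rule H1_difference_criterion(1)[OF cont' _ 1 _ _ 2])
      (use M(1) H1_periodic[OF w] H1_norm_nonneg[of w] in auto)
qed

section \<open>The Sobolev algebra\<close>

lemma fourier_fexp: "fourier (fexp m) k = (if k = m then 1 else 0)"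
proof -
  have "fourier (fexp m) k = integral {0..1} (fexp (m - k))"
    by (simp add: fourier_def fexp_mult)
  then show ?thesis by (simp add: integral_fexp)
qed

lemma fexp_H1: "fexp m \<in> H1"
  unfolding H1_iff
  by (auto intro!: continuous_on_fexp wl2_finite_support finite_subset[of _ "{m}"]
      simp: fexp_periodic fourier_fexp split: if_splits)

text \<open>The phase space \<open>H10\<close> has no unit and is not closed under reflection or
  reciprocals. All computations take place in this larger algebra; \<open>emb\<close> and
  \<open>proj\<close> pass between the two.\<close>

typedef sobolev = H1
  morphisms sob_fun Sob
  using H1_zero by blast

lemma sob_fun_H1 [simp]: "sob_fun g \<in> H1"
  by (rule sob_fun)

lemma continuous_sob_fun: "continuous_on S (sob_fun g)"
  by (rule H1_continuous) simp

definition coef :: "sobolev \<Rightarrow> int \<Rightarrow> complex"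
  where "coef g = fourier (sob_fun g)"

lemma wl2_coef [simp]: "wl2 (coef g)"
  unfolding coef_def by (rule H1_wl2) simp

lemma sobolev_eqI: "(\<And>k. coef g k = coef h k) \<Longrightarrow> g = h"
  using H1_eqI[of "sob_fun g" "sob_fun h"] by (simp add: coef_def sob_fun_inject)

text \<open>The estimate for products carries the factor \<open>3 + 12 * pi\<close>, so the norm is
  not shown submultiplicative. Ring and normed space structures are therefore declared separately,
  and continuity of multiplication enters as a bounded bilinear map.\<close>

instantiation sobolev :: "{complex_normed_vector, comm_ring_1}"
begin

definition zero_sobolev :: sobolev
  where "zero_sobolev = Sob (\<lambda>y. 0)"

definition one_sobolev :: sobolev
  where "one_sobolev = Sob (fexp 0)"

definition plus_sobolev :: "sobolev \<Rightarrow> sobolev \<Rightarrow> sobolev"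
  where "plus_sobolev g h = Sob (\<lambda>y. sob_fun g y + sob_fun h y)"

definition times_sobolev :: "sobolev \<Rightarrow> sobolev \<Rightarrow> sobolev"
  where "times_sobolev g h = Sob (\<lambda>y. sob_fun g y * sob_fun h y)"

definition scaleC_sobolev :: "complex \<Rightarrow> sobolev \<Rightarrow> sobolev"
  where "scaleC_sobolev c g = Sob (\<lambda>y. c * sob_fun g y)"

definition uminus_sobolev :: "sobolev \<Rightarrow> sobolev"
  where "uminus_sobolev g = (- 1) *\<^sub>C g"

definition minus_sobolev :: "sobolev \<Rightarrow> sobolev \<Rightarrow> sobolev"
  where "minus_sobolev g h = g + (- h)"

definition scaleR_sobolev :: "real \<Rightarrow> sobolev \<Rightarrow> sobolev"
  where "scaleR_sobolev r g = of_real r *\<^sub>C g"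

definition norm_sobolev :: "sobolev \<Rightarrow> real"
  where "norm_sobolev g = H1_norm (sob_fun g)"

definition dist_sobolev :: "sobolev \<Rightarrow> sobolev \<Rightarrow> real"
  where "dist_sobolev g h = norm (g - h)"

definition sgn_sobolev :: "sobolev \<Rightarrow> sobolev"
  where "sgn_sobolev g = inverse (norm g) *\<^sub>R g"

definition uniformity_sobolev :: "(sobolev \<times> sobolev) filter"
  where "uniformity_sobolev = (INF e\<in>{0<..}. principal {(g, h). dist g h < e})"

definition open_sobolev :: "sobolev set \<Rightarrow> bool"
  where "open_sobolev U \<longleftrightarrow> (\<forall>g\<in>U. \<forall>\<^sub>F (g', h) in uniformity. g' = g \<longrightarrow> h \<in> U)"

lemma sob_fun_zero: "sob_fun 0 y = 0"
  unfolding zero_sobolev_def by (simp add: Sob_inverse H1_zero)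

lemma sob_fun_one: "sob_fun 1 y = 1"
  unfolding one_sobolev_def by (simp add: Sob_inverse fexp_H1)

lemma sob_fun_add: "sob_fun (g + h) y = sob_fun g y + sob_fun h y"
  unfolding plus_sobolev_def by (simp add: Sob_inverse H1_add)

lemma sob_fun_mult: "sob_fun (g * h) y = sob_fun g y * sob_fun h y"
  unfolding times_sobolev_def by (simp add: Sob_inverse H1_mult)

lemma sob_fun_scaleC: "sob_fun (c *\<^sub>C g) y = c * sob_fun g y"
  unfolding scaleC_sobolev_def by (simp add: Sob_inverse H1_cmult)

lemma coef_add: "coef (g + h) k = coef g k + coef h k"
  unfolding coef_def by (simp add: sob_fun_add[abs_def] fourier_add continuous_sob_fun)

lemma coef_scaleC: "coef (c *\<^sub>C g) k = c * coef g k"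
  unfolding coef_def by (simp add: sob_fun_scaleC[abs_def] fourier_cmult)

lemma norm_sobolev_wl2: "norm g = wl2_norm (coef g)"
  by (simp add: norm_sobolev_def coef_def H1_norm_wl2)

lemma norm_sobolev_scaleC: "norm (c *\<^sub>C g) = cmod c * norm (g :: sobolev)"
  by (simp add: norm_sobolev_wl2 coef_scaleC[abs_def] wl2_cmult)

instance
proof
  note defs = sob_fun_inject[symmetric] fun_eq_iff sob_fun_zero sob_fun_one sob_fun_add sob_fun_mult
    sob_fun_scaleC uminus_sobolev_def minus_sobolev_def scaleR_sobolev_def
  fix u v w :: sobolev and c d :: complex and a b :: real
  show "u + v + w = u + (v + w)" "u + v = v + u" "0 + u = u" "- u + u = 0" "u - v = u + - v"
    "a *\<^sub>R (u + v) = a *\<^sub>R u + a *\<^sub>R v" "(a + b) *\<^sub>R u = a *\<^sub>R u + b *\<^sub>R u"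
    "a *\<^sub>R b *\<^sub>R u = (a * b) *\<^sub>R u" "1 *\<^sub>R u = u"
    "c *\<^sub>C (u + v) = c *\<^sub>C u + c *\<^sub>C v" "(c + d) *\<^sub>C u = c *\<^sub>C u + d *\<^sub>C u"
    "c *\<^sub>C d *\<^sub>C u = (c * d) *\<^sub>C u" "of_real a *\<^sub>C u = a *\<^sub>R u"
    "u * v * w = u * (v * w)" "u * v = v * u" "1 * u = u" "(u + v) * w = u * w + v * w"
    by (simp_all add: defs algebra_simps)
  show "(0 :: sobolev) \<noteq> 1" by (auto simp: defs)
  show "dist u v = norm (u - v)" by (rule dist_sobolev_def)
  show "sgn u = inverse (norm u) *\<^sub>R u" by (rule sgn_sobolev_def)
  show "uniformity = (INF e\<in>{0<..}. principal {(u :: sobolev, v). dist u v < e})"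
    by (rule uniformity_sobolev_def)
  show "open U \<longleftrightarrow> (\<forall>u\<in>U. \<forall>\<^sub>F (u', v) in uniformity. u' = u \<longrightarrow> v \<in> U)" for U :: "sobolev set"
    by (rule open_sobolev_def)
  show "norm (c *\<^sub>C u) = cmod c * norm u" by (rule norm_sobolev_scaleC)
  show "norm (a *\<^sub>R u) = \<bar>a\<bar> * norm u" by (simp add: scaleR_sobolev_def norm_sobolev_scaleC)
  have coef_zero: "coef 0 = (\<lambda>k. 0)"
    by (rule ext) (simp add: coef_def sob_fun_zero[abs_def])
  show "norm u = 0 \<longleftrightarrow> u = 0"
  proof
    assume "norm u = 0"
    then have "coef u k = 0" for k
      by (intro wl2_norm_eq_0) (simp_all add: norm_sobolev_wl2)
    then show "u = 0" by (intro sobolev_eqI) (simp add: coef_zero)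
  qed (simp add: norm_sobolev_wl2 coef_zero)
  show "norm (u + v) \<le> norm u + norm v"
    by (simp add: norm_sobolev_wl2 coef_add[abs_def] wl2_add)
qed

end

lemma coef_uminus: "coef (- g) k = - coef g k"
  by (simp add: uminus_sobolev_def coef_scaleC)

lemma coef_diff: "coef (g - h) k = coef g k - coef h k"
  using coef_add[of g "- h" k] by (simp add: coef_uminus)

lemma sob_fun_diff: "sob_fun (g - h) y = sob_fun g y - sob_fun h y"
  by (simp add: minus_sobolev_def uminus_sobolev_def sob_fun_add sob_fun_scaleC)

lemma bounded_cbilinear_sobolev_mult: "bounded_cbilinear ((*) :: sobolev \<Rightarrow> sobolev \<Rightarrow> sobolev)"
proof -
  have "norm (g * h) \<le> norm g * norm h * (3 + 12 * pi)" for g h :: sobolev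
    using H1_mult(2)[of "sob_fun g" "sob_fun h"] by (simp add: norm_sobolev_def sob_fun_mult[abs_def])
  moreover have "(c *\<^sub>C g) * h = c *\<^sub>C (g * h)" "g * (c *\<^sub>C h) = c *\<^sub>C (g * h)" for c and g h :: sobolev
    by (simp_all add: sob_fun_inject[symmetric] fun_eq_iff sob_fun_mult sob_fun_scaleC)
  ultimately show ?thesis
    unfolding bounded_cbilinear_def
    by (intro conjI allI exI[of _ "3 + 12 * pi"]) (rule distrib_right distrib_left | assumption)+
qed

interpretation sobolev_mult: bounded_bilinear "(*) :: sobolev \<Rightarrow> sobolev \<Rightarrow> sobolev"
  by (rule bounded_cbilinear_imp_bounded_bilinear[OF bounded_cbilinear_sobolev_mult])

lemma sobolev_sup_bound: "cmod (sob_fun g y) \<le> 3 * norm g"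
  using H1_sup_bound[of "sob_fun g"] by (simp add: norm_sobolev_def)

subsection \<open>Linear operators\<close>

definition synth :: "(int \<Rightarrow> complex) \<Rightarrow> sobolev"
  where "synth c = Sob (\<lambda>y. \<Sum>\<^sub>\<infinity>k. c k * fexp k y)"

lemma sob_fun_synth: "wl2 c \<Longrightarrow> sob_fun (synth c) y = (\<Sum>\<^sub>\<infinity>k. c k * fexp k y)"
  unfolding synth_def by (simp add: Sob_inverse wl2_synthesis)

lemma coef_synth: "wl2 c \<Longrightarrow> coef (synth c) = c"
  unfolding synth_def coef_def by (simp add: Sob_inverse wl2_synthesis)

text \<open>Covers truncation and reflection at once: both act on coefficients, linearly and without
  increasing the weighted norm.\<close>

lemma bounded_clinear_synth:
  assumes "\<And>g. wl2 (C g)" "\<And>g. wl2_norm (C g) \<le> norm g"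
    and "\<And>g h k. C (g + h) k = C g k + C h k" "\<And>a g k. C (a *\<^sub>C g) k = a * C g k"
  shows "bounded_clinear (\<lambda>g. synth (C g))"
  unfolding bounded_clinear_def
proof (intro conjI allI)
  show "\<exists>K. \<forall>g. norm (synth (C g)) \<le> norm g * K"
    by (rule exI[of _ 1]) (simp add: norm_sobolev_wl2 coef_synth assms)
qed (auto intro!: sobolev_eqI simp: coef_synth coef_add coef_scaleC assms)

definition trunc :: "int \<Rightarrow> sobolev \<Rightarrow> sobolev"
  where "trunc m g = synth (\<lambda>k. if m \<le> k then coef g k else 0)"

lemma wl2_trunc:
  "wl2 (\<lambda>k. if m \<le> k then coef g k else 0)"
  "wl2_norm (\<lambda>k. if m \<le> k then coef g k else 0) \<le> norm g"
  unfolding norm_sobolev_wl2 by (rule wl2_mono[OF wl2_coef[of g]]; simp)+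

lemma coef_trunc: "coef (trunc m g) k = (if m \<le> k then coef g k else 0)"
  unfolding trunc_def by (simp add: coef_synth wl2_trunc)

lemma sob_fun_trunc: "sob_fun (trunc m g) y = (\<Sum>\<^sub>\<infinity>k\<in>{m..}. coef g k * fexp k y)"
  unfolding trunc_def sob_fun_synth[OF wl2_trunc(1)]
  by (rule infsum_cong_neutral) auto

lemma bounded_clinear_trunc: "bounded_clinear (trunc m)"
  unfolding trunc_def[abs_def]
  by (rule bounded_clinear_synth) (auto simp: wl2_trunc coef_add coef_scaleC)

lemma Pi_plus_eq_trunc: "Pi_plus (sob_fun g) = sob_fun (trunc 0 g)"
  by (simp add: fun_eq_iff Pi_plus_def sob_fun_trunc coef_def)

lemma Pi_plus0_eq_trunc: "Pi_plus0 (sob_fun g) = sob_fun (trunc 1 g)"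
  by (simp add: fun_eq_iff Pi_plus0_def sob_fun_trunc coef_def)

definition reflect :: "sobolev \<Rightarrow> sobolev"
  where "reflect g = synth (\<lambda>k. coef g (- k))"

lemma jap_uminus: "jap (- k) = jap k"
  by (simp add: jap_def)

lemma wl2_reflect: "wl2 (\<lambda>k. coef g (- k))" "wl2_norm (\<lambda>k. coef g (- k)) = norm g"
proof -
  define w where "w k = (cmod (coef g k))\<^sup>2 * (jap k)\<^sup>2" for k
  have *: "(\<lambda>k. (cmod (coef g (- k)))\<^sup>2 * (jap k)\<^sup>2) = (\<lambda>k. w (- k))"
    by (simp add: w_def jap_uminus)
  have "w summable_on UNIV"
    using wl2_coef[of g] by (simp add: wl2_def w_def[abs_def])
  then show "wl2 (\<lambda>k. coef g (- k))"
    unfolding wl2_def * using summable_on_reindex_bij_betw[OF bij_uminus, of w] by simp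
  have "norm g = sqrt (\<Sum>\<^sub>\<infinity>k. w k)"
    by (simp add: norm_sobolev_wl2 wl2_norm_def w_def)
  then show "wl2_norm (\<lambda>k. coef g (- k)) = norm g"
    unfolding wl2_norm_def * using infsum_reindex_bij_betw[OF bij_uminus, of w] by simp
qed

lemma coef_reflect: "coef (reflect g) k = coef g (- k)"
  unfolding reflect_def by (simp add: coef_synth wl2_reflect)

lemma sob_fun_reflect: "sob_fun (reflect g) y = sob_fun g (- y)"
proof -
  have "sob_fun (reflect g) y = (\<Sum>\<^sub>\<infinity>k. (\<lambda>k. coef g k * fexp k (- y)) (- k))"
    unfolding reflect_def sob_fun_synth[OF wl2_reflect(1)]
    by (rule infsum_cong) (simp add: fexp_def)
  also have "\<dots> = (\<Sum>\<^sub>\<infinity>k. coef g k * fexp k (- y))"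
    by (rule infsum_reindex_bij_betw[OF bij_uminus])
  also have "\<dots> = sob_fun g (- y)"
    unfolding coef_def by (rule H1_fourier_series[symmetric]) simp
  finally show ?thesis .
qed

lemma bounded_clinear_reflect: "bounded_clinear reflect"
  unfolding reflect_def[abs_def]
  by (rule bounded_clinear_synth) (auto simp: wl2_reflect coef_add coef_scaleC)

lemma reflect_mult: "reflect (g * h) = reflect g * reflect h"
  by (simp add: sob_fun_inject[symmetric] fun_eq_iff sob_fun_mult sob_fun_reflect)

lemma reflect_reflect [simp]: "reflect (reflect g) = g"
  by (rule sobolev_eqI) (simp add: coef_reflect)

lemma bounded_clinear_coef: "bounded_clinear (\<lambda>g. coef g k)"
  unfolding bounded_clinear_def
proof (intro conjI allI)
  show "\<exists>K. \<forall>g. norm (coef g k) \<le> norm g * K"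
    by (rule exI[of _ 1]) (simp add: norm_sobolev_wl2 wl2_component')
qed (simp_all add: coef_add coef_scaleC scaleC_complex_def)

definition emb :: "H10 \<Rightarrow> sobolev"
  where "emb u = Sob (fun_of u)"

lemma sob_fun_emb [simp]: "sob_fun (emb u) = fun_of u"
  unfolding emb_def by (simp add: Sob_inverse)

lemma coef_emb: "coef (emb u) = fourier (fun_of u)"
  by (simp add: coef_def)

lemma bounded_clinear_emb: "bounded_clinear emb"
  unfolding bounded_clinear_def
proof (intro conjI allI)
  show "\<exists>K. \<forall>u. norm (emb u) \<le> norm u * K"
    by (rule exI[of _ 1]) (simp add: norm_sobolev_def norm_H10_def)
qed (simp_all add: sob_fun_inject[symmetric] fun_eq_iff sob_fun_add sob_fun_scaleC fun_of_add
    fun_of_scaleC)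

definition proj :: "sobolev \<Rightarrow> H10"
  where "proj g = Abs_H10 (sob_fun (trunc 1 g))"

lemma emb_proj: "emb (proj g) = trunc 1 g"
proof -
  have "\<forall>k\<le>0. fourier (sob_fun (trunc 1 g)) k = 0"
    using coef_trunc[of 1 g] by (simp add: coef_def)
  then have "fun_of (proj g) = sob_fun (trunc 1 g)"
    unfolding proj_def by (intro Abs_H10_inverse) simp
  then show ?thesis by (simp add: sob_fun_inject[symmetric])
qed

lemma emb_inject: "emb u = emb v \<longleftrightarrow> u = v"
  by (metis fun_of_inject sob_fun_emb)

lemma trunc_emb: "trunc 1 (emb u) = emb u"
  by (rule sobolev_eqI) (simp add: coef_trunc coef_emb)

text \<open>\<open>emb\<close> is linear, injective and isometric, so everything is inherited from
  \<open>trunc 1\<close>.\<close>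

lemma bounded_clinear_proj: "bounded_clinear proj"
proof -
  have emb: "emb (u + v) = emb u + emb v" "emb (c *\<^sub>C u) = c *\<^sub>C emb u" for u v c
    using bounded_clinear_emb unfolding bounded_clinear_def by auto
  have norm: "norm (proj g) = norm (trunc 1 g)" for g
    by (metis emb_proj norm_sobolev_def norm_H10_def sob_fun_emb)
  show ?thesis
    using bounded_clinear_trunc[of 1]
    unfolding bounded_clinear_def by (simp add: emb_inject[symmetric] emb emb_proj norm)
qed

subsection \<open>The pairing\<close>

text \<open>Written in this form the pairing is a composition of bounded operations, so unfolding it
  is enough for derivatives and power series. The sum over indices, recovered in
  \<open>pair_infsum\<close>, gives symmetry and self-adjointness of truncations.\<close>

definition pair :: "sobolev \<Rightarrow> sobolev \<Rightarrow> complex"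
  where "pair g h = coef (reflect g * h) 0"

lemma pairing_eq_pair: "pairing (sob_fun g) (sob_fun h) = pair g h"
proof -
  have "((\<lambda>k. coef h k * coef (reflect g) (0 - k)) has_sum pair g h) UNIV"
    using fourier_mult_has_sum[of "sob_fun h" "sob_fun (reflect g)" 0]
    by (simp add: pair_def coef_def sob_fun_mult[abs_def] continuous_sob_fun mult.commute)
  then have "((\<lambda>k. coef g k * coef h k) has_sum pair g h) UNIV"
    by (simp add: coef_reflect mult.commute)
  then show ?thesis unfolding pairing_def coef_def by (rule infsumI)
qed

lemma pair_infsum: "pair g h = (\<Sum>\<^sub>\<infinity>k. coef g k * coef h k)"
  by (simp add: pairing_eq_pair[symmetric] pairing_def coef_def)

lemma pair_commute: "pair g h = pair h g"
  by (simp add: pair_infsum mult.commute)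

lemma pair_mult_left: "pair (a * g) h = pair g (reflect a * h)"
  by (simp add: pair_def reflect_mult mult_ac)

lemma pair_mult_right: "pair g (a * h) = pair (reflect a * g) h"
  by (simp add: pair_mult_left)

lemma pair_trunc: "pair (trunc m g) h = pair g (trunc m h)"
  unfolding pair_infsum by (rule infsum_cong) (simp add: coef_trunc)

lemma coef_mult_eq_pair: "coef (g * h) 0 = pair (reflect g) h"
  by (simp add: pair_def)

text \<open>\<open>trunc 1\<close> is self-adjoint and fixes \<open>emb u\<close>. Thus a derivative
  represented by any element \<open>g\<close> of the algebra has the gradient
  \<open>proj g\<close>.\<close>

lemma pair_proj: "pair (emb (proj g)) (emb u) = pair g (emb u)"
  by (simp add: emb_proj pair_trunc trunc_emb)

lemma pair_add_left: "pair (g + g') h = pair g h + pair g' h"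
  and pair_add_right: "pair g (h + h') = pair g h + pair g h'"
  and pair_diff_left: "pair (g - g') h = pair g h - pair g' h"
  and pair_diff_right: "pair g (h - h') = pair g h - pair g h'"
  and pair_minus_left: "pair (- g) h = - pair g h"
proof -
  interpret refl: bounded_linear reflect
    by (rule bounded_clinear_imp_bounded_linear[OF bounded_clinear_reflect])
  show "pair (g + g') h = pair g h + pair g' h" "pair g (h + h') = pair g h + pair g h'"
    "pair (g - g') h = pair g h - pair g' h" "pair g (h - h') = pair g h - pair g h'"
    "pair (- g) h = - pair g h"
    by (simp_all add: pair_def refl.add refl.diff refl.neg algebra_simps coef_add coef_diff coef_uminus)
qed

text \<open>Pairing with the character of index k reads off the k-th coefficient. The character may
  be replaced by its projection, which is an admissible test element, and is zero for k \<le>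
  0.\<close>

lemma pair_emb_unique:
  assumes "\<And>u. pair (emb g) (emb u) = pair (emb h) (emb u)"
  shows "g = h"
proof -
  have coef: "pair a (Sob (fexp k)) = coef a k" for a k
  proof -
    have "coef (Sob (fexp k)) j = (if j = k then 1 else 0)" for j
      by (simp add: coef_def Sob_inverse fexp_H1 fourier_fexp)
    then have "pair a (Sob (fexp k)) = (\<Sum>\<^sub>\<infinity>j\<in>{k}. coef a j)"
      unfolding pair_infsum by (intro infsum_cong_neutral) auto
    then show ?thesis by simp
  qed
  have "coef (emb g) k = coef (emb h) k" for k
  proof -
    have "pair (emb a) (Sob (fexp k)) = pair (emb a) (emb (proj (Sob (fexp k))))" for a
      by (simp add: pair_commute[of "emb a"] pair_proj)
    then show ?thesis by (metis assms coef)
  qed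
  then show ?thesis by (simp add: emb_inject[symmetric] sobolev_eqI)
qed

subsection \<open>Reciprocals\<close>

definition nowhere_zero :: "sobolev \<Rightarrow> bool"
  where "nowhere_zero g \<longleftrightarrow> (\<forall>y. sob_fun g y \<noteq> 0)"

text \<open>If \<open>g\<close> has a zero, the pointwise inverse need not lie in \<open>H1\<close>
  and \<open>Sob\<close> may return an unspecified element; hence the recurring hypothesis
  \<open>nowhere_zero\<close>.\<close>

definition recip :: "sobolev \<Rightarrow> sobolev"
  where "recip g = Sob (\<lambda>y. inverse (sob_fun g y))"

lemma sob_fun_recip: "nowhere_zero g \<Longrightarrow> sob_fun (recip g) y = inverse (sob_fun g y)"
  unfolding recip_def nowhere_zero_def by (simp add: Sob_inverse H1_inverse)

lemma mult_recip: "nowhere_zero g \<Longrightarrow> g * recip g = 1"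
  unfolding sob_fun_inject[symmetric]
  by (simp add: fun_eq_iff sob_fun_mult sob_fun_recip sob_fun_one) (simp add: nowhere_zero_def)

text \<open>At a zero of \<open>g + h\<close> the moduli of 1/g and h have product 1, while the sup
  bounds, with constant 3 each, keep the product below 1.\<close>

lemma nowhere_zero_add:
  assumes "nowhere_zero g" "9 * norm (recip g) * norm h < 1"
  shows "nowhere_zero (g + h)"
  unfolding nowhere_zero_def
proof (rule allI, rule notI)
  fix y assume "sob_fun (g + h) y = 0"
  then have "sob_fun h y = - sob_fun g y" by (simp add: sob_fun_add eq_neg_iff_add_eq_0 add.commute)
  then have "cmod (sob_fun (recip g) y) * cmod (sob_fun h y) = 1"
    using assms(1) by (simp add: sob_fun_recip nowhere_zero_def norm_inverse)
  moreover have "cmod (sob_fun (recip g) y) * cmod (sob_fun h y) \<le> (3 * norm (recip g)) * (3 * norm h)"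
    by (intro mult_mono sobolev_sup_bound) auto
  ultimately show False using assms(2) by simp
qed

lemma open_nowhere_zero: "open (Collect nowhere_zero)"
  unfolding open_dist
proof (intro ballI)
  fix g assume g: "g \<in> Collect nowhere_zero"
  show "\<exists>e>0. \<forall>h. dist h g < e \<longrightarrow> h \<in> Collect nowhere_zero"
  proof (intro exI[of _ "1 / (9 * norm (recip g) + 1)"] conjI allI impI)
    fix h assume "dist h g < 1 / (9 * norm (recip g) + 1)"
    then have "norm (h - g) * (9 * norm (recip g) + 1) < 1"
      by (simp add: dist_norm pos_less_divide_eq add_nonneg_pos)
    then have "9 * norm (recip g) * norm (h - g) < 1"
      using norm_ge_zero[of "h - g"] by (simp add: algebra_simps del: norm_ge_zero)
    from nowhere_zero_add[OF _ this] g show "h \<in> Collect nowhere_zero" by simp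
  qed (simp add: add_nonneg_pos)
qed

lemma recip_diff:
  assumes "nowhere_zero g" "nowhere_zero h"
  shows "recip g - recip h = recip g * recip h * (h - g)"
proof -
  have "recip g * recip h * (h - g) = recip g * (h * recip h) - recip h * (g * recip g)"
    by (simp add: algebra_simps)
  then show ?thesis using assms by (simp add: mult_recip)
qed

text \<open>With \<open>v\<close> as the initial factor there is exactly one multiplication, hence
  one \<open>M\<close>, for each of the \<open>n\<close> arguments.\<close>

lemma bounded_clinear_n_mult_prod:
  fixes v :: sobolev
  assumes L: "bounded_clinear L" and K: "\<And>x. norm (L x) \<le> norm x * K" "0 \<le> K"
    and M: "\<And>g h :: sobolev. norm (g * h) \<le> norm g * norm h * M" "0 \<le> M"
  shows "bounded_clinear_n n (norm v * (K * M) ^ n) (\<lambda>x. v * (\<Prod>i<n. L (x i)))"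
proof (induction n)
  case 0
  then show ?case by (simp add: bounded_clinear_n_def)
next
  case (Suc n)
  have first: "bounded_clinear_n 1 K (\<lambda>x. L (x 0))"
    using L K unfolding bounded_clinear_n_def bounded_clinear_def by (auto simp: mult.commute)
  have "bounded_clinear_n (n + 1) (norm v * (K * M) ^ n * K * M)
      (\<lambda>x. (v * (\<Prod>i<n. L (x i))) * L (x (0 + n)))"
    by (rule bounded_clinear_n_bilinear[OF Suc first bounded_cbilinear_sobolev_mult])
      (use M K in auto)
  then show ?case by (simp add: mult_ac)
qed

text \<open>The Neumann series; the remainder is the reciprocal itself times a power.\<close>

lemma power_series_at_recip:
  fixes x :: "'a::complex_normed_vector"
  assumes L: "bounded_clinear L" and nowhere_zero: "nowhere_zero (L x)"
  shows "power_series_at (\<lambda>z. recip (L z)) x"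
proof -
  interpret L: bounded_linear L by (rule bounded_clinear_imp_bounded_linear[OF L])
  define V where "V = recip (L x)"
  \<comment> \<open>The ratio of the geometric series: 1/(L x + L h) = V/(1 - T h).\<close>
  define T where "T z = - V * L z" for z
  have T: "bounded_clinear T"
  proof -
    have "bounded_clinear (\<lambda>g. - V * g)"
      using bounded_cbilinear_sobolev_mult sobolev_mult.bounded_linear_right[of "- V"]
      unfolding bounded_cbilinear_def bounded_clinear_def
      by (metis bounded_linear.bounded)
    from bounded_clinear_compose[OF this L] show ?thesis by (simp add: T_def[abs_def])
  qed
  interpret T: bounded_linear T by (rule bounded_clinear_imp_bounded_linear[OF T])
  obtain M where M: "M > 0" "\<And>g h :: sobolev. norm (g * h) \<le> norm g * norm h * M"
    using sobolev_mult.pos_bounded by blast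
  obtain K where K: "K > 0" "\<And>z. norm (T z) \<le> norm z * K" using T.pos_bounded by blast
  have "open (L -` Collect nowhere_zero)"
    by (intro open_vimage open_nowhere_zero L.continuous_on continuous_on_id)
  then obtain e where e: "e > 0" "\<And>z. dist z x < e \<Longrightarrow> nowhere_zero (L z)"
    using nowhere_zero unfolding open_dist by (metis mem_Collect_eq vimage_eq)
  \<comment> \<open>\<open>e\<close> keeps L (x + h) nowhere zero; the other bound makes each
    further factor T h shrink the norm by 1/2, the constant \<open>M\<close> of multiplication
    included.\<close>
  define r where "r = min e (1 / (2 * (K * M)))"
  have r: "r > 0" "r \<le> e" "K * M * r \<le> 1 / 2"
  proof -
    show "r > 0" "r \<le> e" using e K M by (auto simp: r_def)
    have "K * M * r \<le> K * M * (1 / (2 * (K * M)))"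
      using K M by (intro mult_left_mono) (auto simp: r_def)
    then show "K * M * r \<le> 1 / 2" using K M by simp
  qed
  show ?thesis
  proof (rule power_series_atI[of r "\<lambda>n. norm V * (K * M) ^ n" "\<lambda>n y. V * (\<Prod>i<n. T (y i))"])
    show "r > 0" by (rule r)
    show "0 \<le> norm V * (K * M) ^ n" for n using K M by simp
    show "bounded_clinear_n n (norm V * (K * M) ^ n) (\<lambda>y. V * (\<Prod>i<n. T (y i)))" for n
      by (rule bounded_clinear_n_mult_prod[OF T K(2) _ M(2)]) (use K M in auto)
    have "summable (\<lambda>n. norm V * (K * M * r) ^ n)"
      using K M r by (intro summable_mult summable_geometric) (auto simp: abs_mult)
    then show "summable (\<lambda>n. norm V * (K * M) ^ n * r ^ n)"
      by (simp add: power_mult_distrib mult_ac)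
    fix h :: 'a assume h: "norm h < r"
    have nowhere_zero': "nowhere_zero (L (x + h))" using e(2)[of "x + h"] h r by (simp add: dist_norm)
    define W where "W = recip (L (x + h))"
    have V: "L x * V = 1" using mult_recip[OF nowhere_zero] by (simp add: V_def)
    have W: "(L x + L h) * W = 1" using mult_recip[OF nowhere_zero'] by (simp add: W_def L.add)
    \<comment> \<open>W (1 - T h) = W (L x V + V L h) = V; iterating this identity produces the
      partial sums and their remainder.\<close>
    have step: "V = W - W * T h"
    proof -
      have "W - W * T h = W * (L x * V + V * L h)" by (simp only: V) (simp add: T_def algebra_simps)
      also have "\<dots> = (L x + L h) * W * V" by (simp add: algebra_simps)
      finally show ?thesis using W by simp
    qed
    have partial: "(\<Sum>n<N. V * T h ^ n) = W - W * T h ^ N" for N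
    proof (induction N)
      case (Suc N)
      have "V * T h ^ N = W * T h ^ N - W * T h ^ Suc N"
        by (subst step) (simp add: algebra_simps)
      then show ?case using Suc by simp
    qed simp
    have bound: "norm (W * T h ^ N) \<le> norm W * (1 / 2) ^ N" for N
    proof (induction N)
      case (Suc N)
      have "norm (W * T h ^ Suc N) \<le> norm (W * T h ^ N) * norm (T h) * M"
        using M(2)[of "W * T h ^ N" "T h"] by (simp add: mult_ac)
      also have "\<dots> \<le> (norm W * (1 / 2) ^ N) * (r * K) * M"
        using M(1) K r h by (intro mult_right_mono mult_mono Suc order_trans[OF K(2)]) auto
      also have "\<dots> = (norm W * (1 / 2) ^ N) * (K * M * r)" by (simp add: mult_ac)
      also have "\<dots> \<le> (norm W * (1 / 2) ^ N) * (1 / 2)"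
        by (intro mult_left_mono r) auto
      finally show ?case by simp
    qed simp
    have "(\<lambda>N. norm W * (1 / 2) ^ N) \<longlonglongrightarrow> 0"
      by (intro tendsto_mult_right_zero LIMSEQ_realpow_zero) auto
    then have "(\<lambda>N. W * T h ^ N) \<longlonglongrightarrow> 0"
      by (rule Lim_null_comparison[OF always_eventually[OF allI[OF bound]]])
    from tendsto_diff[OF tendsto_const[of W] this]
    show "(\<lambda>n. V * (\<Prod>i<n. T h)) sums recip (L (x + h))"
      by (simp add: sums_def partial W_def[symmetric])
  qed
qed

text \<open>Applying \<open>recip_diff\<close> twice gives the exact remainder (1/g)^2 (1/h) (h -
  g)^2. It is of second order as soon as 1/h is bounded near \<open>g\<close>, which is the content
  of \<open>near\<close>.\<close>

lemma has_derivative_recip: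
  assumes "nowhere_zero g"
  shows "(recip has_derivative (\<lambda>h. - (recip g * recip g * h))) (at g)"
proof -
  obtain M where M: "M > 0" "\<And>g h :: sobolev. norm (g * h) \<le> norm g * norm h * M"
    using sobolev_mult.pos_bounded by blast
  define a where "a = norm (recip g)"
  obtain e where e: "e > 0" "\<And>h. dist h g < e \<Longrightarrow> nowhere_zero h"
    using open_nowhere_zero assms unfolding open_dist by (metis mem_Collect_eq)
  \<comment> \<open>Chosen so that \<open>a * M * M * norm (h - g) \<le> 1 / 2\<close>: then 1/h -
    1/g has norm at most half that of 1/h, which can be absorbed and leaves the bound
    \<open>2 * a\<close>. The \<open>+ 1\<close> keeps the denominator positive.\<close>
  define d where "d = min e (1 / (2 * (a * M * M + 1)))"
  have a: "0 \<le> a * M * M" using M(1) by (simp add: a_def)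
  have near: "norm (recip h) \<le> 2 * a" if h: "dist h g < d" for h
  proof -
    have u: "nowhere_zero h" using e h by (simp add: d_def)
    have "norm (h - g) * (2 * (a * M * M + 1)) \<le> 1"
    proof -
      have "norm (h - g) < 1 / (2 * (a * M * M + 1))" using h by (simp add: d_def dist_norm)
      then show ?thesis using a by (simp add: pos_less_divide_eq add_nonneg_pos less_imp_le)
    qed
    then have small: "a * M * M * norm (h - g) \<le> 1 / 2"
      using norm_ge_zero[of "h - g"] by (simp add: algebra_simps del: norm_ge_zero)
    have "norm (recip h - recip g) \<le> norm (recip h * recip g) * norm (g - h) * M"
      unfolding recip_diff[OF u assms] by (rule M)
    also have "\<dots> \<le> (norm (recip h) * a * M) * norm (g - h) * M"
      unfolding a_def using M by (intro mult_right_mono) auto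
    also have "\<dots> = norm (recip h) * (a * M * M * norm (h - g))"
      by (simp add: mult_ac norm_minus_commute)
    also have "\<dots> \<le> norm (recip h) * (1 / 2)" by (intro mult_left_mono small) simp
    finally have "norm (recip h - recip g) \<le> norm (recip h) / 2" by simp
    with norm_triangle_sub[of "recip h" "recip g"] show ?thesis by (simp add: a_def)
  qed
  show ?thesis
  proof (rule has_derivativeI_sandwich[where e = d])
    show "d > 0" using e(1) a by (simp add: d_def add_nonneg_pos)
    show "bounded_linear (\<lambda>h. - (recip g * recip g * h))"
      by (intro bounded_linear_minus sobolev_mult.bounded_linear_right)
    show "((\<lambda>h. norm (recip g * recip g) * (2 * a) * M * (norm (h - g) * M) * M) \<longlongrightarrow> 0) (at g)"
    proof -
      have "((\<lambda>h. norm (recip g * recip g) * (2 * a) * M * (norm (h - g) * M) * M) \<longlongrightarrow>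
          norm (recip g * recip g) * (2 * a) * M * (norm (g - g) * M) * M) (at g)"
        by (intro tendsto_intros)
      then show ?thesis by simp
    qed
    fix h assume "h \<in> UNIV" "h \<noteq> g" and h: "dist h g < d"
    then have u: "nowhere_zero h" using e by (simp add: d_def)
    have "recip h - recip g - - (recip g * recip g * (h - g)) = (recip g - recip h) * recip g * (h - g)"
      using recip_diff[OF assms u] recip_diff[OF u assms] by (simp add: algebra_simps)
    also have "\<dots> = recip g * recip g * recip h * (h - g) * (h - g)"
      unfolding recip_diff[OF assms u] by (simp add: mult_ac)
    finally have "norm (recip h - recip g - - (recip g * recip g * (h - g))) =
        norm (recip g * recip g * recip h * (h - g) * (h - g))" by simp
    also have "\<dots> \<le> norm (recip g * recip g * recip h * (h - g)) * norm (h - g) * M" by (rule M)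
    also have "\<dots> \<le> (norm (recip g * recip g * recip h) * norm (h - g) * M) * norm (h - g) * M"
      using M by (intro mult_right_mono) auto
    also have "\<dots> \<le> ((norm (recip g * recip g) * (2 * a) * M) * norm (h - g) * M) * norm (h - g) * M"
    proof (intro mult_right_mono)
      have "norm (recip g * recip g * recip h) \<le> norm (recip g * recip g) * norm (recip h) * M"
        by (rule M)
      also have "\<dots> \<le> norm (recip g * recip g) * (2 * a) * M"
        using M(1) near[OF h] by (intro mult_right_mono mult_left_mono) auto
      finally show "norm (recip g * recip g * recip h) \<le> norm (recip g * recip g) * (2 * a) * M" .
    qed (use M(1) in auto)
    finally show "norm (recip h - recip g - - (recip g * recip g * (h - g))) / norm (h - g)
        \<le> norm (recip g * recip g) * (2 * a) * M * (norm (h - g) * M) * M"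
      using \<open>h \<noteq> g\<close> by (simp add: divide_le_eq mult_ac)
  qed
qed

section \<open>The gradients\<close>

lemmas sobolev_bounded_linear =
  bounded_clinear_imp_bounded_linear[OF bounded_clinear_trunc]
  bounded_clinear_imp_bounded_linear[OF bounded_clinear_reflect]
  bounded_clinear_imp_bounded_linear[OF bounded_clinear_coef]
  bounded_clinear_imp_bounded_linear[OF bounded_clinear_emb]

lemmas sobolev_derivative_intros =
  sobolev_mult.FDERIV sobolev_bounded_linear[THEN bounded_linear.has_derivative]

lemmas sobolev_linear = sobolev_bounded_linear[THEN linear_simps(1)]
  sobolev_bounded_linear[THEN linear_simps(2)] sobolev_bounded_linear[THEN linear_simps(4)]
  reflect_mult

text \<open>
  For \<open>s\<close> the character of index \<open>- (k + 1)\<close>, multiplication by \<open>s\<close> is the (k + 1)-st power of the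
  shift \<open>L\<close> and \<open>comm_op s\<close> is \<open>A\<^sub>k\<close>; \<open>comm_adj s a\<close> is its transpose in the last argument, and \<open>gam\<close> is
  the operator \<open>\<Gamma>\<close>.
\<close>

definition comm_op :: "sobolev \<Rightarrow> sobolev \<Rightarrow> sobolev \<Rightarrow> sobolev"
  where "comm_op s a b = b * trunc 0 (s * a) - a * trunc 0 (s * b)"

definition comm_adj :: "sobolev \<Rightarrow> sobolev \<Rightarrow> sobolev \<Rightarrow> sobolev"
  where "comm_adj s a p = reflect (trunc 0 (s * a)) * p - reflect s * trunc 0 (reflect a * p)"

definition gam :: "sobolev \<Rightarrow> sobolev \<Rightarrow> sobolev"
  where "gam w p = trunc 1 (w * reflect p)"

lemma pair_comm_op: "pair (comm_op s a b) p = pair b (comm_adj s a p)"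
proof -
  have "pair (b * trunc 0 (s * a)) p = pair b (reflect (trunc 0 (s * a)) * p)"
    by (metis mult.commute pair_mult_left)
  moreover have "pair (a * trunc 0 (s * b)) p = pair b (reflect s * trunc 0 (reflect a * p))"
    by (simp add: pair_mult_left pair_trunc)
  ultimately show ?thesis by (simp add: comm_op_def comm_adj_def pair_diff_left pair_diff_right)
qed

text \<open>Antisymmetry reduces transposition in the first argument to \<open>pair_comm_op\<close>,
  which handles the last.\<close>

lemma comm_op_swap: "comm_op s a b = - comm_op s b a"
  by (simp add: comm_op_def)

lemma pair_gam_left: "pair (gam u p) x = pair u (p * trunc 1 x)"
  by (simp add: gam_def pair_trunc mult.commute[of u] pair_mult_left)

text \<open>Reflecting a product leaves its coefficient of index 0 unchanged; this moves the
  reflection off \<open>q\<close>.\<close>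

lemma pair_gam_right: "pair (gam w q) x = pair q (w * reflect (trunc 1 x))"
proof -
  have "pair (gam w q) x = coef (reflect (reflect q * (w * reflect (trunc 1 x)))) 0"
    unfolding gam_def by (subst pair_trunc) (simp add: pair_def reflect_mult mult_ac)
  then show ?thesis by (simp add: pair_def coef_reflect)
qed

lemma nonvanishing_iff_nowhere_zero: "w \<in> nonvanishing \<longleftrightarrow> nowhere_zero (emb w)"
  by (simp add: nonvanishing_def nowhere_zero_def)

lemma open_nonvanishing: "open nonvanishing"
proof -
  have "nonvanishing = emb -` Collect nowhere_zero"
    by (auto simp: nonvanishing_iff_nowhere_zero)
  then show ?thesis
    using open_vimage[OF open_nowhere_zero linear_continuous_on[OF sobolev_bounded_linear(4)]] by simp
qed

section \<open>The Hamiltonians as expressions in the algebra\<close>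

lemma funpow_shift: "(shift ^^ n) h y = h y * fexp (- int n) y"
proof (induction n)
  case (Suc n)
  have "(shift ^^ Suc n) h y = (shift ^^ n) h y * fexp (- 1) y"
    by (simp add: shift_def[of "(shift ^^ n) h"])
  also have "\<dots> = h y * (fexp (- int n) y * fexp (- 1) y)"
    by (simp only: Suc mult.assoc)
  also have "fexp (- int n) y * fexp (- 1) y = fexp (- int (Suc n)) y"
    by (simp only: fexp_mult) (simp add: algebra_simps)
  finally show ?case .
qed simp

definition char_fun :: "int \<Rightarrow> sobolev"
  where "char_fun m = Sob (fexp m)"

lemma sob_fun_char: "sob_fun (char_fun m) y = fexp m y"
  by (simp add: char_fun_def Sob_inverse fexp_H1)

text \<open>Moves the coefficient of index k + 1 in \<open>J_fun\<close> to index 0, where the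
  pairing lives; the character needed is the same \<open>s\<close> that encodes the shifts.\<close>

lemma coef_char_mult: "coef (char_fun (- m) * g) 0 = coef g m"
  by (simp add: coef_def fourier_def sob_fun_mult sob_fun_char mult.commute)

lemma funpow_shift_sob: "(shift ^^ (k + 1)) (sob_fun g) = sob_fun (char_fun (- (int k + 1)) * g)"
  by (rule ext) (simp only: funpow_shift sob_fun_mult sob_fun_char mult.commute of_nat_add of_nat_1)

context
  fixes f :: "real \<Rightarrow> complex"
  assumes f: "f \<in> H1"
begin

lemma quotient_eq_sob:
  "nowhere_zero g \<Longrightarrow> (\<lambda>y. f y / sob_fun g y) = sob_fun (Sob f * recip g)"
  by (simp add: fun_eq_iff sob_fun_mult Sob_inverse[OF f] sob_fun_recip divide_inverse)

lemma H_fun_eq: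
  assumes "nowhere_zero (emb w)"
  shows "H_fun f (w, p) =
    pair (emb w) (emb p * emb p) + coef (Sob f * recip (emb w)) 0"
proof -
  have "(\<lambda>y. (fun_of p y)\<^sup>2) = sob_fun (emb p * emb p)"
    by (simp add: fun_eq_iff sob_fun_mult power2_eq_square)
  moreover have "integral {0..1} (\<lambda>y. f y / fun_of w y) = coef (Sob f * recip (emb w)) 0"
    using quotient_eq_sob[OF assms] by (simp add: coef_def fourier_def)
  ultimately show ?thesis
    using pairing_eq_pair[of "emb w" "emb p * emb p"] by (simp add: H_fun_def)
qed

lemma J_fun_eq:
  fixes k :: nat
  assumes "nowhere_zero (emb w)"
  defines "s \<equiv> char_fun (- (int k + 1))"
  shows "J_fun f k (w, p) =
    pair (comm_op s (emb w) (gam (emb w) (emb p))) (emb p)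
    - coef (s * (emb w * trunc 1 (Sob f * recip (emb w)))) 0"
proof -
  have A: "A_op k (sob_fun a) (sob_fun b) = sob_fun (comm_op s a b)" for a b
    unfolding A_op_def funpow_shift_sob Pi_plus_eq_trunc
    by (simp add: fun_eq_iff s_def comm_op_def sob_fun_diff sob_fun_mult)
  have "(\<lambda>y. sob_fun a y * sob_fun b (- y)) = sob_fun (a * reflect b)" for a b
    by (simp add: fun_eq_iff sob_fun_mult sob_fun_reflect)
  then have G: "Gamma_op (sob_fun a) (sob_fun b) = sob_fun (gam a b)" for a b
    by (simp add: Gamma_op_def Pi_plus0_eq_trunc gam_def)
  have "fourier (\<lambda>y. sob_fun (emb w) y * Pi_plus0 (\<lambda>y. f y / sob_fun (emb w) y) y) (int k + 1) =
      coef (emb w * trunc 1 (Sob f * recip (emb w))) (int k + 1)"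
    unfolding quotient_eq_sob[OF assms(1)] Pi_plus0_eq_trunc coef_def
    by (simp add: sob_fun_mult[abs_def])
  also have "\<dots> = coef (s * (emb w * trunc 1 (Sob f * recip (emb w)))) 0"
    unfolding s_def by (rule coef_char_mult[symmetric])
  finally show ?thesis
    using A[of "emb w" "gam (emb w) (emb p)"] G[of "emb w" "emb p"]
      pairing_eq_pair[of "comm_op s (emb w) (gam (emb w) (emb p))" "emb p"]
    by (simp add: J_fun_def)
qed

end

section \<open>Explicit gradients and their verification\<close>

definition grad_H_p :: "H10 \<times> H10 \<Rightarrow> H10" where
  "grad_H_p z = proj (reflect (emb (snd z)) * emb (fst z) + reflect (emb (snd z)) * emb (fst z))"

definition grad_H_w :: "sobolev \<Rightarrow> H10 \<times> H10 \<Rightarrow> H10" where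
  "grad_H_w \<phi> z = proj (emb (snd z) * emb (snd z) -
     reflect (\<phi> * (recip (emb (fst z)) * recip (emb (fst z)))))"

text \<open>The first summand comes from the \<open>p\<close> inside \<open>gam\<close>, the second
  from the \<open>p\<close> in the outer slot of the pairing.\<close>

definition grad_J_p :: "sobolev \<Rightarrow> H10 \<times> H10 \<Rightarrow> H10" where
  "grad_J_p s z = (let w = emb (fst z); p = emb (snd z) in
     proj (w * reflect (trunc 1 (comm_adj s w p)) + comm_op s w (gam w p)))"

text \<open>One term for each occurrence of \<open>w\<close>, in this order: inside
  \<open>gam\<close>, as argument of A_k, as explicit factor of the coefficient term, and in the
  quotient f/w.\<close>

definition grad_J_w :: "sobolev \<Rightarrow> sobolev \<Rightarrow> H10 \<times> H10 \<Rightarrow> H10" where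
  "grad_J_w s \<phi> z = (let w = emb (fst z); p = emb (snd z); v = recip w in
     proj (p * trunc 1 (comm_adj s w p) - comm_adj s (gam w p) p
       - (reflect (s * trunc 1 (\<phi> * v)) - trunc 1 (reflect (s * w)) * reflect (\<phi> * (v * v)))))"

lemma has_derivative_recip_emb:
  "nowhere_zero (emb w) \<Longrightarrow>
     ((\<lambda>w. recip (emb w)) has_derivative (\<lambda>u. - (recip (emb w) * recip (emb w) * emb u))) (at w)"
  by (rule has_derivative_compose[OF bounded_linear.has_derivative[OF sobolev_bounded_linear(4) has_derivative_ident]
        has_derivative_recip])

text \<open>The algebraic expressions match the Hamiltonians where \<open>w\<close> is nowhere zero;
  that set is open, so derivatives carry over.\<close>

lemma has_derivative_nonvanishing_cong:
  assumes "nowhere_zero (emb w)" "(G has_derivative D) (at w)" "\<And>w. nowhere_zero (emb w) \<Longrightarrow> F w = G w"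
  shows "(F has_derivative D) (at w)"
  by (rule has_derivative_transform_within_open[OF assms(2) open_nonvanishing])
    (use assms in \<open>simp_all add: nonvanishing_iff_nowhere_zero\<close>)

text \<open>\<open>g\<close> may have coefficients at all indices: by \<open>pair_proj\<close> the
  nonpositive ones are invisible to \<open>emb u\<close>.\<close>

lemma is_gradI_w:
  assumes "nowhere_zero (emb w)" "\<And>w. nowhere_zero (emb w) \<Longrightarrow> F (w, p) = G w"
    and "(G has_derivative D) (at w)" "\<And>u. D u = pair g (emb u)"
  shows "is_grad_w F (w, p) (proj g)"
proof -
  have "pairing (fun_of (proj g)) (fun_of u) = D u" for u
    using pairing_eq_pair[of "emb (proj g)" "emb u"] by (simp add: pair_proj assms(4))
  then have "(\<lambda>u. pairing (fun_of (proj g)) (fun_of u)) = D" by blast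
  then show ?thesis
    using has_derivative_nonvanishing_cong[OF assms(1,3), of "\<lambda>w. F (w, p)"] assms(2)
    by (simp add: is_grad_w_def)
qed

lemma is_gradI_p:
  assumes "\<And>p. F (w, p) = G p" "(G has_derivative D) (at p)" "\<And>u. D u = pair g (emb u)"
  shows "is_grad_p F (w, p) (proj g)"
proof -
  have "pairing (fun_of (proj g)) (fun_of u) = D u" for u
    using pairing_eq_pair[of "emb (proj g)" "emb u"] by (simp add: pair_proj assms(3))
  then have "(\<lambda>u. pairing (fun_of (proj g)) (fun_of u)) = D" by blast
  then show ?thesis using assms(1,2) by (simp add: is_grad_p_def)
qed

lemma is_grad_p_H:
  assumes "f \<in> H1" "nowhere_zero (emb w)"
  shows "is_grad_p (H_fun f) (w, p) (grad_H_p (w, p))"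
  unfolding grad_H_p_def fst_conv snd_conv
proof (rule is_gradI_p)
  show "H_fun f (w, q) = pair (emb w) (emb q * emb q) + coef (Sob f * recip (emb w)) 0" for q
    by (rule H_fun_eq[OF assms])
  let ?D = "\<lambda>q. pair (emb w) (emb p * emb q + emb q * emb p)"
  show "((\<lambda>q. pair (emb w) (emb q * emb q) + coef (Sob f * recip (emb w)) 0) has_derivative ?D) (at p)"
    unfolding pair_def
    by (rule derivative_eq_intros sobolev_derivative_intros refl)+ (simp add: algebra_simps)
  fix q
  have "pair (emb w) (emb p * emb q) = pair (reflect (emb p) * emb w) (emb q)"
    by (rule pair_mult_right)
  then show "?D q = pair (reflect (emb p) * emb w + reflect (emb p) * emb w) (emb q)"
    by (simp only: pair_add_left pair_add_right mult.commute[of "emb q"])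
qed

lemma is_grad_w_H:
  assumes "f \<in> H1" "nowhere_zero (emb w)"
  shows "is_grad_w (H_fun f) (w, p) (grad_H_w (Sob f) (w, p))"
  unfolding grad_H_w_def fst_conv snd_conv
proof (rule is_gradI_w[OF assms(2)])
  show "H_fun f (w', p) = pair (emb w') (emb p * emb p) + coef (Sob f * recip (emb w')) 0"
    if "nowhere_zero (emb w')" for w'
    by (rule H_fun_eq[OF assms(1) that])
  let ?v = "recip (emb w)"
  let ?D = "\<lambda>u. pair (emb u) (emb p * emb p) - coef (Sob f * (?v * ?v) * emb u) 0"
  show "((\<lambda>w. pair (emb w) (emb p * emb p) + coef (Sob f * recip (emb w)) 0) has_derivative ?D) (at w)"
    unfolding pair_def
    by (rule derivative_eq_intros sobolev_derivative_intros has_derivative_recip_emb[OF assms(2)]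
        refl)+ (simp add: algebra_simps sobolev_linear)
  show "?D u = pair (emb p * emb p - reflect (Sob f * (?v * ?v))) (emb u)" for u
    by (simp add: pair_diff_left coef_mult_eq_pair[of "Sob f * (?v * ?v)"] pair_commute[of "emb u"])
qed

lemma comm_derivative_right:
  "pair (comm_op s w (gam w q)) p + pair (comm_op s w (gam w p)) q =
     pair (w * reflect (trunc 1 (comm_adj s w p)) + comm_op s w (gam w p)) q"
proof -
  have "pair (comm_op s w (gam w q)) p = pair q (w * reflect (trunc 1 (comm_adj s w p)))"
    by (simp only: pair_comm_op pair_gam_right)
  then show ?thesis by (simp only: pair_add_left pair_commute[of q])
qed

text \<open>The two terms are the variations of \<open>w\<close> in A_k and in \<open>gam\<close>.
  The first is transposed after exchanging arguments by \<open>comm_op_swap\<close>, the second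
  through \<open>comm_adj\<close> followed by \<open>pair_gam_left\<close>.\<close>

lemma comm_derivative_left:
  "pair (comm_op s u (gam w p)) p + pair (comm_op s w (gam u p)) p =
     pair (p * trunc 1 (comm_adj s w p) - comm_adj s (gam w p) p) u"
proof -
  have "pair (comm_op s u (gam w p)) p = - pair u (comm_adj s (gam w p) p)"
    by (simp only: comm_op_swap[of s u] pair_minus_left pair_comm_op)
  moreover have "pair (comm_op s w (gam u p)) p = pair u (p * trunc 1 (comm_adj s w p))"
    by (simp only: pair_comm_op pair_gam_left)
  ultimately show ?thesis by (simp add: pair_diff_left pair_commute[of u])
qed

text \<open>Applied with \<open>g\<close> = f/w and \<open>h\<close> = f/w^2: the left side is the
  variation of the coefficient term, its minus sign being that of the derivative of 1/w.\<close>

lemma trunc_derivative: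
  "coef (s * u * trunc 1 g) 0 - coef (s * w * trunc 1 (h * u)) 0 =
     pair (reflect (s * trunc 1 g) - trunc 1 (reflect (s * w)) * reflect h) u"
proof -
  have "coef (s * u * trunc 1 g) 0 = pair (reflect (s * trunc 1 g)) u"
    by (simp add: pair_def mult_ac)
  moreover have "coef (s * w * trunc 1 (h * u)) 0 = pair (trunc 1 (reflect (s * w)) * reflect h) u"
    by (simp add: coef_mult_eq_pair[of "s * w"] pair_trunc[symmetric] pair_mult_right[of _ h]
        mult.commute)
  ultimately show ?thesis by (simp add: pair_diff_left)
qed

lemma is_grad_p_J:
  fixes k :: nat
  assumes "f \<in> H1" "nowhere_zero (emb w)"
  shows "is_grad_p (J_fun f k) (w, p) (grad_J_p (char_fun (- (int k + 1))) (w, p))"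
  unfolding grad_J_p_def fst_conv snd_conv Let_def
proof (rule is_gradI_p)
  let ?s = "char_fun (- (int k + 1))" and ?w = "emb w" and ?p = "emb p"
  show "J_fun f k (w, q) = pair (comm_op ?s ?w (gam ?w (emb q))) (emb q) -
      coef (?s * (?w * trunc 1 (Sob f * recip ?w))) 0" for q
    by (rule J_fun_eq[OF assms])
  let ?D = "\<lambda>q. pair (comm_op ?s ?w (gam ?w (emb q))) ?p + pair (comm_op ?s ?w (gam ?w ?p)) (emb q)"
  show "((\<lambda>p. pair (comm_op ?s ?w (gam ?w (emb p))) (emb p) -
      coef (?s * (?w * trunc 1 (Sob f * recip ?w))) 0) has_derivative ?D) (at p)"
    unfolding pair_def comm_op_def gam_def
    by (rule derivative_eq_intros sobolev_derivative_intros refl)+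
      (simp add: algebra_simps sobolev_linear)
  show "?D q = pair (?w * reflect (trunc 1 (comm_adj ?s ?w ?p)) + comm_op ?s ?w (gam ?w ?p)) (emb q)" for q
    by (rule comm_derivative_right)
qed

lemma is_grad_w_J:
  fixes k :: nat
  assumes "f \<in> H1" "nowhere_zero (emb w)"
  shows "is_grad_w (J_fun f k) (w, p) (grad_J_w (char_fun (- (int k + 1))) (Sob f) (w, p))"
  unfolding grad_J_w_def fst_conv snd_conv Let_def
proof (rule is_gradI_w[OF assms(2)])
  let ?s = "char_fun (- (int k + 1))" and ?\<phi> = "Sob f" and ?w = "emb w" and ?p = "emb p"
  show "J_fun f k (w', p) = pair (comm_op ?s (emb w') (gam (emb w') ?p)) ?p -
      coef (?s * (emb w' * trunc 1 (?\<phi> * recip (emb w')))) 0"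
    if "nowhere_zero (emb w')" for w'
    by (rule J_fun_eq[OF assms(1) that])
  let ?v = "recip ?w"
  let ?D = "\<lambda>u. pair (comm_op ?s (emb u) (gam ?w ?p)) ?p + pair (comm_op ?s ?w (gam (emb u) ?p)) ?p
      - (coef (?s * emb u * trunc 1 (?\<phi> * ?v)) 0 - coef (?s * ?w * trunc 1 (?\<phi> * (?v * ?v) * emb u)) 0)"
  show "((\<lambda>w. pair (comm_op ?s (emb w) (gam (emb w) ?p)) ?p -
      coef (?s * (emb w * trunc 1 (?\<phi> * recip (emb w)))) 0) has_derivative ?D) (at w)"
    unfolding pair_def comm_op_def gam_def
    by (rule derivative_eq_intros sobolev_derivative_intros has_derivative_recip_emb[OF assms(2)]
        refl)+ (simp add: algebra_simps sobolev_linear)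
  show "?D u = pair (?p * trunc 1 (comm_adj ?s ?w ?p) - comm_adj ?s (gam ?w ?p) ?p
      - (reflect (?s * trunc 1 (?\<phi> * ?v)) - trunc 1 (reflect (?s * ?w)) * reflect (?\<phi> * (?v * ?v)))) (emb u)"
    for u
    unfolding pair_diff_left[of "_ - _" "_ - _"] comm_derivative_left trunc_derivative ..
qed

lemma is_grad_w_unique: "is_grad_w F z g \<Longrightarrow> is_grad_w F z h \<Longrightarrow> g = h"
  and is_grad_p_unique: "is_grad_p F z g \<Longrightarrow> is_grad_p F z h \<Longrightarrow> g = h"
proof -
  have *: "g = h" if "(\<lambda>u. pairing (fun_of g) (fun_of u)) = (\<lambda>u. pairing (fun_of h) (fun_of u))"
  proof (rule pair_emb_unique)
    show "pair (emb g) (emb u) = pair (emb h) (emb u)" for u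
      using fun_cong[OF that, of u] pairing_eq_pair[of "emb _" "emb u"] by simp
  qed
  show "is_grad_w F z g \<Longrightarrow> is_grad_w F z h \<Longrightarrow> g = h"
    unfolding is_grad_w_def by (rule *) (rule has_derivative_unique)
  show "is_grad_p F z g \<Longrightarrow> is_grad_p F z h \<Longrightarrow> g = h"
    unfolding is_grad_p_def by (rule *) (rule has_derivative_unique)
qed

text \<open>Uniqueness identifies the values of \<open>THE\<close> on \<open>U\<close> with
  \<open>gw\<close> and \<open>gp\<close>. The field is then a sum of two analytic maps, through the
  linear injections of \<open>gp\<close> into the first and of \<open>- gw\<close> into the second
  component.\<close>

lemma ham_vf_analytic:
  assumes "open U" and w: "\<And>z. z \<in> U \<Longrightarrow> is_grad_w F z (gw z)"
    and p: "\<And>z. z \<in> U \<Longrightarrow> is_grad_p F z (gp z)"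
    and "\<And>z. z \<in> U \<Longrightarrow> power_series_at gw z" "\<And>z. z \<in> U \<Longrightarrow> power_series_at gp z"
  shows "ham_vf_well_defined_on U F \<and> complex_analytic_on U (ham_vf F)"
proof
  show "ham_vf_well_defined_on U F"
    unfolding ham_vf_well_defined_on_def
    using w p is_grad_w_unique is_grad_p_unique by metis
  have grad: "grad_w F z = gw z" "grad_p F z = gp z" if "z \<in> U" for z
    unfolding grad_w_def grad_p_def
    using w[OF that] p[OF that] is_grad_w_unique is_grad_p_unique by blast+
  have inj: "bounded_clinear (\<lambda>a :: H10. (a, 0 :: H10))" "bounded_clinear (\<lambda>a :: H10. (0 :: H10, - a))"
    unfolding bounded_clinear_def
    by (intro conjI allI exI[of _ 1]; simp add: scaleC_prod_def scaleC_minus_right norm_Pair)+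
  have "power_series_at (\<lambda>z. (gp z, 0) + (0, - gw z)) z" if "z \<in> U" for z
    by (rule power_series_at_add[OF power_series_at_compose_clinear[OF inj(1) assms(5)[OF that]]
          power_series_at_compose_clinear[OF inj(2) assms(4)[OF that]]])
  then show "complex_analytic_on U (ham_vf F)"
    by (rule power_series_at_imp_analytic_on[OF assms(1)]) (simp_all add: ham_vf_def grad)
qed

section \<open>Analyticity\<close>

lemma bounded_clinear_fst: "bounded_clinear (fst :: 'a::complex_normed_vector \<times> 'b::complex_normed_vector \<Rightarrow> 'a)"
  and bounded_clinear_snd: "bounded_clinear (snd :: 'a \<times> 'b \<Rightarrow> 'b)"
  unfolding bounded_clinear_def
  by (auto simp: scaleC_prod_def norm_fst_le norm_snd_le intro!: exI[of _ 1])

text \<open>Reciprocals occur only as \<open>recip (emb (fst z))\<close>, the reciprocal of a linear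
  map; the rule for \<open>recip\<close> along linear maps thus takes the place of a composition
  theorem for power series.\<close>

lemmas power_series_at_intros =
  power_series_at_const power_series_at_add
  power_series_at_bilinear[OF bounded_cbilinear_sobolev_mult]
  power_series_at_compose_clinear[OF bounded_clinear_trunc]
  power_series_at_compose_clinear[OF bounded_clinear_reflect]
  power_series_at_compose_clinear[OF bounded_clinear_coef]
  power_series_at_compose_clinear[OF bounded_clinear_proj]
  power_series_at_clinear[OF bounded_clinear_compose[OF bounded_clinear_emb bounded_clinear_fst]]
  power_series_at_clinear[OF bounded_clinear_compose[OF bounded_clinear_emb bounded_clinear_snd]]
  power_series_at_recip[OF bounded_clinear_compose[OF bounded_clinear_emb bounded_clinear_fst]]

lemma power_series_at_diff:
  assumes "power_series_at F x" "power_series_at G x"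
  shows "power_series_at (\<lambda>z. F z - G z) x"
proof -
  have "bounded_clinear (\<lambda>g. - g :: 'b)"
    unfolding bounded_clinear_def by (auto simp: scaleC_minus_right intro!: exI[of _ 1])
  from power_series_at_add[OF assms(1) power_series_at_compose_clinear[OF this assms(2)]]
  show ?thesis by simp
qed

theorem corollary7p1:
  fixes f :: "real \<Rightarrow> complex"
  assumes "f \<in> H1"
  shows "(complex_analytic_on (nonvanishing \<times> UNIV) (H_fun f) \<and>
          (\<forall>k\<ge>1. complex_analytic_on (nonvanishing \<times> UNIV) (J_fun f k))) \<and>
         (ham_vf_well_defined_on (nonvanishing \<times> UNIV) (H_fun f) \<and>
          complex_analytic_on (nonvanishing \<times> UNIV) (ham_vf (H_fun f)) \<and>
          (\<forall>k\<ge>1. ham_vf_well_defined_on (nonvanishing \<times> UNIV) (J_fun f k) \<and>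
                 complex_analytic_on (nonvanishing \<times> UNIV) (ham_vf (J_fun f k))))"
proof -
  let ?U = "nonvanishing \<times> UNIV :: (H10 \<times> H10) set"
  have U: "open ?U" by (intro open_Times open_nonvanishing open_UNIV)
  have nowhere_zero: "nowhere_zero (emb (fst z))" if "z \<in> ?U" for z
    using that by (auto simp: nonvanishing_iff_nowhere_zero)
  \<comment> \<open>Once \<open>defs\<close> is unfolded, Hamiltonians and gradients consist of
    operations covered by \<open>ps\<close>; the side condition left is that \<open>w\<close> is
    nowhere zero.\<close>
  note ps = power_series_at_intros power_series_at_diff
  note defs = pair_def comm_op_def comm_adj_def gam_def Let_def
  have "complex_analytic_on ?U (H_fun f)"
  proof (rule power_series_at_imp_analytic_on[OF U])
    show "H_fun f z = pair (emb (fst z)) (emb (snd z) * emb (snd z))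
        + coef (Sob f * recip (emb (fst z))) 0" if "z \<in> ?U" for z
      using H_fun_eq[OF assms nowhere_zero[OF that], of "snd z"] by simp
  qed (unfold defs, intro ps nowhere_zero)
  moreover have "complex_analytic_on ?U (J_fun f k)" for k
  proof (rule power_series_at_imp_analytic_on[OF U])
    let ?s = "char_fun (- (int k + 1))"
    show "J_fun f k z = pair (comm_op ?s (emb (fst z)) (gam (emb (fst z)) (emb (snd z)))) (emb (snd z))
        - coef (?s * (emb (fst z) * trunc 1 (Sob f * recip (emb (fst z))))) 0" if "z \<in> ?U" for z
      using J_fun_eq[OF assms nowhere_zero[OF that], of k "snd z"] by simp
  qed (unfold defs, intro ps nowhere_zero)
  moreover have "ham_vf_well_defined_on ?U (H_fun f) \<and> complex_analytic_on ?U (ham_vf (H_fun f))"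
  proof (rule ham_vf_analytic[OF U])
    fix z assume z: "z \<in> ?U"
    show "is_grad_w (H_fun f) z (grad_H_w (Sob f) z)" "is_grad_p (H_fun f) z (grad_H_p z)"
      using is_grad_w_H[OF assms nowhere_zero[OF z], of "snd z"] is_grad_p_H[OF assms nowhere_zero[OF z], of "snd z"]
      by simp_all
    show "power_series_at (grad_H_w (Sob f)) z" "power_series_at grad_H_p z"
      unfolding grad_H_w_def[abs_def] grad_H_p_def[abs_def] by (intro ps nowhere_zero[OF z])+
  qed
  moreover have "ham_vf_well_defined_on ?U (J_fun f k) \<and> complex_analytic_on ?U (ham_vf (J_fun f k))" for k
  proof (rule ham_vf_analytic[OF U])
    let ?s = "char_fun (- (int k + 1))"
    fix z assume z: "z \<in> ?U"
    show "is_grad_w (J_fun f k) z (grad_J_w ?s (Sob f) z)" "is_grad_p (J_fun f k) z (grad_J_p ?s z)"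
      using is_grad_w_J[OF assms nowhere_zero[OF z], of k "snd z"] is_grad_p_J[OF assms nowhere_zero[OF z], of k "snd z"]
      by simp_all
    show "power_series_at (grad_J_w ?s (Sob f)) z" "power_series_at (grad_J_p ?s) z"
      unfolding grad_J_w_def[abs_def] grad_J_p_def[abs_def] defs by (intro ps nowhere_zero[OF z])+
  qed
  ultimately show ?thesis by blast
qed

end
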